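(* Let $\mathcal{A}$ be a Grothendieck category. 1. A functor $F$ of $\mathbf{Fct}(\Theta,\mathcal{A})$ is of finite type if and only if there exists an integer $n$ such that $F$ is generated in cardinality at most $n$ and $F$ takes values of finite type in $\mathcal{A}$. (In this criterion one may moreover restrict the condition on values to the values on $\mathbf{i}$ for $i\le n$.) 2. Every functor of finite type of $\mathbf{Fct}(\Theta,\mathcal{A})$ is strongly polynomial. 3. Every functor of $\mathbf{Fct}(\Theta,\mathcal{A})$ that is strongly polynomial and takes values of finite type is of finite type.
   Context: $\Theta$ is the category of finite sets with injections (skeleton with objects $\mathbf{n}=\{1,\dots,n\}$, $n\in\mathbb{N}$), symmetric monoidal for disjoint union $\oplus$, with unit $0=\emptyset$ initial. $\mathbf{Fct}(\Theta,\mathcal{A})$ is the category of functors $\Theta\to\mathcal{A}$. An object $A$ of an abelian category is of finite type if every increasing filtered family of subobjects of $A$ with union $A$ is stationary. A functor $F:\Theta\to\mathcal{A}$ is generated in cardinality at most $n$ if every subfunctor $G$ of $F$ such that the inclusion $G(\mathbf{i})\subset F(\mathbf{i})$ is an equality for all $i\le n$ is equal to $F$. For an object $x$ of $\Theta$, $\delta_x(F)$ is the cokernel of the map $F\to F(x\oplus-)$ induced by $0\to x$. Full subcategories $\mathcal{P}ol_n^{\rm fort}(\Theta,\mathcal{A})$ of $\mathbf{Fct}(\Theta,\mathcal{A})$ are defined inductively: $\{0\}$ for $n<0$; for $n\ge 0$, the $F$ with $\delta_x(F)\in\mathcal{P}ol^{\rm fort}_{n-1}(\Theta,\mathcal{A})$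 for every object $x$. $F$ is strongly polynomial if it belongs to some $\mathcal{P}ol^{\rm fort}_n(\Theta,\mathcal{A})$. *)

theory Defs
  imports "HOL-Algebra.Group" "HOL-Library.Equipollence" "HOL-Library.FuncSet"
begin

section \<open>Categories\<close>

text \<open>\<open>Comp C g f\<close> is the composite \<open>g \<circ> f\<close>; it is meaningful only if \<open>Dom C g = Cod C f\<close>.\<close>

record ('o, 'm) category =
  Ob :: "'o set"
  Ar :: "'m set"
  Dom :: "'m \<Rightarrow> 'o"
  Cod :: "'m \<Rightarrow> 'o"
  Id :: "'o \<Rightarrow> 'm"
  Comp :: "'m \<Rightarrow> 'm \<Rightarrow> 'm"

definition Hom :: "('o, 'm) category \<Rightarrow> 'o \<Rightarrow> 'o \<Rightarrow> 'm set" where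
  "Hom C X Y = {f \<in> Ar C. Dom C f = X \<and> Cod C f = Y}"

definition is_category :: "('o, 'm) category \<Rightarrow> bool" where
  "is_category C \<longleftrightarrow>
     (\<forall>f\<in>Ar C. Dom C f \<in> Ob C \<and> Cod C f \<in> Ob C) \<and>
     (\<forall>X\<in>Ob C. Id C X \<in> Hom C X X) \<and>
     (\<forall>X Y Z f g. f \<in> Hom C X Y \<and> g \<in> Hom C Y Z \<longrightarrow> Comp C g f \<in> Hom C X Z) \<and>
     (\<forall>X Y f. f \<in> Hom C X Y \<longrightarrow> Comp C f (Id C X) = f \<and> Comp C (Id C Y) f = f) \<and>
     (\<forall>W X Y Z f g h. f \<in> Hom C W X \<and> g \<in> Hom C X Y \<and> h \<in> Hom C Y Z \<longrightarrow>
        Comp C h (Comp C g f) = Comp C (Comp C h g) f)"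

definition is_iso :: "('o, 'm) category \<Rightarrow> 'm \<Rightarrow> bool" where
  "is_iso C f \<longleftrightarrow> f \<in> Ar C \<and>
     (\<exists>g\<in>Hom C (Cod C f) (Dom C f). Comp C g f = Id C (Dom C f) \<and> Comp C f g = Id C (Cod C f))"

definition is_mono :: "('o, 'm) category \<Rightarrow> 'm \<Rightarrow> bool" where
  "is_mono C f \<longleftrightarrow> f \<in> Ar C \<and>
     (\<forall>W. \<forall>g\<in>Hom C W (Dom C f). \<forall>h\<in>Hom C W (Dom C f). Comp C f g = Comp C f h \<longrightarrow> g = h)"

definition is_epi :: "('o, 'm) category \<Rightarrow> 'm \<Rightarrow> bool" where
  "is_epi C f \<longleftrightarrow> f \<in> Ar C \<and>
     (\<forall>Z. \<forall>g\<in>Hom C (Cod C f) Z. \<forall>h\<in>Hom C (Cod C f) Z. Comp C g f = Comp C h f \<longrightarrow> g = h)"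

definition is_zero_object :: "('o, 'm) category \<Rightarrow> 'o \<Rightarrow> bool" where
  "is_zero_object C Z \<longleftrightarrow> Z \<in> Ob C \<and>
     (\<forall>X\<in>Ob C. (\<exists>!f. f \<in> Hom C Z X) \<and> (\<exists>!f. f \<in> Hom C X Z))"

definition is_zero_arrow :: "('o, 'm) category \<Rightarrow> 'm \<Rightarrow> bool" where
  "is_zero_arrow C f \<longleftrightarrow> f \<in> Ar C \<and>
     (\<exists>Z g h. is_zero_object C Z \<and> g \<in> Hom C (Dom C f) Z \<and> h \<in> Hom C Z (Cod C f) \<and> f = Comp C h g)"

definition is_kernel :: "('o, 'm) category \<Rightarrow> 'm \<Rightarrow> 'm \<Rightarrow> bool" where
  "is_kernel C f k \<longleftrightarrow> k \<in> Ar C \<and> Cod C k = Dom C f \<and> is_zero_arrow C (Comp C f k) \<and>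
     (\<forall>W. \<forall>g\<in>Hom C W (Dom C f). is_zero_arrow C (Comp C f g) \<longrightarrow>
        (\<exists>!h. h \<in> Hom C W (Dom C k) \<and> Comp C k h = g))"

definition is_cokernel :: "('o, 'm) category \<Rightarrow> 'm \<Rightarrow> 'm \<Rightarrow> bool" where
  "is_cokernel C f q \<longleftrightarrow> q \<in> Ar C \<and> Dom C q = Cod C f \<and> is_zero_arrow C (Comp C q f) \<and>
     (\<forall>Z. \<forall>g\<in>Hom C (Cod C f) Z. is_zero_arrow C (Comp C g f) \<longrightarrow>
        (\<exists>!h. h \<in> Hom C (Cod C q) Z \<and> Comp C h q = g))"

section \<open>Subobjects and objects of finite type\<close>

text \<open>A subobject is represented by any monomorphism in its class; \<open>sub_le\<close> is a preorder on these
  representatives, two of which define the same subobject iff each is below the other. Unions and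
  intersections are suprema and infima for it; in a Grothendieck category they exist, and the
  supremum of a family is the image of the canonical map from its coproduct.\<close>

definition subobjects :: "('o, 'm) category \<Rightarrow> 'o \<Rightarrow> 'm set" where
  "subobjects C X = {s. is_mono C s \<and> Cod C s = X}"

definition sub_le :: "('o, 'm) category \<Rightarrow> 'm \<Rightarrow> 'm \<Rightarrow> bool" where
  "sub_le C s t \<longleftrightarrow> (\<exists>h\<in>Hom C (Dom C s) (Dom C t). Comp C t h = s)"

definition is_union :: "('o, 'm) category \<Rightarrow> 'o \<Rightarrow> 'm set \<Rightarrow> 'm \<Rightarrow> bool" where
  "is_union C X S u \<longleftrightarrow> u \<in> subobjects C X \<and> (\<forall>s\<in>S. sub_le C s u) \<and>
     (\<forall>v\<in>subobjects C X. (\<forall>s\<in>S. sub_le C s v) \<longrightarrow> sub_le C u v)"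

definition is_intersection :: "('o, 'm) category \<Rightarrow> 'o \<Rightarrow> 'm \<Rightarrow> 'm \<Rightarrow> 'm \<Rightarrow> bool" where
  "is_intersection C X s t w \<longleftrightarrow> w \<in> subobjects C X \<and> sub_le C w s \<and> sub_le C w t \<and>
     (\<forall>v\<in>subobjects C X. sub_le C v s \<and> sub_le C v t \<longrightarrow> sub_le C v w)"

definition directed_subobjects :: "('o, 'm) category \<Rightarrow> 'o \<Rightarrow> 'm set \<Rightarrow> bool" where
  "directed_subobjects C X S \<longleftrightarrow> S \<subseteq> subobjects C X \<and> S \<noteq> {} \<and>
     (\<forall>s\<in>S. \<forall>t\<in>S. \<exists>u\<in>S. sub_le C s u \<and> sub_le C t u)"

text \<open>An increasing filtered family of subobjects is replaced by the set of its members. A family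
  \<open>s\<close> is stationary (\<open>s j = s i\<close> as subobjects for some \<open>i\<close> and all \<open>j \<ge> i\<close>) iff its set of members
  is, because a directed family with a maximal member has it as its greatest member.\<close>

definition finite_type :: "('o, 'm) category \<Rightarrow> 'o \<Rightarrow> bool" where
  "finite_type C X \<longleftrightarrow> X \<in> Ob C \<and>
     (\<forall>S. directed_subobjects C X S \<and> is_union C X S (Id C X) \<longrightarrow>
        (\<exists>s\<in>S. \<forall>t\<in>S. sub_le C s t \<longrightarrow> sub_le C t s))"

section \<open>Grothendieck categories\<close>

text \<open>An abelian category is a preadditive category with a zero object, binary biproducts, kernels
  and cokernels, in which every monomorphism is a kernel and every epimorphism a cokernel.\<close>

definition preadditive :: "('o, 'm) category \<Rightarrow> ('m \<Rightarrow> 'm \<Rightarrow> 'm) \<Rightarrow> ('o \<Rightarrow> 'o \<Rightarrow> 'm) \<Rightarrow> bool" where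
  "preadditive C add zer \<longleftrightarrow>
     (\<forall>X\<in>Ob C. \<forall>Y\<in>Ob C. comm_group \<lparr>carrier = Hom C X Y, monoid.mult = add, one = zer X Y\<rparr>) \<and>
     (\<forall>X Y Z f g g'. f \<in> Hom C X Y \<and> g \<in> Hom C Y Z \<and> g' \<in> Hom C Y Z \<longrightarrow>
        Comp C (add g g') f = add (Comp C g f) (Comp C g' f)) \<and>
     (\<forall>X Y Z f f' g. f \<in> Hom C X Y \<and> f' \<in> Hom C X Y \<and> g \<in> Hom C Y Z \<longrightarrow>
        Comp C g (add f f') = add (Comp C g f) (Comp C g f'))"

definition has_biproduct :: "('o, 'm) category \<Rightarrow> ('m \<Rightarrow> 'm \<Rightarrow> 'm) \<Rightarrow> 'o \<Rightarrow> 'o \<Rightarrow> bool" where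
  "has_biproduct C add X Y \<longleftrightarrow>
     (\<exists>B\<in>Ob C. \<exists>i1\<in>Hom C X B. \<exists>i2\<in>Hom C Y B. \<exists>p1\<in>Hom C B X. \<exists>p2\<in>Hom C B Y.
        Comp C p1 i1 = Id C X \<and> Comp C p2 i2 = Id C Y \<and>
        add (Comp C i1 p1) (Comp C i2 p2) = Id C B)"

definition abelian_category :: "('o, 'm) category \<Rightarrow> bool" where
  "abelian_category C \<longleftrightarrow> is_category C \<and>
     (\<exists>add zer. preadditive C add zer \<and> (\<forall>X\<in>Ob C. \<forall>Y\<in>Ob C. has_biproduct C add X Y)) \<and>
     (\<exists>Z. is_zero_object C Z) \<and>
     (\<forall>f\<in>Ar C. (\<exists>k. is_kernel C f k) \<and> (\<exists>q. is_cokernel C f q)) \<and>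
     (\<forall>m. is_mono C m \<longrightarrow> (\<exists>f\<in>Ar C. is_kernel C f m)) \<and>
     (\<forall>e. is_epi C e \<longrightarrow> (\<exists>f\<in>Ar C. is_cokernel C f e))"

definition has_coproduct :: "('o, 'm) category \<Rightarrow> 'i set \<Rightarrow> ('i \<Rightarrow> 'o) \<Rightarrow> bool" where
  "has_coproduct C I X \<longleftrightarrow>
     (\<exists>P\<in>Ob C. \<exists>inj. (\<forall>i\<in>I. inj i \<in> Hom C (X i) P) \<and>
        (\<forall>Y\<in>Ob C. \<forall>g. (\<forall>i\<in>I. g i \<in> Hom C (X i) Y) \<longrightarrow>
           (\<exists>!h. h \<in> Hom C P Y \<and> (\<forall>i\<in>I. Comp C h (inj i) = g i))))"

text \<open>Smallness is relative to a type \<open>'u\<close> playing the role of the universe: a set is small if its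
  cardinality is strictly below that of \<open>'u\<close>. As for a Grothendieck universe, \<open>UNIV :: nat set\<close> is
  small and small unions of small sets are small, i.e. the cardinality of \<open>'u\<close> is uncountable and
  regular. Closure under power sets is not required.\<close>

definition small :: "'u itself \<Rightarrow> 'a set \<Rightarrow> bool" where
  "small u A \<longleftrightarrow> A \<prec> (UNIV :: 'u set)"

definition universe :: "'u itself \<Rightarrow> bool" where
  "universe u \<longleftrightarrow> small u (UNIV :: nat set) \<and>
     (\<forall>(I :: 'u set) (A :: 'u \<Rightarrow> 'u set).
        small u I \<and> (\<forall>i\<in>I. small u (A i)) \<longrightarrow> small u (\<Union>i\<in>I. A i))"

definition AB3 :: "'u itself \<Rightarrow> ('o, 'm) category \<Rightarrow> bool" where
  "AB3 u C \<longleftrightarrow> (\<forall>(I :: 'u set) X. small u I \<and> (\<forall>i\<in>I. X i \<in> Ob C) \<longrightarrow> has_coproduct C I X)"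

text \<open>Grothendieck's form of AB5, given AB3: \<open>(\<Union>s\<in>S. s) \<inter> t = (\<Union>s\<in>S. s \<inter> t)\<close> for \<open>S\<close> directed. The
  set below contains all representatives of the subobjects \<open>s \<inter> t\<close>, \<open>s \<in> S\<close>.\<close>

definition AB5 :: "'u itself \<Rightarrow> ('o, 'm) category \<Rightarrow> bool" where
  "AB5 u C \<longleftrightarrow> AB3 u C \<and>
     (\<forall>X\<in>Ob C. \<forall>S u' t w. small u S \<and> directed_subobjects C X S \<and> is_union C X S u' \<and>
        t \<in> subobjects C X \<and> is_intersection C X u' t w \<longrightarrow>
        is_union C X {v. \<exists>s\<in>S. is_intersection C X s t v} w)"

text \<open>Local smallness enters only through the sets \<open>Hom(G, X)\<close>. Categories all of whose hom-sets
  are small (the usual convention) satisfy this in particular. Requiring all hom-sets to be small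
  would add nothing but force the cardinality of \<open>'u\<close> to be inaccessible as soon as
  \<open>C \<noteq> 0\<close>, since \<open>Hom(G\<^bsup>(I)\<^esup>, G) = Hom(G, G)\<^bsup>I\<^esup>\<close> for every small \<open>I\<close>; whereas, say, the
  countable abelian groups with \<open>G = \<int>\<close> and \<open>'u\<close> of cardinality \<open>\<aleph>\<^sub>1\<close> are covered here.\<close>

definition is_generator :: "'u itself \<Rightarrow> ('o, 'm) category \<Rightarrow> 'o \<Rightarrow> bool" where
  "is_generator u C G \<longleftrightarrow> G \<in> Ob C \<and> (\<forall>X\<in>Ob C. small u (Hom C G X)) \<and>
     (\<forall>X Y. \<forall>f\<in>Hom C X Y. \<forall>g\<in>Hom C X Y.
        (\<forall>h\<in>Hom C G X. Comp C f h = Comp C g h) \<longrightarrow> f = g)"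

definition grothendieck_category :: "'u itself \<Rightarrow> ('o, 'm) category \<Rightarrow> bool" where
  "grothendieck_category u C \<longleftrightarrow> abelian_category C \<and> AB5 u C \<and> (\<exists>G. is_generator u C G)"

section \<open>Functor categories\<close>

text \<open>Functors and natural transformations are normalised to be \<open>undefined\<close> outside the source
  category, so that equality of the values below is equality of functors and transformations.\<close>

record ('p, 'a, 'o, 'm) ftor =
  FOb :: "'p \<Rightarrow> 'o"
  FAr :: "'a \<Rightarrow> 'm"

definition is_functor :: "('p, 'a) category \<Rightarrow> ('o, 'm) category \<Rightarrow> ('p, 'a, 'o, 'm) ftor \<Rightarrow> bool" where
  "is_functor B C F \<longleftrightarrow>
     FOb F \<in> Ob B \<rightarrow>\<^sub>E Ob C \<and> FAr F \<in> Ar B \<rightarrow>\<^sub>E Ar C \<and>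
     (\<forall>f\<in>Ar B. Dom C (FAr F f) = FOb F (Dom B f) \<and> Cod C (FAr F f) = FOb F (Cod B f)) \<and>
     (\<forall>X\<in>Ob B. FAr F (Id B X) = Id C (FOb F X)) \<and>
     (\<forall>X Y Z f g. f \<in> Hom B X Y \<and> g \<in> Hom B Y Z \<longrightarrow>
        FAr F (Comp B g f) = Comp C (FAr F g) (FAr F f))"

type_synonym ('p, 'a, 'o, 'm) nattrans =
  "('p, 'a, 'o, 'm) ftor \<times> ('p, 'a, 'o, 'm) ftor \<times> ('p \<Rightarrow> 'm)"

definition is_nattrans ::
  "('p, 'a) category \<Rightarrow> ('o, 'm) category \<Rightarrow> ('p, 'a, 'o, 'm) nattrans \<Rightarrow> bool" where
  "is_nattrans B C = (\<lambda>(F, G, \<eta>).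
     is_functor B C F \<and> is_functor B C G \<and> \<eta> \<in> extensional (Ob B) \<and>
     (\<forall>X\<in>Ob B. \<eta> X \<in> Hom C (FOb F X) (FOb G X)) \<and>
     (\<forall>X Y. \<forall>f\<in>Hom B X Y. Comp C (\<eta> Y) (FAr F f) = Comp C (FAr G f) (\<eta> X)))"

definition Fct ::
  "('p, 'a) category \<Rightarrow> ('o, 'm) category \<Rightarrow>
   (('p, 'a, 'o, 'm) ftor, ('p, 'a, 'o, 'm) nattrans) category" where
  "Fct B C = \<lparr>
     Ob = {F. is_functor B C F},
     Ar = {\<eta>. is_nattrans B C \<eta>},
     Dom = (\<lambda>(F, G, \<eta>). F),
     Cod = (\<lambda>(F, G, \<eta>). G),
     Id = (\<lambda>F. (F, F, \<lambda>X\<in>Ob B. Id C (FOb F X))),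
     Comp = (\<lambda>(G', H, \<theta>) (F, G, \<eta>). (F, H, \<lambda>X\<in>Ob B. Comp C (\<theta> X) (\<eta> X)))\<rparr>"

definition component :: "('p, 'a, 'o, 'm) nattrans \<Rightarrow> 'p \<Rightarrow> 'm" where
  "component = (\<lambda>(F, G, \<eta>). \<eta>)"

section \<open>The category \<open>\<Theta>\<close>\<close>

text \<open>The object \<open>n\<close> stands for \<open>{1..n}\<close>; the arrow \<open>(m, n, f)\<close> is the injection \<open>f\<close> from \<open>{1..m}\<close>
  to \<open>{1..n}\<close>.\<close>

type_synonym theta_arrow = "nat \<times> nat \<times> (nat \<Rightarrow> nat)"

definition Theta :: "(nat, theta_arrow) category" where
  "Theta = \<lparr>
     Ob = UNIV,
     Ar = {(m, n, f). f \<in> {1..m} \<rightarrow>\<^sub>E {1..n} \<and> inj_on f {1..m}},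
     Dom = (\<lambda>(m, n, f). m),
     Cod = (\<lambda>(m, n, f). n),
     Id = (\<lambda>n. (n, n, \<lambda>i\<in>{1..n}. i)),
     Comp = (\<lambda>(n', p, g) (m, n, f). (m, p, \<lambda>i\<in>{1..m}. g (f i)))\<rparr>"

text \<open>The disjoint union of \<open>{1..a}\<close> and \<open>{1..c}\<close> is \<open>{1..a + c}\<close>, the first summand coming first. In
  particular \<open>0 \<oplus> n = n\<close>.\<close>

definition theta_sum :: "theta_arrow \<Rightarrow> theta_arrow \<Rightarrow> theta_arrow" where
  "theta_sum = (\<lambda>(a, b, f) (c, d, g).
     (a + c, b + d, \<lambda>i\<in>{1..a + c}. if i \<le> a then f i else b + g (i - a)))"

definition theta_init :: "nat \<Rightarrow> theta_arrow" where
  "theta_init x = (0, x, \<lambda>i\<in>{}. undefined)"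

type_synonym ('o, 'm) theta_ftor = "(nat, theta_arrow, 'o, 'm) ftor"

definition generated_upto :: "('o, 'm) category \<Rightarrow> ('o, 'm) theta_ftor \<Rightarrow> int \<Rightarrow> bool" where
  "generated_upto A F n \<longleftrightarrow>
     (\<forall>\<gamma>\<in>subobjects (Fct Theta A) F.
        (\<forall>i. int i \<le> n \<longrightarrow> is_iso A (component \<gamma> i)) \<longrightarrow> is_iso (Fct Theta A) \<gamma>)"

section \<open>Strongly polynomial functors\<close>

text \<open>\<open>shift x F\<close> is \<open>F(x \<oplus> -)\<close> and \<open>shift_map x F\<close> is the map \<open>F = F(0 \<oplus> -) \<rightarrow> F(x \<oplus> -)\<close> induced by
  \<open>0 \<rightarrow> x\<close>.\<close>

definition shift :: "nat \<Rightarrow> ('o, 'm) theta_ftor \<Rightarrow> ('o, 'm) theta_ftor" where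
  "shift x F = \<lparr>
     FOb = (\<lambda>n. FOb F (x + n)),
     FAr = (\<lambda>f\<in>Ar Theta. FAr F (theta_sum (Id Theta x) f))\<rparr>"

definition shift_map :: "nat \<Rightarrow> ('o, 'm) theta_ftor \<Rightarrow> (nat, theta_arrow, 'o, 'm) nattrans" where
  "shift_map x F = (F, shift x F, \<lambda>n. FAr F (theta_sum (theta_init x) (Id Theta n)))"

text \<open>\<open>is_delta A x F D\<close>: the functor \<open>D\<close> is a \<open>\<delta>\<^sub>x(F)\<close>, which is determined up to isomorphism.\<close>

definition is_delta ::
  "('o, 'm) category \<Rightarrow> nat \<Rightarrow> ('o, 'm) theta_ftor \<Rightarrow> ('o, 'm) theta_ftor \<Rightarrow> bool" where
  "is_delta A x F D \<longleftrightarrow>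
     (\<exists>q. is_cokernel (Fct Theta A) (shift_map x F) q \<and> Cod (Fct Theta A) q = D)"

function Pol_fort :: "('o, 'm) category \<Rightarrow> int \<Rightarrow> ('o, 'm) theta_ftor set" where
  "Pol_fort A n =
     (if n < 0 then {F. is_zero_object (Fct Theta A) F}
      else {F \<in> Ob (Fct Theta A). \<forall>x\<in>Ob Theta. \<exists>D. is_delta A x F D \<and> D \<in> Pol_fort A (n - 1)})"
  by pat_completeness auto
termination
  by (relation "measure (\<lambda>(A, n). nat (n + 1))") auto

declare Pol_fort.simps [simp del]

definition strongly_polynomial :: "('o, 'm) category \<Rightarrow> ('o, 'm) theta_ftor \<Rightarrow> bool" where
  "strongly_polynomial A F \<longleftrightarrow> (\<exists>n. F \<in> Pol_fort A n)"

end

theory Submission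
  imports Defs
begin

text \<open>Dually to generation in cardinality at most \<open>n\<close>, consider the condition that the maps \<open>F f\<close> with
  source of cardinality at most \<open>n\<close> are jointly epic. It holds iff \<open>F\<close> is in \<open>Pol_fort A n\<close>, by induction
  on \<open>n\<close>: an injection into \<open>x \<oplus> j\<close> either misses \<open>x\<close>, and is then killed in \<open>\<delta>\<^sub>x F\<close>, or meets \<open>j\<close> in
  fewer points; conversely \<open>\<delta>\<^sub>1 F\<close> being generated up to \<open>n - 1\<close> allows one to climb from \<open>F j\<close> to
  \<open>F (1 \<oplus> j)\<close>. So strongly polynomial functors are exactly those generated in bounded cardinality.

  A functor of finite type is one of its subfunctors generated up to \<open>n\<close>. Its values are of finite type
  because a directed union \<open>F i = \<Union>s\<close> lifts to the directed union of the largest subfunctors of \<open>F\<close> with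
  value at \<open>i\<close> in \<open>s\<close>; here AB5 is used. Conversely, if \<open>F\<close> is generated up to \<open>n\<close> and its values up to \<open>n\<close>
  are of finite type, a directed family with union \<open>F\<close> reaches these finitely many values, hence \<open>F\<close>.\<close>

section \<open>Small sets\<close>

text \<open>Inclusions are handled by tests. \<open>sub_le C g s\<close> is used for every arrow
  \<open>g\<close>, monic or not, and says that \<open>g\<close> factors through \<open>s\<close>;
  since each subobject is a kernel, this amounts to an equation \<open>kills r g\<close> for a fixed
  \<open>r\<close>. Preimages, sums of images and joint epicity can thus be stated without
  pullbacks, images or coproducts.

  Two obstacles shape the rest. Finite type quantifies over directed families of any size, whereas
  AB3 and AB5 speak of small ones; arrows from the generator cut the families down. And AB5 concerns
  intersections with one subobject, whereas the largest subfunctor with value at \<open>i\<close> in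
  \<open>s\<close> is an intersection of several preimages along maps that need not be monic. A
  single preimage is traded for an intersection with a graph; several are treated one after the
  other, which works because there are finitely many injections from \<open>j\<close> to
  \<open>i\<close>.

  Monomorphisms, cokernels and unions of functors are reduced to their components, so that the
  abelian arguments take place in the target category.\<close>

lemma small_mono: "small u A \<Longrightarrow> B \<lesssim> A \<Longrightarrow> small u B"
  unfolding small_def by (rule lesspoll_trans1)

lemma small_image: "small u A \<Longrightarrow> small u (f ` A)"
  by (rule small_mono[OF _ image_lepoll])

lemma small_countable:
  assumes "universe (u :: 'u itself)" "countable A"
  shows "small u A"
proof -
  have "A \<lesssim> (UNIV :: nat set)"
    using assms(2) by (auto simp: countable_def lepoll_def)
  then show ?thesis using assms(1) small_mono unfolding universe_def by blast
qed

text \<open>A pairing on \<open>'u\<close>, used to tag an element with the index of the set it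
  comes from. It exists because \<open>universe\<close> makes \<open>'u\<close> infinite and an
  infinite cardinal equals its square.\<close>

lemma universe_Times_lepoll:
  assumes "universe (u :: 'u itself)"
  obtains \<pi> :: "'u \<times> 'u \<Rightarrow> 'u" where "inj \<pi>"
proof -
  have "(UNIV :: nat set) \<lesssim> (UNIV :: 'u set)"
    using assms lesspoll_imp_lepoll unfolding universe_def small_def by blast
  then have "infinite (UNIV :: 'u set)" by (simp add: infinite_le_lepoll)
  then have "(UNIV :: 'u set) \<times> (UNIV :: 'u set) \<approx> (UNIV :: 'u set)"
    unfolding eqpoll_iff_card_of_ordIso by (rule card_of_Times_same_infinite)
  then obtain \<pi> :: "'u \<times> 'u \<Rightarrow> 'u" where "bij_betw \<pi> (UNIV \<times> UNIV) UNIV"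
    unfolding eqpoll_def by blast
  then have "inj \<pi>" by (simp add: bij_betw_def)
  then show ?thesis by (rule that)
qed

text \<open>\<open>universe\<close> speaks only of subsets of \<open>'u\<close> indexed by elements
  of \<open>'u\<close>, so indices and members are coded into \<open>'u\<close>. The coding of
  members depends on the index; the tag through \<open>\<pi>\<close> makes the decoding
  \<open>dec\<close> a function.\<close>

lemma small_UN:
  fixes A :: "'a set" and B :: "'a \<Rightarrow> 'b set"
  assumes U: "universe (u :: 'u itself)" and A: "small u A" and B: "\<And>a. a \<in> A \<Longrightarrow> small u (B a)"
  shows "small u (\<Union>a\<in>A. B a)"
proof -
  obtain \<phi> :: "'a \<Rightarrow> 'u" where \<phi>: "inj_on \<phi> A"
    using A lesspoll_imp_lepoll unfolding small_def lepoll_def by blast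
  have "\<exists>\<psi> :: 'b \<Rightarrow> 'u. inj_on \<psi> (B a)" if "a \<in> A" for a
    using B[OF that] lesspoll_imp_lepoll unfolding small_def lepoll_def by blast
  then obtain \<psi> :: "'a \<Rightarrow> 'b \<Rightarrow> 'u" where \<psi>: "\<And>a. a \<in> A \<Longrightarrow> inj_on (\<psi> a) (B a)" by metis
  obtain \<pi> :: "'u \<times> 'u \<Rightarrow> 'u" where \<pi>: "inj \<pi>" using universe_Times_lepoll[OF U] .
  define B' where "B' i = (let a = inv_into A \<phi> i in (\<lambda>b. \<pi> (i, \<psi> a b)) ` B a)" for i
  define dec where "dec x = (let p = inv_into UNIV \<pi> x; a = inv_into A \<phi> (fst p) in inv_into (B a) (\<psi> a) (snd p))" for x
  have 1: "small u (\<Union>i\<in>\<phi> ` A. B' i)"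
  proof -
    have "small u (B' i)" if "i \<in> \<phi> ` A" for i
    proof -
      have "inv_into A \<phi> i \<in> A" using that by (rule inv_into_into)
      then show ?thesis using B small_image unfolding B'_def Let_def by blast
    qed
    moreover have "\<forall>(I :: 'u set) (A :: 'u \<Rightarrow> 'u set).
        small u I \<and> (\<forall>i\<in>I. small u (A i)) \<longrightarrow> small u (\<Union>i\<in>I. A i)"
      using U unfolding universe_def by (rule conjunct2)
    ultimately show ?thesis using small_image[OF A, of \<phi>] by metis
  qed
  have "(\<Union>a\<in>A. B a) \<subseteq> dec ` (\<Union>i\<in>\<phi> ` A. B' i)"
  proof
    fix b assume "b \<in> (\<Union>a\<in>A. B a)"
    then obtain a where a: "a \<in> A" "b \<in> B a" by blast
    have "dec (\<pi> (\<phi> a, \<psi> a b)) = b"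
      using a \<phi> \<psi>[OF a(1)] \<pi> by (simp add: dec_def Let_def)
    moreover have "\<pi> (\<phi> a, \<psi> a b) \<in> B' (\<phi> a)"
      using a \<phi> by (simp add: B'_def Let_def)
    ultimately show "b \<in> dec ` (\<Union>i\<in>\<phi> ` A. B' i)" using a(1) by (metis UN_I image_eqI)
  qed
  then show ?thesis by (rule small_mono[OF 1 subset_image_lepoll])
qed

text \<open>Closure in countably many rounds: each round adds the values of \<open>j\<close> on a
  small set, and the union over all rounds is again small. The intended \<open>j\<close> chooses
  upper bounds in a directed set.\<close>

lemma small_closure:
  fixes j :: "'a \<Rightarrow> 'a \<Rightarrow> 'a"
  assumes U: "universe (u :: 'u itself)" and X: "small u X" "X \<subseteq> S"
    and j: "\<And>a b. a \<in> S \<Longrightarrow> b \<in> S \<Longrightarrow> j a b \<in> S"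
  obtains Y where "X \<subseteq> Y" "Y \<subseteq> S" "small u Y" "\<And>a b. a \<in> Y \<Longrightarrow> b \<in> Y \<Longrightarrow> j a b \<in> Y"
proof -
  define st where "st Z = Z \<union> (\<Union>a\<in>Z. j a ` Z)" for Z
  define Z where "Z n = (st ^^ n) X" for n
  have Z_Suc: "Z (Suc n) = st (Z n)" for n by (simp add: Z_def)
  have Z: "small u (Z n) \<and> Z n \<subseteq> S" for n
  proof (induction n)
    case 0 then show ?case using X by (simp add: Z_def)
  next
    case (Suc n)
    have "small u (\<Union>a\<in>Z n. insert a (j a ` Z n))"
    proof (rule small_UN[OF U])
      show "small u (insert a (j a ` Z n))" for a
      proof -
        have "small u (if b then {a} else j a ` Z n)" for b
          using Suc.IH small_image[of u "Z n" "j a"] small_countable[OF U, of "{a}"] by simp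
        then have "small u (\<Union>b\<in>{True, False}. if b then {a} else j a ` Z n)"
          by (rule small_UN[OF U small_countable[OF U], rotated]) simp
        then show ?thesis by simp
      qed
    qed (use Suc in simp)
    moreover have "(\<Union>a\<in>Z n. insert a (j a ` Z n)) = st (Z n)" unfolding st_def by blast
    moreover have "st (Z n) \<subseteq> S" using Suc.IH j unfolding st_def by blast
    ultimately show ?case by (simp add: Z_Suc)
  qed
  have mono: "Z m \<subseteq> Z n" if "m \<le> n" for m n
    by (rule lift_Suc_mono_le[OF _ that]) (auto simp: Z_Suc st_def)
  show ?thesis
  proof
    show "X \<subseteq> (\<Union>n. Z n)" by (rule subset_trans[of _ "Z 0"]) (simp add: Z_def, blast)
    show "(\<Union>n. Z n) \<subseteq> S" using Z by blast
    show "small u (\<Union>n. Z n)"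
      by (rule small_UN[OF U small_countable[OF U]]) (use Z in simp_all)
    show "j a b \<in> (\<Union>n. Z n)" if ab: "a \<in> (\<Union>n. Z n)" "b \<in> (\<Union>n. Z n)" for a b
    proof -
      obtain m n where "a \<in> Z m" "b \<in> Z n" using ab by blast
      then have "a \<in> Z (max m n)" "b \<in> Z (max m n)" using mono max.cobounded1 max.cobounded2 by blast+
      then have "j a b \<in> Z (Suc (max m n))" unfolding Z_Suc st_def by blast
      then show ?thesis by blast
    qed
  qed
qed

section \<open>Subobjects in abelian categories\<close>

locale cat =
  fixes C :: "('o, 'm) category"
  assumes is_cat: "is_category C"
begin

abbreviation comp (infixr "\<cdot>" 70) where "g \<cdot> f \<equiv> Comp C g f"

lemma Hom_iff: "f \<in> Hom C X Y \<longleftrightarrow> f \<in> Ar C \<and> Dom C f = X \<and> Cod C f = Y"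
  by (simp add: Hom_def)

lemma Dom_Ob [simp]: "f \<in> Ar C \<Longrightarrow> Dom C f \<in> Ob C"
  and Cod_Ob [simp]: "f \<in> Ar C \<Longrightarrow> Cod C f \<in> Ob C"
  using is_cat unfolding is_category_def by blast+

lemma Id_Hom: "X \<in> Ob C \<Longrightarrow> Id C X \<in> Hom C X X"
  using is_cat unfolding is_category_def by blast

lemma Id_Ar [simp]: "X \<in> Ob C \<Longrightarrow> Id C X \<in> Ar C"
  and Dom_Id [simp]: "X \<in> Ob C \<Longrightarrow> Dom C (Id C X) = X"
  and Cod_Id [simp]: "X \<in> Ob C \<Longrightarrow> Cod C (Id C X) = X"
  using Id_Hom[of X] by (auto simp: Hom_iff)

lemma Comp_Hom: "f \<in> Hom C X Y \<Longrightarrow> g \<in> Hom C Y Z \<Longrightarrow> g \<cdot> f \<in> Hom C X Z"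
  using is_cat unfolding is_category_def by blast

lemma
  assumes "f \<in> Ar C" "g \<in> Ar C" "Cod C f = Dom C g"
  shows Comp_Ar [simp]: "g \<cdot> f \<in> Ar C"
    and Dom_Comp [simp]: "Dom C (g \<cdot> f) = Dom C f"
    and Cod_Comp [simp]: "Cod C (g \<cdot> f) = Cod C g"
  using Comp_Hom[of f "Dom C f" "Cod C f" g "Cod C g"] assms by (auto simp: Hom_iff)

lemma Comp_Id_right [simp]: "f \<in> Ar C \<Longrightarrow> Dom C f = X \<Longrightarrow> f \<cdot> Id C X = f"
  and Comp_Id_left [simp]: "f \<in> Ar C \<Longrightarrow> Cod C f = Y \<Longrightarrow> Id C Y \<cdot> f = f"
  using is_cat unfolding is_category_def Hom_def by blast+

lemma Comp_assoc:
  assumes "f \<in> Ar C" "g \<in> Ar C" "h \<in> Ar C" "Cod C f = Dom C g" "Cod C g = Dom C h"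
  shows "(h \<cdot> g) \<cdot> f = h \<cdot> (g \<cdot> f)"
proof -
  have "\<forall>W X Y Z f g h. f \<in> Hom C W X \<and> g \<in> Hom C X Y \<and> h \<in> Hom C Y Z \<longrightarrow>
      h \<cdot> (g \<cdot> f) = (h \<cdot> g) \<cdot> f"
    using is_cat unfolding is_category_def by blast
  then show ?thesis using assms unfolding Hom_iff by metis
qed

lemma monoD:
  assumes "is_mono C m" "g \<in> Ar C" "h \<in> Ar C" "Dom C g = Dom C h" "Cod C g = Dom C m" "Cod C h = Dom C m"
    "m \<cdot> g = m \<cdot> h"
  shows "g = h"
  using assms unfolding is_mono_def Hom_def by blast

lemma epiD:
  assumes "is_epi C e" "g \<in> Ar C" "h \<in> Ar C" "Cod C g = Cod C h" "Dom C g = Cod C e" "Dom C h = Cod C e"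
    "g \<cdot> e = h \<cdot> e"
  shows "g = h"
  using assms unfolding is_epi_def Hom_def by blast

lemma mono_Ar [simp]: "is_mono C m \<Longrightarrow> m \<in> Ar C"
  and epi_Ar [simp]: "is_epi C m \<Longrightarrow> m \<in> Ar C"
  by (auto simp: is_mono_def is_epi_def)

lemma subobjects_iff: "s \<in> subobjects C X \<longleftrightarrow> is_mono C s \<and> Cod C s = X"
  by (simp add: subobjects_def)

text \<open>Here \<open>s\<close> may be any arrow, so that "the image of \<open>s\<close> lies in
  \<open>t\<close>" can be expressed without an image.\<close>

lemma sub_le_iff: "sub_le C s t \<longleftrightarrow> (\<exists>h. h \<in> Ar C \<and> Dom C h = Dom C s \<and> Cod C h = Dom C t \<and> t \<cdot> h = s)"
  by (auto simp: sub_le_def Hom_iff)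

lemma sub_le_refl [simp]: "s \<in> Ar C \<Longrightarrow> sub_le C s s"
  unfolding sub_le_iff by (rule exI[of _ "Id C (Dom C s)"]) simp

lemma sub_le_trans:
  assumes "sub_le C s t" "sub_le C t u" "u \<in> Ar C"
  shows "sub_le C s u"
proof -
  obtain h k where "h \<in> Ar C" "Dom C h = Dom C s" "Cod C h = Dom C t" "t \<cdot> h = s"
     "k \<in> Ar C" "Dom C k = Dom C t" "Cod C k = Dom C u" "u \<cdot> k = t"
    using assms unfolding sub_le_iff by blast
  then show ?thesis using assms(3) unfolding sub_le_iff
    by (intro exI[of _ "k \<cdot> h"]) (simp flip: Comp_assoc)
qed

lemma sub_le_Comp:
  assumes "g \<in> Ar C" "s \<in> Ar C" "Cod C g = Dom C s"
  shows "sub_le C (s \<cdot> g) s"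
  using assms unfolding sub_le_iff by auto

lemma sub_le_comp_left:
  assumes "sub_le C s t" "t \<in> Ar C" "f \<in> Ar C" "Dom C f = Cod C t"
  shows "sub_le C (f \<cdot> s) (f \<cdot> t)"
proof -
  obtain h where "h \<in> Ar C" "Dom C h = Dom C s" "Cod C h = Dom C t" "t \<cdot> h = s"
    using assms unfolding sub_le_iff by blast
  then show ?thesis using assms unfolding sub_le_iff
    by (intro exI[of _ h]) (auto simp add: Comp_assoc)
qed

lemma sub_le_comp_right:
  assumes "sub_le C s t" "t \<in> Ar C" "g \<in> Ar C" "Cod C g = Dom C s"
  shows "sub_le C (s \<cdot> g) t"
proof -
  obtain h where "h \<in> Ar C" "Dom C h = Dom C s" "Cod C h = Dom C t" "t \<cdot> h = s"
    using assms unfolding sub_le_iff by blast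
  then show ?thesis using assms unfolding sub_le_iff
    by (intro exI[of _ "h \<cdot> g"]) (auto simp add: Comp_assoc)
qed

lemma sub_le_Id [simp]: "s \<in> Ar C \<Longrightarrow> Cod C s = X \<Longrightarrow> sub_le C s (Id C X)"
  unfolding sub_le_iff by (rule exI[of _ s]) auto

lemma Id_sub_le_trans:
  assumes "sub_le C (Id C X) s" "s \<in> Ar C" "g \<in> Ar C" "Cod C g = X"
  shows "sub_le C g s"
  using sub_le_trans[OF _ assms(1,2), of g] assms by simp

lemma Id_subobject [simp]: "X \<in> Ob C \<Longrightarrow> Id C X \<in> subobjects C X"
  unfolding subobjects_iff is_mono_def
proof (intro conjI allI ballI impI)
  show "g = h" if "X \<in> Ob C" "g \<in> Hom C W (Dom C (Id C X))" "h \<in> Hom C W (Dom C (Id C X))"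
    "Id C X \<cdot> g = Id C X \<cdot> h" for W g h
    using that Comp_Id_left[of g X] Comp_Id_left[of h X] Dom_Id[of X] by (metis Hom_iff)
qed auto

text \<open>A right inverse \<open>h\<close> of a monomorphism \<open>s\<close> is two-sided:
  \<open>s \<cdot> (h \<cdot> s) = s\<close>, and \<open>s\<close> cancels. Being an isomorphism
  thereby becomes a relation of the preorder.\<close>

lemma is_iso_iff_Id_sub_le:
  assumes "is_mono C s"
  shows "is_iso C s \<longleftrightarrow> sub_le C (Id C (Cod C s)) s"
proof
  assume "is_iso C s"
  then show "sub_le C (Id C (Cod C s)) s"
    using assms by (auto simp: is_iso_def sub_le_iff Hom_iff)
next
  assume "sub_le C (Id C (Cod C s)) s"
  then obtain h where h: "h \<in> Ar C" "Dom C h = Cod C s" "Cod C h = Dom C s" "s \<cdot> h = Id C (Cod C s)"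
    using assms unfolding sub_le_iff by auto
  have "h \<cdot> s = Id C (Dom C s)"
  proof (rule monoD[OF assms])
    have "s \<cdot> h \<cdot> s = (s \<cdot> h) \<cdot> s" using assms h(1-3) by (simp add: Comp_assoc)
    also have "\<dots> = s \<cdot> Id C (Dom C s)" unfolding h(4) using assms by simp
    finally show "s \<cdot> h \<cdot> s = s \<cdot> Id C (Dom C s)" .
  qed (use assms h(1-3) in auto)
  moreover have "h \<in> Hom C (Cod C s) (Dom C s)" using h by (simp add: Hom_iff)
  ultimately show "is_iso C s" using assms h(4) unfolding is_iso_def by auto
qed

lemma is_union_Id_iff:
  assumes "X \<in> Ob C" "S \<subseteq> subobjects C X"
  shows "is_union C X S (Id C X) \<longleftrightarrow>
    (\<forall>v\<in>subobjects C X. (\<forall>s\<in>S. sub_le C s v) \<longrightarrow> sub_le C (Id C X) v)"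
proof -
  have "\<forall>s\<in>S. sub_le C s (Id C X)" using assms by (auto simp: subobjects_iff)
  then show ?thesis using assms(1) unfolding is_union_def by auto
qed

lemma directedE:
  assumes "directed_subobjects C X S" "s \<in> S" "t \<in> S"
  obtains u where "u \<in> S" "sub_le C s u" "sub_le C t u"
  using assms unfolding directed_subobjects_def by blast

lemma maximal_is_greatest:
  assumes "directed_subobjects C X S" "s \<in> S" "\<forall>t\<in>S. sub_le C s t \<longrightarrow> sub_le C t s" "t \<in> S"
  shows "sub_le C t s"
proof -
  obtain u where u: "u \<in> S" "sub_le C s u" "sub_le C t u"
    using directedE[OF assms(1,2,4)] by blast
  moreover have "s \<in> Ar C" using assms by (auto simp: directed_subobjects_def subobjects_iff)
  ultimately show ?thesis using assms(3) sub_le_trans by blast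
qed

text \<open>A directed set of subobjects with a maximal member has a greatest one, so stationarity says
  that the union is reached.\<close>

lemma finite_type_iff:
  "finite_type C X \<longleftrightarrow> X \<in> Ob C \<and>
    (\<forall>S. directed_subobjects C X S \<and> is_union C X S (Id C X) \<longrightarrow> (\<exists>s\<in>S. sub_le C (Id C X) s))"
  (is "_ \<longleftrightarrow> _ \<and> (\<forall>S. ?P S \<longrightarrow> ?Q S)")
proof (cases "X \<in> Ob C")
  case X: True
  have "(\<exists>s\<in>S. \<forall>t\<in>S. sub_le C s t \<longrightarrow> sub_le C t s) \<longleftrightarrow> ?Q S" if S: "?P S" for S
  proof
    assume "\<exists>s\<in>S. \<forall>t\<in>S. sub_le C s t \<longrightarrow> sub_le C t s"
    then obtain s where s: "s \<in> S" "\<forall>t\<in>S. sub_le C t s"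
      using maximal_is_greatest S by (metis (no_types, lifting))
    then show "?Q S" using S unfolding is_union_def directed_subobjects_def by blast
  next
    assume "?Q S"
    moreover have "s \<in> Ar C \<and> Cod C s = X" if "s \<in> S" for s
      using S that unfolding directed_subobjects_def subobjects_iff[abs_def] by (auto simp: subobjects_iff)
    ultimately show "\<exists>s\<in>S. \<forall>t\<in>S. sub_le C s t \<longrightarrow> sub_le C t s" using Id_sub_le_trans by blast
  qed
  then show ?thesis unfolding finite_type_def by blast
qed (simp add: finite_type_def)

lemma directed_finite_bound:
  assumes S: "directed_subobjects C X S" and "finite K" "\<And>k. k \<in> K \<Longrightarrow> s k \<in> S"
  shows "\<exists>u\<in>S. \<forall>k\<in>K. sub_le C (s k) u"
  using assms(2,3)
proof (induction K rule: finite_induct)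
  case empty then show ?case using S by (auto simp: directed_subobjects_def)
next
  case (insert k K)
  then obtain u where u: "u \<in> S" "\<forall>k\<in>K. sub_le C (s k) u" by auto
  obtain w where w: "w \<in> S" "sub_le C (s k) w" "sub_le C u w"
    using directedE[OF S insert.prems[of k] u(1)] by blast
  have "w \<in> Ar C" using S w by (auto simp: directed_subobjects_def subobjects_iff)
  then show ?case using u w sub_le_trans by (intro bexI[of _ w]) auto
qed

end

section \<open>Zero arrows, kernels, cokernels and biproducts\<close>

locale abelian = cat +
  fixes add zer
  assumes pre: "preadditive C add zer"
    and bip: "\<And>X Y. X \<in> Ob C \<Longrightarrow> Y \<in> Ob C \<Longrightarrow> has_biproduct C add X Y"
    and zob: "\<exists>Z. is_zero_object C Z"
    and kers: "\<And>f. f \<in> Ar C \<Longrightarrow> \<exists>k. is_kernel C f k"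
    and cokers: "\<And>f. f \<in> Ar C \<Longrightarrow> \<exists>q. is_cokernel C f q"
    and mono_ker: "\<And>m. is_mono C m \<Longrightarrow> \<exists>f\<in>Ar C. is_kernel C f m"
begin

lemma group: "X \<in> Ob C \<Longrightarrow> Y \<in> Ob C \<Longrightarrow> comm_group \<lparr>carrier = Hom C X Y, monoid.mult = add, one = zer X Y\<rparr>"
  using pre unfolding preadditive_def by blast

lemma zer_Hom: "X \<in> Ob C \<Longrightarrow> Y \<in> Ob C \<Longrightarrow> zer X Y \<in> Hom C X Y"
  using monoid.one_closed[OF group.is_monoid, OF comm_group.axioms(2), OF group] by simp

lemma zer_Ar [simp]: "X \<in> Ob C \<Longrightarrow> Y \<in> Ob C \<Longrightarrow> zer X Y \<in> Ar C"
  and Dom_zer [simp]: "X \<in> Ob C \<Longrightarrow> Y \<in> Ob C \<Longrightarrow> Dom C (zer X Y) = X"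
  and Cod_zer [simp]: "X \<in> Ob C \<Longrightarrow> Y \<in> Ob C \<Longrightarrow> Cod C (zer X Y) = Y"
  using zer_Hom[of X Y] by (auto simp: Hom_iff)

lemma add_Hom: "f \<in> Hom C X Y \<Longrightarrow> g \<in> Hom C X Y \<Longrightarrow> add f g \<in> Hom C X Y"
  using monoid.m_closed[OF group.is_monoid, OF comm_group.axioms(2), OF group, of X Y f g]
  by (auto simp: Hom_iff)

lemma add_zer_left: "f \<in> Hom C X Y \<Longrightarrow> add (zer X Y) f = f"
  using monoid.l_one[OF group.is_monoid, OF comm_group.axioms(2), OF group, of X Y f]
  by (auto simp: Hom_iff)

lemma add_zer_right: "f \<in> Hom C X Y \<Longrightarrow> add f (zer X Y) = f"
  using monoid.r_one[OF group.is_monoid, OF comm_group.axioms(2), OF group, of X Y f]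
  by (auto simp: Hom_iff)

lemma add_left_cancel:
  assumes "f \<in> Hom C X Y" "g \<in> Hom C X Y" "h \<in> Hom C X Y" "add f g = add f h"
  shows "g = h"
proof -
  have "X \<in> Ob C" "Y \<in> Ob C" using assms(1) by (auto simp: Hom_iff)
  note G = comm_group.axioms(2)[OF group[OF this]]
  from monoid.Units_l_cancel[OF group.is_monoid[OF G], of f g h] group.Units_eq[OF G] assms
  show ?thesis by simp
qed

lemma ex_minus:
  assumes "f \<in> Hom C X Y"
  obtains g where "g \<in> Hom C X Y" "add f g = zer X Y" "add g f = zer X Y"
proof -
  have "X \<in> Ob C" "Y \<in> Ob C" using assms(1) by (auto simp: Hom_iff)
  note G = comm_group.axioms(2)[OF group[OF this]]
  show thesis
    using group.inv_closed[OF G, of f] group.r_inv[OF G, of f] group.l_inv[OF G, of f] assms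
    by (intro that[of "inv\<^bsub>\<lparr>carrier = Hom C X Y, monoid.mult = add, one = zer X Y\<rparr>\<^esub> f"]) auto
qed

lemma add_assoc:
  assumes "f \<in> Hom C X Y" "g \<in> Hom C X Y" "h \<in> Hom C X Y"
  shows "add (add f g) h = add f (add g h)"
proof -
  have "X \<in> Ob C" "Y \<in> Ob C" using assms(1) by (auto simp: Hom_iff)
  from monoid.m_assoc[OF group.is_monoid[OF comm_group.axioms(2)[OF group[OF this]]], of f g h] assms
  show ?thesis by simp
qed

lemma add_Comp:
  assumes "f \<in> Hom C X Y" "g \<in> Hom C Y Z" "g' \<in> Hom C Y Z"
  shows "add g g' \<cdot> f = add (g \<cdot> f) (g' \<cdot> f)"
  using pre assms unfolding preadditive_def by blast

lemma Comp_add: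
  assumes "f \<in> Hom C X Y" "f' \<in> Hom C X Y" "g \<in> Hom C Y Z"
  shows "g \<cdot> add f f' = add (g \<cdot> f) (g \<cdot> f')"
  using pre assms unfolding preadditive_def by blast

lemma zer_Comp [simp]:
  assumes "f \<in> Ar C" "Cod C f = Y" "Z \<in> Ob C"
  shows "zer Y Z \<cdot> f = zer (Dom C f) Z"
proof -
  have z: "zer Y Z \<in> Hom C Y Z" using assms by (auto intro: zer_Hom)
  have h: "zer Y Z \<cdot> f \<in> Hom C (Dom C f) Z" "zer (Dom C f) Z \<in> Hom C (Dom C f) Z"
    using assms z by (auto simp: Hom_iff)
  have "add (zer Y Z \<cdot> f) (zer Y Z \<cdot> f) = add (zer Y Z) (zer Y Z) \<cdot> f"
    using add_Comp[OF _ z z] assms by (simp add: Hom_iff)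
  also have "\<dots> = add (zer Y Z \<cdot> f) (zer (Dom C f) Z)" using add_zer_left[OF z] add_zer_right[OF h(1)] by simp
  finally show ?thesis using add_left_cancel[OF h(1) h(1) h(2)] by simp
qed

lemma Comp_zer [simp]:
  assumes "f \<in> Ar C" "Dom C f = Y" "X \<in> Ob C"
  shows "f \<cdot> zer X Y = zer X (Cod C f)"
proof -
  have z: "zer X Y \<in> Hom C X Y" using assms by (auto intro: zer_Hom)
  have h: "f \<cdot> zer X Y \<in> Hom C X (Cod C f)" "zer X (Cod C f) \<in> Hom C X (Cod C f)"
    using assms z by (auto simp: Hom_iff)
  have "add (f \<cdot> zer X Y) (f \<cdot> zer X Y) = f \<cdot> add (zer X Y) (zer X Y)"
    using Comp_add[OF z z, of f] assms by (simp add: Hom_iff)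
  also have "\<dots> = add (f \<cdot> zer X Y) (zer X (Cod C f))" using add_zer_left[OF z] add_zer_right[OF h(1)] by simp
  finally show ?thesis using add_left_cancel[OF h(1) h(1) h(2)] by simp
qed

text \<open>One equation in place of two uniqueness statements; for functors it can be checked
  component by component.\<close>

lemma zero_object_iff: "is_zero_object C Z \<longleftrightarrow> Z \<in> Ob C \<and> Id C Z = zer Z Z"
proof
  assume Z: "is_zero_object C Z"
  then have "\<exists>!f. f \<in> Hom C Z Z" unfolding is_zero_object_def by blast
  then show "Z \<in> Ob C \<and> Id C Z = zer Z Z"
    using Z Id_Hom[of Z] zer_Hom[of Z Z] unfolding is_zero_object_def by blast
next
  assume Z: "Z \<in> Ob C \<and> Id C Z = zer Z Z"
  have "f = zer Z X" if "f \<in> Hom C Z X" for f X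
    using that Z Comp_Id_right[of f Z] Comp_zer[of f Z Z] by (auto simp: Hom_iff simp del: Comp_Id_right)
  moreover have "f = zer X Z" if "f \<in> Hom C X Z" for f X
    using that Z Comp_Id_left[of f Z] zer_Comp[of f Z Z] by (auto simp: Hom_iff simp del: Comp_Id_left)
  ultimately show "is_zero_object C Z" using Z zer_Hom unfolding is_zero_object_def by blast
qed

lemma zero_arrow_iff:
  assumes "f \<in> Ar C"
  shows "is_zero_arrow C f \<longleftrightarrow> f = zer (Dom C f) (Cod C f)"
proof
  assume "is_zero_arrow C f"
  then obtain Z g h where Z: "is_zero_object C Z" "g \<in> Hom C (Dom C f) Z" "h \<in> Hom C Z (Cod C f)" "f = h \<cdot> g"
    unfolding is_zero_arrow_def by blast
  then have "g = zer (Dom C f) Z"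
  proof -
    have "\<exists>!e. e \<in> Hom C (Dom C f) Z" "Z \<in> Ob C" using Z(1) assms by (auto simp: is_zero_object_def)
    then show ?thesis using Z(2) zer_Hom[of "Dom C f" Z] assms by auto
  qed
  moreover have "h \<cdot> zer (Dom C f) Z = zer (Dom C f) (Cod C f)"
    using Z(3) assms Comp_zer[of h Z "Dom C f"] by (simp add: Hom_iff)
  ultimately show "f = zer (Dom C f) (Cod C f)" using Z(4) by metis
next
  assume f: "f = zer (Dom C f) (Cod C f)"
  obtain Z where Z: "is_zero_object C Z" using zob by blast
  then have ZO: "Z \<in> Ob C" by (simp add: is_zero_object_def)
  have "zer Z (Cod C f) \<cdot> zer (Dom C f) Z = zer (Dom C f) (Cod C f)" using assms ZO by simp
  then have "f = zer Z (Cod C f) \<cdot> zer (Dom C f) Z" using f by metis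
  then show "is_zero_arrow C f" using Z ZO assms unfolding is_zero_arrow_def Hom_iff
    by (metis Cod_Ob Cod_zer Dom_Ob Dom_zer zer_Ar)
qed

text \<open>An equation fit for rewriting, whereas \<open>is_zero_arrow\<close> asserts a
  factorisation through some zero object; for composable arrows the two agree.\<close>

definition kills where "kills r s \<longleftrightarrow> r \<cdot> s = zer (Dom C s) (Cod C r)"

lemma zero_arrow_Comp_iff:
  assumes "r \<in> Ar C" "s \<in> Ar C" "Cod C s = Dom C r"
  shows "is_zero_arrow C (r \<cdot> s) \<longleftrightarrow> kills r s"
  using zero_arrow_iff[of "r \<cdot> s"] assms unfolding kills_def by (metis Comp_Ar Dom_Comp Cod_Comp)

lemma kills_Comp_left:
  assumes "kills r s" "r \<in> Ar C" "s \<in> Ar C" "Cod C s = Dom C r" "h \<in> Ar C" "Dom C h = Cod C r"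
  shows "kills (h \<cdot> r) s"
  using assms by (simp add: kills_def Comp_assoc)

lemma kills_Comp_right:
  assumes "kills r s" "r \<in> Ar C" "s \<in> Ar C" "Cod C s = Dom C r" "h \<in> Ar C" "Cod C h = Dom C s"
  shows "kills r (s \<cdot> h)"
  using assms by (simp add: kills_def flip: Comp_assoc)

lemma kills_sub_le:
  assumes "kills r t" "sub_le C s t" "r \<in> Ar C" "t \<in> Ar C" "Cod C t = Dom C r"
  shows "kills r s"
  using assms kills_Comp_right unfolding sub_le_iff by metis

text \<open>The universal property as an equivalence for arbitrary arrows \<open>g\<close>; the
  uniqueness of the factorisation is stored in \<open>k\<close> being monic.\<close>

lemma kernel_iff:
  assumes f: "f \<in> Ar C" and k: "is_kernel C f k"
  shows "k \<in> subobjects C (Dom C f)" "kills f k"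
    and "\<And>g. g \<in> Ar C \<Longrightarrow> Cod C g = Dom C f \<Longrightarrow> sub_le C g k \<longleftrightarrow> kills f g"
proof -
  have kA: "k \<in> Ar C" "Cod C k = Dom C f" and z: "is_zero_arrow C (f \<cdot> k)"
    and u: "\<And>W g. g\<in>Hom C W (Dom C f) \<Longrightarrow> is_zero_arrow C (f \<cdot> g) \<Longrightarrow>
        (\<exists>!h. h \<in> Hom C W (Dom C k) \<and> k \<cdot> h = g)"
    using k unfolding is_kernel_def by blast+
  show kk: "kills f k" using z kA f by (simp add: zero_arrow_Comp_iff)
  show "k \<in> subobjects C (Dom C f)" unfolding subobjects_iff is_mono_def
  proof (intro conjI allI ballI impI)
    fix W g h assume gh: "g \<in> Hom C W (Dom C k)" "h \<in> Hom C W (Dom C k)" "k \<cdot> g = k \<cdot> h"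
    have "is_zero_arrow C (f \<cdot> k \<cdot> g)"
      using kills_Comp_right[OF kk, of g] f kA gh(1) by (auto simp: zero_arrow_Comp_iff Hom_iff)
    then show "g = h" using u[of "k \<cdot> g" W] gh kA by (metis Comp_Hom Hom_iff)
  qed (use kA in auto)
  show "sub_le C g k \<longleftrightarrow> kills f g" if g: "g \<in> Ar C" "Cod C g = Dom C f" for g
  proof
    show "sub_le C g k \<Longrightarrow> kills f g" using kills_sub_le[OF kk] f kA by simp
    assume "kills f g"
    then have "is_zero_arrow C (f \<cdot> g)" using f g by (simp add: zero_arrow_Comp_iff)
    moreover have "g \<in> Hom C (Dom C g) (Dom C f)" using g by (simp add: Hom_iff)
    ultimately show "sub_le C g k" unfolding sub_le_def using u by blast
  qed
qed

lemma ex_ker: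
  assumes "f \<in> Ar C"
  obtains k where "k \<in> subobjects C (Dom C f)" "\<And>g. g \<in> Ar C \<Longrightarrow> Cod C g = Dom C f \<Longrightarrow> sub_le C g k \<longleftrightarrow> kills f g"
  using kernel_iff[OF assms] kers[OF assms] by metis

text \<open>A monomorphism is the kernel of some \<open>f\<close>, so lying in \<open>s\<close>
  becomes an equation. Inclusions in a subobject are repeatedly proved below by testing against such
  an \<open>f\<close>.\<close>

lemma subobject_ker:
  assumes "s \<in> subobjects C X"
  obtains f where "f \<in> Ar C" "Dom C f = X" "\<And>g. g \<in> Ar C \<Longrightarrow> Cod C g = X \<Longrightarrow> sub_le C g s \<longleftrightarrow> kills f g"
proof -
  obtain f where f: "f \<in> Ar C" "is_kernel C f s"
    using assms mono_ker unfolding subobjects_iff by blast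
  moreover have "Dom C f = X" using kernel_iff(1)[OF f] assms by (simp add: subobjects_iff)
  ultimately show thesis using that kernel_iff(3)[OF f] by blast
qed

text \<open>If \<open>s\<close> is the kernel of \<open>h\<close>, its preimage along
  \<open>f\<close> is the kernel of \<open>h \<cdot> f\<close>. The equivalence for all
  \<open>g\<close> is the universal property of the pullback.\<close>

lemma preimage:
  assumes "s \<in> subobjects C X" "f \<in> Ar C" "Cod C f = X"
  obtains t where "t \<in> subobjects C (Dom C f)"
    "\<And>g. g \<in> Ar C \<Longrightarrow> Cod C g = Dom C f \<Longrightarrow> sub_le C g t \<longleftrightarrow> sub_le C (f \<cdot> g) s"
proof -
  obtain h where h: "h \<in> Ar C" "Dom C h = X" "\<And>g. g \<in> Ar C \<Longrightarrow> Cod C g = X \<Longrightarrow> sub_le C g s \<longleftrightarrow> kills h g"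
    using subobject_ker[OF assms(1)] by blast
  have hf: "h \<cdot> f \<in> Ar C" "Dom C (h \<cdot> f) = Dom C f" using h assms by auto
  obtain t where t: "t \<in> subobjects C (Dom C (h \<cdot> f))"
     "\<And>g. g \<in> Ar C \<Longrightarrow> Cod C g = Dom C (h \<cdot> f) \<Longrightarrow> sub_le C g t \<longleftrightarrow> kills (h \<cdot> f) g"
    using ex_ker[OF hf(1)] by blast
  show thesis
  proof
    show "t \<in> subobjects C (Dom C f)" using t hf by simp
    fix g assume "g \<in> Ar C" "Cod C g = Dom C f"
    then show "sub_le C g t \<longleftrightarrow> sub_le C (f \<cdot> g) s"
      using t hf h assms by (simp add: kills_def Comp_assoc)
  qed
qed

text \<open>Write \<open>s\<close> as the kernel of \<open>f\<close>. Then \<open>f\<close> kills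
  \<open>s\<close>, so the hypothesis forces \<open>f = 0\<close>, and the kernel of zero is
  everything. In other words, a subobject that is also epic is the whole object.\<close>

lemma Id_sub_leI:
  assumes "s \<in> subobjects C X"
    "\<And>r. r \<in> Ar C \<Longrightarrow> Dom C r = X \<Longrightarrow> kills r s \<Longrightarrow> r = zer X (Cod C r)"
  shows "sub_le C (Id C X) s"
proof -
  obtain f where f: "f \<in> Ar C" "Dom C f = X" "\<And>g. g \<in> Ar C \<Longrightarrow> Cod C g = X \<Longrightarrow> sub_le C g s \<longleftrightarrow> kills f g"
    using subobject_ker[OF assms(1)] by blast
  have "kills f s" using f(3)[of s] assms(1) by (simp add: subobjects_iff)
  then have "f = zer X (Cod C f)" using assms(2) f by blast
  then have "kills f (Id C X)" using f by (auto simp: kills_def)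
  then show ?thesis using f by auto
qed

lemma kills_Id_sub_le:
  assumes "sub_le C (Id C X) s" "kills r s" "r \<in> Ar C" "Dom C r = X" "s \<in> Ar C" "Cod C s = X"
  shows "r = zer X (Cod C r)"
  using kills_sub_le[OF assms(2,1)] assms by (auto simp: kills_def)

lemma cokernel_iff:
  assumes f: "f \<in> Ar C" and k: "is_cokernel C f q"
  shows "q \<in> Ar C" "Dom C q = Cod C f" "is_epi C q" "kills q f"
    and "\<And>g. g \<in> Ar C \<Longrightarrow> Dom C g = Cod C f \<Longrightarrow> kills g f \<Longrightarrow> \<exists>h\<in>Hom C (Cod C q) (Cod C g). h \<cdot> q = g"
proof -
  show kA: "q \<in> Ar C" "Dom C q = Cod C f" 
    using k unfolding is_cokernel_def by blast+
  have z: "is_zero_arrow C (q \<cdot> f)"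
    and u: "\<And>Z g. g\<in>Hom C (Cod C f) Z \<Longrightarrow> is_zero_arrow C (g \<cdot> f) \<Longrightarrow>
        (\<exists>!h. h \<in> Hom C (Cod C q) Z \<and> h \<cdot> q = g)"
    using k unfolding is_cokernel_def by blast+
  show kk: "kills q f" using z kA f by (simp add: zero_arrow_Comp_iff)
  show "is_epi C q" unfolding is_epi_def
  proof (intro conjI allI ballI impI)
    fix Z g h assume gh: "g \<in> Hom C (Cod C q) Z" "h \<in> Hom C (Cod C q) Z" "g \<cdot> q = h \<cdot> q"
    have "is_zero_arrow C ((g \<cdot> q) \<cdot> f)"
      using kills_Comp_left[OF kk, of g] f kA gh(1) by (auto simp: zero_arrow_Comp_iff Hom_iff)
    then show "g = h" using u[of "g \<cdot> q" Z] gh kA by (metis Comp_Hom Hom_iff)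
  qed (use kA in auto)
  show "\<exists>h\<in>Hom C (Cod C q) (Cod C g). h \<cdot> q = g" if g: "g \<in> Ar C" "Dom C g = Cod C f" "kills g f" for g
  proof -
    have "is_zero_arrow C (g \<cdot> f)" using f g by (simp add: zero_arrow_Comp_iff)
    moreover have "g \<in> Hom C (Cod C f) (Cod C g)" using g by (simp add: Hom_iff)
    ultimately show ?thesis using u by blast
  qed
qed

lemma mono_if_ker_zero:
  assumes m: "m \<in> Ar C"
    and k: "k \<in> subobjects C (Dom C m)" "\<And>g. g \<in> Ar C \<Longrightarrow> Cod C g = Dom C m \<Longrightarrow> sub_le C g k \<longleftrightarrow> kills m g"
    and z: "k = zer (Dom C k) (Dom C m)"
  shows "is_mono C m"
  unfolding is_mono_def
proof (intro conjI allI ballI impI m)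
  fix W g h assume gh: "g \<in> Hom C W (Dom C m)" "h \<in> Hom C W (Dom C m)" "m \<cdot> g = m \<cdot> h"
  obtain h' where h': "h' \<in> Hom C W (Dom C m)" "add h h' = zer W (Dom C m)" "add h' h = zer W (Dom C m)"
    using ex_minus[OF gh(2)] by blast
  \<comment> \<open>The difference of \<open>g\<close> and \<open>h\<close>. It is killed by
    \<open>m\<close>, so it factors through the zero kernel.\<close>
  let ?d = "add g h'"
  have d: "?d \<in> Hom C W (Dom C m)" using add_Hom gh h' by blast
  have mH: "m \<in> Hom C (Dom C m) (Cod C m)" using m by (simp add: Hom_iff)
  have "m \<cdot> ?d = add (m \<cdot> h) (m \<cdot> h')" using Comp_add[OF gh(1) h'(1) mH] gh(3) by simp
  also have "\<dots> = m \<cdot> zer W (Dom C m)" using Comp_add[OF gh(2) h'(1) mH] h'(2) by simp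
  finally have "kills m ?d" using d m unfolding kills_def Hom_iff by auto
  then have "sub_le C ?d k" using k(2) d by (simp add: Hom_iff)
  then obtain e where e: "e \<in> Ar C" "Dom C e = W" "Cod C e = Dom C k" "k \<cdot> e = ?d"
    using d unfolding sub_le_iff Hom_iff by auto
  have kA: "Dom C k \<in> Ob C" using k(1) by (simp add: subobjects_iff)
  have "zer (Dom C k) (Dom C m) \<cdot> e = zer W (Dom C m)" using e m kA by simp
  then have d0: "?d = zer W (Dom C m)" using e(4) z by simp
  have "add ?d h = add g (add h' h)" using add_assoc[OF gh(1) h'(1) gh(2)] .
  then have "h = g" using d0 h'(3) add_zer_left[OF gh(2)] add_zer_right[OF gh(1)] by simp
  then show "g = h" ..
qed

text \<open>The mixed relations follow from those in \<open>has_biproduct\<close>. Composing the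
  decomposition of \<open>Id C B\<close> with \<open>p1\<close> and cancelling gives
  \<open>p1 \<cdot> i2 = 0\<close>; composing it with \<open>p2\<close> and \<open>i1\<close> gives
  \<open>x + x = x\<close> for \<open>x = p2 \<cdot> i1\<close>.\<close>

lemma biproduct:
  assumes "X \<in> Ob C" "Y \<in> Ob C"
  obtains B i1 i2 p1 p2 where "B \<in> Ob C" "i1 \<in> Hom C X B" "i2 \<in> Hom C Y B" "p1 \<in> Hom C B X" "p2 \<in> Hom C B Y"
    "p1 \<cdot> i1 = Id C X" "p2 \<cdot> i2 = Id C Y" "add (i1 \<cdot> p1) (i2 \<cdot> p2) = Id C B"
    "p1 \<cdot> i2 = zer Y X" "p2 \<cdot> i1 = zer X Y"
proof -
  obtain B i1 i2 p1 p2 where B: "B \<in> Ob C" and i: "i1 \<in> Hom C X B" "i2 \<in> Hom C Y B"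
    and p: "p1 \<in> Hom C B X" "p2 \<in> Hom C B Y"
    and e: "p1 \<cdot> i1 = Id C X" "p2 \<cdot> i2 = Id C Y" "add (i1 \<cdot> p1) (i2 \<cdot> p2) = Id C B"
    using bip[OF assms] unfolding has_biproduct_def by metis
  note H = i[unfolded Hom_iff] p[unfolded Hom_iff]
  have ip: "i1 \<cdot> p1 \<in> Hom C B B" "i2 \<cdot> p2 \<in> Hom C B B" using i p Comp_Hom by blast+
  have "add (p1 \<cdot> i1 \<cdot> p1) (p1 \<cdot> i2 \<cdot> p2) = p1"
    using Comp_add[OF ip p(1)] e(3) H by simp
  then have "add p1 (p1 \<cdot> i2 \<cdot> p2) = add p1 (zer B X)"
    using H e(1) add_zer_right[OF p(1)] by (simp flip: Comp_assoc)
  then have "p1 \<cdot> i2 \<cdot> p2 = zer B X"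
    using add_left_cancel[OF p(1)] H zer_Hom assms B by (simp add: Hom_iff)
  then have "(p1 \<cdot> i2 \<cdot> p2) \<cdot> i2 = zer B X \<cdot> i2" by simp
  then have 1: "p1 \<cdot> i2 = zer Y X" using H e(2) assms by (simp add: Comp_assoc)
  have "add (p2 \<cdot> i1 \<cdot> p1) (p2 \<cdot> i2 \<cdot> p2) = p2"
    using Comp_add[OF ip p(2)] e(3) H by simp
  then have "add (p2 \<cdot> i1 \<cdot> p1) p2 = p2"
    using H e(2) by (simp flip: Comp_assoc)
  then have "add (p2 \<cdot> i1 \<cdot> p1) p2 \<cdot> i1 = p2 \<cdot> i1" by simp
  moreover have "add (p2 \<cdot> i1 \<cdot> p1) p2 \<cdot> i1 = add ((p2 \<cdot> i1 \<cdot> p1) \<cdot> i1) (p2 \<cdot> i1)"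
    by (rule add_Comp[OF i(1)]) (use H in \<open>auto simp: Hom_iff\<close>)
  moreover have "(p2 \<cdot> i1 \<cdot> p1) \<cdot> i1 = p2 \<cdot> i1" using H e(1) by (simp add: Comp_assoc)
  ultimately have "add (p2 \<cdot> i1) (p2 \<cdot> i1) = add (p2 \<cdot> i1) (zer X Y)"
    using add_zer_right[of "p2 \<cdot> i1" X Y] H by (simp add: Hom_iff)
  moreover have "p2 \<cdot> i1 \<in> Hom C X Y" using i(1) p(2) Comp_Hom by blast
  ultimately have 2: "p2 \<cdot> i1 = zer X Y" using add_left_cancel zer_Hom[OF assms] by blast
  show thesis using that[OF B i p e 1 2] .
qed

end

section \<open>Grothendieck categories\<close>

locale grothendieck = abelian C add zer
  for C :: "('o, 'm) category" and add zer +
  fixes u :: "'u itself" and G :: 'o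
  assumes univ: "universe u" and ab5: "AB5 u C" and gen: "is_generator u C G"
begin

lemma G_Ob [simp]: "G \<in> Ob C"
  using gen by (simp add: is_generator_def)

text \<open>Vanishing is tested on arrows from \<open>G\<close> alone; this is what replaces large
  families by subsets of the small set \<open>Hom C G X\<close>.\<close>

lemma generator_zer:
  assumes "r \<in> Ar C" "\<And>x. x \<in> Ar C \<Longrightarrow> Dom C x = G \<Longrightarrow> Cod C x = Dom C r \<Longrightarrow> kills r x"
  shows "r = zer (Dom C r) (Cod C r)"
proof -
  have "\<And>X Y f g. f \<in> Hom C X Y \<Longrightarrow> g \<in> Hom C X Y \<Longrightarrow> \<forall>h\<in>Hom C G X. f \<cdot> h = g \<cdot> h \<Longrightarrow> f = g"
    using gen unfolding is_generator_def by blast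
  from this[of r "Dom C r" "Cod C r" "zer (Dom C r) (Cod C r)"] assms show ?thesis
    by (simp add: Hom_iff kills_def)
qed

text \<open>The sum of the images of the arrows in \<open>T\<close>: like \<open>is_union\<close>,
  but the members need not be monic.\<close>

definition is_span where
  "is_span Y T s \<longleftrightarrow> s \<in> subobjects C Y \<and> (\<forall>t\<in>T. sub_le C t s) \<and>
     (\<forall>v\<in>subobjects C Y. (\<forall>t\<in>T. sub_le C t v) \<longrightarrow> sub_le C s v)"

text \<open>\<open>T\<close> may be large; the arrows from the generator that factor through a member of \<open>T\<close> form a
  small set with the same span, namely the kernel of the cokernel of their coproduct.\<close>

lemma ex_span:
  assumes Y: "Y \<in> Ob C" and T: "\<And>t. t \<in> T \<Longrightarrow> t \<in> Ar C \<and> Cod C t = Y"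
  shows "\<exists>s. is_span Y T s"
proof -
  define E where "E = {x \<in> Hom C G Y. \<exists>t\<in>T. sub_le C x t}"
  have "small u (Hom C G Y)" using gen Y by (simp add: is_generator_def)
  then have sE: "small u E"
    by (rule small_mono) (auto simp: E_def intro: subset_imp_lepoll)
  then obtain \<phi> :: "'m \<Rightarrow> 'u" where \<phi>: "inj_on \<phi> E"
    using lesspoll_imp_lepoll unfolding small_def lepoll_def by blast
  \<comment> \<open>AB3 provides coproducts indexed by subsets of \<open>'u\<close>, so
    \<open>E\<close> is transported there.\<close>
  define I where "I = \<phi> ` E"
  have "small u I" unfolding I_def by (rule small_image[OF sE])
  then have "has_coproduct C I (\<lambda>_. G)"
    using ab5 unfolding AB5_def AB3_def by simp
  then obtain P inj where "P \<in> Ob C" "\<forall>i\<in>I. inj i \<in> Hom C G P"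
    "\<forall>Z\<in>Ob C. \<forall>g. (\<forall>i\<in>I. g i \<in> Hom C G Z) \<longrightarrow> (\<exists>!h. h \<in> Hom C P Z \<and> (\<forall>i\<in>I. h \<cdot> inj i = g i))"
    unfolding has_coproduct_def by (elim bexE exE conjE) (rule that)
  then have P: "P \<in> Ob C" "\<And>i. i \<in> I \<Longrightarrow> inj i \<in> Hom C G P"
    and uni: "\<And>Z g. Z \<in> Ob C \<Longrightarrow> \<forall>i\<in>I. g i \<in> Hom C G Z \<Longrightarrow> \<exists>!h. h \<in> Hom C P Z \<and> (\<forall>i\<in>I. h \<cdot> inj i = g i)"
    by blast+
  have "\<forall>i\<in>I. inv_into E \<phi> i \<in> Hom C G Y"
    using inv_into_into[of _ \<phi> E] unfolding I_def by (auto simp: E_def)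
  from uni[OF Y this] obtain h where h: "h \<in> Hom C P Y" "\<forall>i\<in>I. h \<cdot> inj i = inv_into E \<phi> i"
    by blast
  have hx: "h \<cdot> inj (\<phi> x) = x" "inj (\<phi> x) \<in> Hom C G P" if "x \<in> E" for x
    using h(2) that \<phi> P(2) by (auto simp: I_def)
  have hA: "h \<in> Ar C" "Dom C h = P" "Cod C h = Y" using h by (auto simp: Hom_iff)
  obtain q where "is_cokernel C h q" using cokers hA by blast
  note q = cokernel_iff[OF hA(1) this, unfolded hA]
  obtain s where s: "s \<in> subobjects C Y" "\<And>g. g \<in> Ar C \<Longrightarrow> Cod C g = Y \<Longrightarrow> sub_le C g s \<longleftrightarrow> kills q g"
    using ex_ker[OF q(1)] q(2) by metis
  have "sub_le C t s" if t: "t \<in> T" for t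
  proof -
    have tA: "t \<in> Ar C" "Cod C t = Y" using T t by auto
    have "kills (q \<cdot> t) y" if y: "y \<in> Ar C" "Dom C y = G" "Cod C y = Dom C t" for y
    proof -
      \<comment> \<open>Testing \<open>t\<close> on arrows \<open>y\<close> from \<open>G\<close>
        suffices, and each \<open>t \<cdot> y\<close> is one of the arrows assembled in
        \<open>h\<close>.\<close>
      have ty: "t \<cdot> y \<in> E" using tA y t sub_le_Comp unfolding E_def Hom_iff by auto
      have "kills q (h \<cdot> inj (\<phi> (t \<cdot> y)))"
        using kills_Comp_right[OF q(4,1) hA(1)] hx(2)[OF ty] q(2) hA by (simp add: Hom_iff)
      then show ?thesis using hx(1)[OF ty] tA y q(1,2) by (simp add: kills_def Comp_assoc)
    qed
    then have "kills q t" using generator_zer[of "q \<cdot> t"] tA q(1,2) by (simp add: kills_def)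
    then show ?thesis using s(2) tA by blast
  qed
  moreover have "sub_le C s v" if v: "v \<in> subobjects C Y" "\<forall>t\<in>T. sub_le C t v" for v
  proof -
    obtain g where g: "g \<in> Ar C" "Dom C g = Y" "\<And>x. x \<in> Ar C \<Longrightarrow> Cod C x = Y \<Longrightarrow> sub_le C x v \<longleftrightarrow> kills g x"
      using subobject_ker[OF v(1)] by blast
    have vA: "v \<in> Ar C" using v(1) by (simp add: subobjects_iff)
    have gx: "g \<cdot> x = zer G (Cod C g)" if "x \<in> E" for x
    proof -
      have "sub_le C x v" using that v(2) sub_le_trans vA unfolding E_def by blast
      then show ?thesis using g(3)[of x] that by (simp add: E_def Hom_iff kills_def)
    qed
    have "\<forall>i\<in>I. zer G (Cod C g) \<in> Hom C G (Cod C g)" using g zer_Hom by simp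
    \<comment> \<open>\<open>g \<cdot> h\<close> and the zero arrow agree on every summand, hence
      are equal. So \<open>g\<close> factors through the cokernel \<open>q\<close> of
      \<open>h\<close> and kills \<open>s\<close>.\<close>
    from uni[OF _ this] have "\<exists>!k. k \<in> Hom C P (Cod C g) \<and> (\<forall>i\<in>I. k \<cdot> inj i = zer G (Cod C g))"
      using g by simp
    moreover have "(g \<cdot> h) \<cdot> inj i = zer G (Cod C g)" "zer P (Cod C g) \<cdot> inj i = zer G (Cod C g)" if "i \<in> I" for i
    proof -
      obtain x where x: "x \<in> E" "i = \<phi> x" using \<open>i \<in> I\<close> unfolding I_def by blast
      show "(g \<cdot> h) \<cdot> inj i = zer G (Cod C g)"
        using hx[OF x(1)] gx[OF x(1)] g hA x by (simp add: Comp_assoc Hom_iff)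
      show "zer P (Cod C g) \<cdot> inj i = zer G (Cod C g)"
        using hx(2)[OF x(1)] g x by (simp add: Hom_iff)
    qed
    moreover have "g \<cdot> h \<in> Hom C P (Cod C g)" "zer P (Cod C g) \<in> Hom C P (Cod C g)"
      using g hA P zer_Hom by (auto simp: Hom_iff)
    ultimately have "g \<cdot> h = zer P (Cod C g)" by blast
    then have "kills g h" using hA by (simp add: kills_def)
    then obtain k where k: "k \<in> Hom C (Cod C q) (Cod C g)" "k \<cdot> q = g" using q(5) g by blast
    have sA: "s \<in> Ar C" "Cod C s = Y" using s(1) by (auto simp: subobjects_iff)
    then have "kills q s" using s(2)[of s] sub_le_refl[of s] by simp
    then have "kills (k \<cdot> q) s"
      using kills_Comp_left[of q s k] q(1,2) sA k(1) by (simp add: Hom_iff)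
    then show ?thesis using g(3) sA k(2) by simp
  qed
  ultimately show ?thesis unfolding is_span_def using s(1) by blast
qed

text \<open>The kernel of \<open>r\<close> is a subobject above all of \<open>T\<close>, hence above
  the span.\<close>

lemma kills_span:
  assumes "is_span Y T s" "\<And>t. t \<in> T \<Longrightarrow> t \<in> Ar C \<and> Cod C t = Y"
    "r \<in> Ar C" "Dom C r = Y" "\<And>t. t \<in> T \<Longrightarrow> kills r t"
  shows "kills r s"
proof -
  obtain k where k: "k \<in> subobjects C Y" "\<And>g. g \<in> Ar C \<Longrightarrow> Cod C g = Y \<Longrightarrow> sub_le C g k \<longleftrightarrow> kills r g"
    using ex_ker[OF assms(3)] assms(4) by metis
  then have "\<forall>t\<in>T. sub_le C t k" using assms(2,5) by blast
  then have "sub_le C s k" "s \<in> Ar C" "Cod C s = Y"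
    using assms(1) k(1) by (auto simp: is_span_def subobjects_iff)
  then show ?thesis using k by blast
qed

text \<open>As for \<open>kills_span\<close>, with the preimage of \<open>v\<close> along
  \<open>f\<close> in place of the kernel.\<close>

lemma span_comp_left:
  assumes "is_span Y T s" "\<And>t. t \<in> T \<Longrightarrow> t \<in> Ar C \<and> Cod C t = Y"
    "f \<in> Ar C" "Dom C f = Y" "v \<in> subobjects C (Cod C f)" "\<And>t. t \<in> T \<Longrightarrow> sub_le C (f \<cdot> t) v"
  shows "sub_le C (f \<cdot> s) v"
proof -
  obtain k where k: "k \<in> subobjects C Y" "\<And>g. g \<in> Ar C \<Longrightarrow> Cod C g = Y \<Longrightarrow> sub_le C g k \<longleftrightarrow> sub_le C (f \<cdot> g) v"
    using preimage[OF assms(5,3)] assms(4) by metis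
  then have "\<forall>t\<in>T. sub_le C t k" using assms(2,6) by blast
  then have "sub_le C s k" "s \<in> Ar C" "Cod C s = Y"
    using assms(1) k(1) by (auto simp: is_span_def subobjects_iff)
  then show ?thesis using k by blast
qed

text \<open>Bridges the arbitrary directed families of \<open>finite_type\<close> and the small ones
  of \<open>AB5\<close>. For each arrow from \<open>G\<close> that factors through some member one
  such member is kept, and the result is closed under chosen upper bounds. By the generator
  property, a subobject above all kept members is above all of \<open>S\<close>.\<close>

lemma small_directed:
  assumes X: "X \<in> Ob C" and S: "directed_subobjects C X S" "is_union C X S (Id C X)"
  obtains S' where "S' \<subseteq> S" "small u S'" "directed_subobjects C X S'" "is_union C X S' (Id C X)"
proof -
  have SA: "s \<in> Ar C" "Cod C s = X" "s \<in> subobjects C X" if "s \<in> S" for s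
    using S that unfolding directed_subobjects_def by (auto simp: subobjects_iff)
  have Ssub: "S \<subseteq> subobjects C X" using SA by blast
  define E where "E = {x \<in> Hom C G X. \<exists>s\<in>S. sub_le C x s}"
  have "small u (Hom C G X)" using gen X by (simp add: is_generator_def)
  then have sE: "small u E"
    by (rule small_mono) (auto simp: E_def intro: subset_imp_lepoll)
  define c where "c x = (SOME s. s \<in> S \<and> sub_le C x s)" for x
  have c: "c x \<in> S \<and> sub_le C x (c x)" if "x \<in> E" for x
    unfolding c_def by (rule someI_ex) (use that in \<open>auto simp: E_def\<close>)
  define j where "j s t = (SOME v. v \<in> S \<and> sub_le C s v \<and> sub_le C t v)" for s t
  have j: "j s t \<in> S \<and> sub_le C s (j s t) \<and> sub_le C t (j s t)" if "s \<in> S" "t \<in> S" for s t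
    unfolding j_def by (rule someI_ex) (use directedE[OF S(1) that] in blast)
  obtain S' where S': "c ` E \<subseteq> S'" "S' \<subseteq> S" "small u S'" "\<And>a b. a \<in> S' \<Longrightarrow> b \<in> S' \<Longrightarrow> j a b \<in> S'"
    using small_closure[OF univ small_image[OF sE, of c], of S j] c j by blast
  \<comment> \<open>Ensures that \<open>E\<close>, and with it \<open>S'\<close>, is
    nonempty.\<close>
  have "zer G X \<in> E"
  proof -
    obtain s where s: "s \<in> S" using S by (auto simp: directed_subobjects_def)
    have "zer G X = s \<cdot> zer G (Dom C s)" using SA[OF s] by simp
    then have "sub_le C (zer G X) s" using sub_le_Comp[of "zer G (Dom C s)" s] SA[OF s] by simp
    then show ?thesis using s X zer_Hom by (auto simp: E_def)
  qed
  then have "S' \<noteq> {}" using S'(1) by blast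
  then have D: "directed_subobjects C X S'"
    unfolding directed_subobjects_def
  proof (intro conjI ballI)
    show "S' \<subseteq> subobjects C X" using S'(2) Ssub by blast
    show "\<exists>w\<in>S'. sub_le C s w \<and> sub_le C t w" if "s \<in> S'" "t \<in> S'" for s t
      using S'(4)[OF that] j[of s t] that S'(2) by blast
  qed
  have "sub_le C (Id C X) v" if v: "v \<in> subobjects C X" "\<forall>s\<in>S'. sub_le C s v" for v
  proof -
    obtain g where g: "g \<in> Ar C" "Dom C g = X" "\<And>x. x \<in> Ar C \<Longrightarrow> Cod C x = X \<Longrightarrow> sub_le C x v \<longleftrightarrow> kills g x"
      using subobject_ker[OF v(1)] by blast
    have vA: "v \<in> Ar C" using v(1) by (simp add: subobjects_iff)
    have "sub_le C s v" if s: "s \<in> S" for s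
    proof -
      have "kills (g \<cdot> s) y" if y: "y \<in> Ar C" "Dom C y = G" "Cod C y = Dom C s" for y
      proof -
        have sy: "s \<cdot> y \<in> E" using SA[OF s] y s sub_le_Comp unfolding E_def Hom_iff by auto
        then have "c (s \<cdot> y) \<in> S'" "sub_le C (s \<cdot> y) (c (s \<cdot> y))" using c[OF sy] S'(1) by auto
        then have "sub_le C (s \<cdot> y) v" using v(2) sub_le_trans[OF _ _ vA] by blast
        then show ?thesis using g SA[OF s] y by (simp add: kills_def Comp_assoc)
      qed
      then have "kills g s" using generator_zer[of "g \<cdot> s"] SA[OF s] g(1,2) by (simp add: kills_def)
      then show ?thesis using g SA[OF s] by blast
    qed
    then show ?thesis using S(2) v(1) is_union_Id_iff[OF X Ssub] by blast
  qed
  then have "is_union C X S' (Id C X)" using is_union_Id_iff[OF X] S'(2) Ssub by blast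
  then show thesis using that S' D by blast
qed

text \<open>AB5 for the preimages along \<open>f\<close>: intersect the subobjects \<open>Y \<oplus> s\<close> of \<open>Y \<oplus> X\<close> with the graph
  of \<open>f\<close>.\<close>

lemma preimage_directed_union:
  assumes X: "X \<in> Ob C" and S: "directed_subobjects C X S" "is_union C X S (Id C X)"
    and f: "f \<in> Ar C" "Dom C f = Y" "Cod C f = X" and v: "v \<in> subobjects C Y"
    and le: "\<And>s g. s \<in> S \<Longrightarrow> g \<in> Ar C \<Longrightarrow> Cod C g = Y \<Longrightarrow> sub_le C (f \<cdot> g) s \<Longrightarrow> sub_le C g v"
  shows "sub_le C (Id C Y) v"
proof -
  have Y: "Y \<in> Ob C" using f by auto
  have vA: "v \<in> Ar C" "Cod C v = Y" using v by (auto simp: subobjects_iff)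
  obtain S' where S': "S' \<subseteq> S" "small u S'" "directed_subobjects C X S'" "is_union C X S' (Id C X)"
    using small_directed[OF X S] by blast
  have SA: "s \<in> Ar C" "Cod C s = X" "s \<in> subobjects C X" if "s \<in> S'" for s
    using S' that unfolding directed_subobjects_def by (auto simp: subobjects_iff)
  obtain B i1 i2 p1 p2 where B: "B \<in> Ob C" and ip: "i1 \<in> Hom C Y B" "i2 \<in> Hom C X B" "p1 \<in> Hom C B Y" "p2 \<in> Hom C B X"
    and e: "p1 \<cdot> i1 = Id C Y" "p2 \<cdot> i2 = Id C X" "add (i1 \<cdot> p1) (i2 \<cdot> p2) = Id C B"
    "p1 \<cdot> i2 = zer X Y" "p2 \<cdot> i1 = zer Y X"
    using biproduct[OF Y X] by blast
  note H = ip[unfolded Hom_iff]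
  \<comment> \<open>The graph of \<open>f\<close>. It is monic even if \<open>f\<close> is not,
    because \<open>p1\<close> retracts it, so it may enter an intersection in
    \<open>AB5\<close>.\<close>
  define \<gamma> where "\<gamma> = add i1 (i2 \<cdot> f)"
  have i2f: "i2 \<cdot> f \<in> Hom C Y B" using H f by (simp add: Hom_iff)
  have \<gamma>: "\<gamma> \<in> Hom C Y B" unfolding \<gamma>_def by (rule add_Hom[OF ip(1) i2f])
  note \<gamma>A = \<gamma>[unfolded Hom_iff]
  have p1\<gamma>: "p1 \<cdot> \<gamma> = Id C Y"
  proof -
    have "p1 \<cdot> i2 \<cdot> f = (p1 \<cdot> i2) \<cdot> f" using H f Comp_assoc[of f i2 p1] by simp
    also have "\<dots> = zer Y Y" using e(4) f Y by simp
    finally show ?thesis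
      using Comp_add[OF ip(1) i2f ip(3)] e(1) add_zer_right[OF Id_Hom[OF Y]] by (simp add: \<gamma>_def)
  qed
  have p2\<gamma>: "p2 \<cdot> \<gamma> = f"
  proof -
    have "p2 \<cdot> i2 \<cdot> f = (p2 \<cdot> i2) \<cdot> f" using H f Comp_assoc[of f i2 p2] by simp
    also have "\<dots> = f" using e(2) f by simp
    finally show ?thesis
      using Comp_add[OF ip(1) i2f ip(4)] e(5) add_zer_left[of f Y X] f by (simp add: \<gamma>_def Hom_iff)
  qed
  have \<gamma>cancel: "g = h" if "g \<in> Ar C" "h \<in> Ar C" "Cod C g = Y" "Cod C h = Y" "\<gamma> \<cdot> g = \<gamma> \<cdot> h" for g h
  proof -
    have "(p1 \<cdot> \<gamma>) \<cdot> g = (p1 \<cdot> \<gamma>) \<cdot> h"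
      using that H \<gamma>A Comp_assoc[of g \<gamma> p1] Comp_assoc[of h \<gamma> p1] by simp
    then show ?thesis using that by (simp add: p1\<gamma>)
  qed
  have \<gamma>sub: "\<gamma> \<in> subobjects C B"
    using \<gamma>A \<gamma>cancel unfolding subobjects_iff is_mono_def Hom_iff[abs_def] by (auto simp: Hom_iff)
  \<comment> \<open>\<open>pr s\<close> is the subobject \<open>Y \<oplus> s\<close>, obtained as
    the preimage of \<open>s\<close> along \<open>p2\<close>.\<close>
  define pr where "pr s = (SOME t. t \<in> subobjects C B \<and>
      (\<forall>g. g \<in> Ar C \<longrightarrow> Cod C g = B \<longrightarrow> (sub_le C g t \<longleftrightarrow> sub_le C (p2 \<cdot> g) s)))" for s
  have pr: "pr s \<in> subobjects C B \<and>
      (\<forall>g. g \<in> Ar C \<longrightarrow> Cod C g = B \<longrightarrow> (sub_le C g (pr s) \<longleftrightarrow> sub_le C (p2 \<cdot> g) s))" if "s \<in> S'" for s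
    unfolding pr_def by (rule someI_ex) (use preimage[OF SA(3)[OF that], of p2] H in metis)
  have prA: "pr s \<in> Ar C" "Cod C (pr s) = B" if "s \<in> S'" for s
    using pr[OF that] by (auto simp: subobjects_iff)
  have prle: "sub_le C g (pr s) \<longleftrightarrow> sub_le C (p2 \<cdot> g) s" if "s \<in> S'" "g \<in> Ar C" "Cod C g = B" for g s
    using pr[OF that(1)] that by blast
  have prself: "sub_le C (p2 \<cdot> pr s) s" if "s \<in> S'" for s
    using prle[OF that prA[OF that]] prA[OF that] by simp
  have dir: "directed_subobjects C B (pr ` S')"
  proof -
    have "\<exists>w\<in>S'. sub_le C (pr s) (pr w) \<and> sub_le C (pr t) (pr w)" if st: "s \<in> S'" "t \<in> S'" for s t
    proof -
      obtain w where w: "w \<in> S'" "sub_le C s w" "sub_le C t w" using directedE[OF S'(3) st] by blast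
      have "sub_le C (p2 \<cdot> pr s) w" "sub_le C (p2 \<cdot> pr t) w"
        using sub_le_trans[OF prself[OF st(1)] w(2)] sub_le_trans[OF prself[OF st(2)] w(3)] SA[OF w(1)] by auto
      then show ?thesis using w(1) prle prA st by blast
    qed
    moreover have "S' \<noteq> {}" using S'(3) by (auto simp: directed_subobjects_def)
    ultimately show ?thesis using pr unfolding directed_subobjects_def by blast
  qed
  have un: "is_union C B (pr ` S') (Id C B)"
  proof (subst is_union_Id_iff[OF B])
    show "pr ` S' \<subseteq> subobjects C B" using pr by blast
    show "\<forall>z\<in>subobjects C B. (\<forall>s\<in>pr ` S'. sub_le C s z) \<longrightarrow> sub_le C (Id C B) z"
    proof (intro ballI impI)
      fix z assume z: "z \<in> subobjects C B" "\<forall>s\<in>pr ` S'. sub_le C s z"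
      have zA: "z \<in> Ar C" "Cod C z = B" using z by (auto simp: subobjects_iff)
      obtain r where r: "r \<in> Ar C" "Dom C r = B" "\<And>g. g \<in> Ar C \<Longrightarrow> Cod C g = B \<Longrightarrow> sub_le C g z \<longleftrightarrow> kills r g"
        using subobject_ker[OF z(1)] by blast
      have le_z: "sub_le C g z" if "g \<in> Ar C" "Cod C g = B" "s \<in> S'" "sub_le C (p2 \<cdot> g) s" for g s
        using prle that z(2) sub_le_trans zA by blast
      \<comment> \<open>\<open>p2 \<cdot> i1\<close> is zero and a zero arrow factors through any
        member of \<open>S'\<close>, so \<open>z\<close> contains the summand
        \<open>Y\<close>.\<close>
      have "sub_le C i1 z"
      proof -
        obtain s where s: "s \<in> S'" using S'(3) by (auto simp: directed_subobjects_def)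
        have "zer Y X = s \<cdot> zer Y (Dom C s)" using SA[OF s] Y by simp
        then have "sub_le C (zer Y X) s" using sub_le_Comp[of "zer Y (Dom C s)" s] SA[OF s] Y by simp
        then show ?thesis using le_z[OF _ _ s] H e(5) by simp
      qed
      then have 1: "r \<cdot> i1 = zer Y (Cod C r)" using r H by (simp add: kills_def)
      \<comment> \<open>For the summand \<open>X\<close>: the preimage \<open>w\<close> of
        \<open>z\<close> along \<open>i2\<close> contains every member of \<open>S'\<close>, hence
        all of \<open>X\<close>.\<close>
      obtain w where w: "w \<in> subobjects C X" "\<And>g. g \<in> Ar C \<Longrightarrow> Cod C g = X \<Longrightarrow> sub_le C g w \<longleftrightarrow> sub_le C (i2 \<cdot> g) z"
        using preimage[OF z(1), of i2] H by metis
      have "sub_le C s w" if s: "s \<in> S'" for s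
      proof -
        have "p2 \<cdot> i2 \<cdot> s = (p2 \<cdot> i2) \<cdot> s" using H SA[OF s] Comp_assoc[of s i2 p2] by simp
        then have "p2 \<cdot> i2 \<cdot> s = s" using e(2) SA[OF s] by simp
        then have "sub_le C (i2 \<cdot> s) z" using le_z[OF _ _ s, of "i2 \<cdot> s"] H SA[OF s] by simp
        then show ?thesis using w SA[OF s] by blast
      qed
      then have "sub_le C (Id C X) w"
        using S'(4) w(1) unfolding is_union_def by blast
      then have "sub_le C i2 z" using w(2)[of "Id C X"] X H by simp
      then have 2: "r \<cdot> i2 = zer X (Cod C r)" using r H by (simp add: kills_def)
      have "r \<cdot> Id C B = add (r \<cdot> i1 \<cdot> p1) (r \<cdot> i2 \<cdot> p2)"
        using e(3) Comp_add[of "i1 \<cdot> p1" B B "i2 \<cdot> p2" r "Cod C r"] H r by (simp add: Hom_iff)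
      also have "r \<cdot> i1 \<cdot> p1 = (r \<cdot> i1) \<cdot> p1" using H r Comp_assoc[of p1 i1 r] by simp
      also have "\<dots> = zer B (Cod C r)" using 1 H r by simp
      also have "r \<cdot> i2 \<cdot> p2 = (r \<cdot> i2) \<cdot> p2" using H r Comp_assoc[of p2 i2 r] by simp
      also have "\<dots> = zer B (Cod C r)" using 2 H r by simp
      finally have "r \<cdot> Id C B = zer B (Cod C r)" using r(1) add_zer_left[OF zer_Hom[OF B, of "Cod C r"]] by simp
      then have "kills r (Id C B)" unfolding kills_def using B by simp
      then show "sub_le C (Id C B) z" using r B by simp
    qed
  qed
  \<comment> \<open>The \<open>pr s\<close> have union \<open>B\<close>, whose intersection with the
    graph is the graph. So AB5 presents the graph as the union of its intersections with the
    \<open>pr s\<close>.\<close>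
  have int: "is_intersection C B (Id C B) \<gamma> \<gamma>"
    using \<gamma>sub \<gamma>A B unfolding is_intersection_def by auto
  have "is_union C B {z. \<exists>s\<in>pr ` S'. is_intersection C B s \<gamma> z} \<gamma>"
    using ab5 B small_image[OF S'(2), of pr] dir un \<gamma>sub int unfolding AB5_def by blast
  moreover have \<gamma>v: "\<gamma> \<cdot> v \<in> subobjects C B"
    unfolding subobjects_iff is_mono_def
  proof (intro conjI allI ballI impI)
    fix W g h assume gh: "g \<in> Hom C W (Dom C (\<gamma> \<cdot> v))" "h \<in> Hom C W (Dom C (\<gamma> \<cdot> v))" "(\<gamma> \<cdot> v) \<cdot> g = (\<gamma> \<cdot> v) \<cdot> h"
    then have A: "g \<in> Ar C" "h \<in> Ar C" "Dom C g = Dom C h" "Cod C g = Dom C v" "Cod C h = Dom C v"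
      using \<gamma>A vA by (auto simp: Hom_iff)
    have e: "\<gamma> \<cdot> v \<cdot> g = \<gamma> \<cdot> v \<cdot> h"
      using gh(3) A \<gamma>A vA Comp_assoc[of g v \<gamma>] Comp_assoc[of h v \<gamma>] by simp
    have "v \<cdot> g = v \<cdot> h" by (rule \<gamma>cancel[OF _ _ _ _ e]) (use A vA in simp_all)
    then show "g = h" using A v monoD unfolding subobjects_iff by blast
  qed (use \<gamma>A vA in auto)
  \<comment> \<open>An arrow into the graph has the form \<open>\<gamma> \<cdot> z'\<close>. That it
    lies in \<open>pr s\<close> means that \<open>f \<cdot> z'\<close> lies in \<open>s\<close>, and
    then \<open>le\<close> puts \<open>z'\<close> in \<open>v\<close>.\<close>
  moreover have "sub_le C z (\<gamma> \<cdot> v)" if zz: "s \<in> S'" "is_intersection C B (pr s) \<gamma> z" for s z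
  proof -
    have z: "z \<in> Ar C" "Cod C z = B" "sub_le C z (pr s)" "sub_le C z \<gamma>"
      using zz unfolding is_intersection_def subobjects_iff by auto
    obtain z' where z': "z' \<in> Ar C" "Cod C z' = Y" "\<gamma> \<cdot> z' = z"
      using z(4) \<gamma>A unfolding sub_le_iff by auto
    have "p2 \<cdot> z = f \<cdot> z'"
      using z' \<gamma>A H Comp_assoc[of z' \<gamma> p2] p2\<gamma> by auto
    then have "sub_le C (f \<cdot> z') s" using prle[OF zz(1) z(1,2)] z(3) by simp
    then have "sub_le C z' v" using le z' S'(1) zz(1) by blast
    then show ?thesis using sub_le_comp_left[of z' v \<gamma>] vA \<gamma>A z'(3) by simp
  qed
  ultimately have "sub_le C \<gamma> (\<gamma> \<cdot> v)" unfolding is_union_def by blast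
  then obtain h where h: "h \<in> Ar C" "Dom C h = Y" "Cod C h = Dom C v" "(\<gamma> \<cdot> v) \<cdot> h = \<gamma>"
    using \<gamma>A vA unfolding sub_le_iff by auto
  have "v \<cdot> h = Id C Y"
  proof (rule \<gamma>cancel)
    have "\<gamma> \<cdot> v \<cdot> h = (\<gamma> \<cdot> v) \<cdot> h" using h(1-3) vA \<gamma>A Comp_assoc[of h v \<gamma>] by simp
    also have "\<dots> = \<gamma> \<cdot> Id C Y" using h(4) \<gamma>A by simp
    finally show "\<gamma> \<cdot> v \<cdot> h = \<gamma> \<cdot> Id C Y" .
  qed (use h vA Y in auto)
  then show ?thesis using h vA Y unfolding sub_le_iff by auto
qed

text \<open>Finitely many conditions are added one at a time. If \<open>g\<close> satisfies those of
  \<open>\<Phi>\<close> at stage \<open>s\<close>, the case of a single arrow is applied to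
  \<open>\<phi> \<cdot> g\<close> and to the preimage of \<open>v\<close> along \<open>g\<close>;
  directedness merges \<open>s\<close> with the stage \<open>t\<close> found for
  \<open>\<phi>\<close>. Infinitely many conditions need not have a common stage.\<close>

lemma preimages_directed_union:
  assumes X: "X \<in> Ob C" and S: "directed_subobjects C X S" "is_union C X S (Id C X)"
    and "finite \<Phi>" and \<Phi>: "\<And>f. f \<in> \<Phi> \<Longrightarrow> f \<in> Hom C Y X" and Y: "Y \<in> Ob C" and v: "v \<in> subobjects C Y"
    and le: "\<And>s g. s \<in> S \<Longrightarrow> g \<in> Ar C \<Longrightarrow> Cod C g = Y \<Longrightarrow> \<forall>f\<in>\<Phi>. sub_le C (f \<cdot> g) s \<Longrightarrow> sub_le C g v"
  shows "sub_le C (Id C Y) v"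
  using assms(4) \<Phi> le
proof (induction \<Phi> rule: finite_induct)
  case empty
  then show ?case using S(1) Y unfolding directed_subobjects_def by auto
next
  case (insert \<phi> \<Phi>)
  have SA: "s \<in> Ar C" if "s \<in> S" for s
    using S that unfolding directed_subobjects_def by (auto simp: subobjects_iff)
  have \<phi>: "\<phi> \<in> Ar C" "Dom C \<phi> = Y" "Cod C \<phi> = X" using insert.prems(1) by (auto simp: Hom_iff)
  have vA: "v \<in> Ar C" using v by (auto simp: subobjects_iff)
  show ?case
  proof (rule insert.IH)
    fix s g assume s: "s \<in> S" and g: "g \<in> Ar C" "Cod C g = Y" and sg: "\<forall>f\<in>\<Phi>. sub_le C (f \<cdot> g) s"
    have \<Phi>': "f \<in> Ar C" "Dom C f = Y" if "f \<in> \<Phi>" for f using insert.prems(1) that by (auto simp: Hom_iff)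
    obtain w where w: "w \<in> subobjects C (Dom C g)"
      "\<And>h. h \<in> Ar C \<Longrightarrow> Cod C h = Dom C g \<Longrightarrow> sub_le C h w \<longleftrightarrow> sub_le C (g \<cdot> h) v"
      using preimage[OF v g] by blast
    have "sub_le C (Id C (Dom C g)) w"
    proof (rule preimage_directed_union[OF X S, of "\<phi> \<cdot> g"])
      fix t h assume t: "t \<in> S" and h: "h \<in> Ar C" "Cod C h = Dom C g" "sub_le C ((\<phi> \<cdot> g) \<cdot> h) t"
      obtain r where r: "r \<in> S" "sub_le C s r" "sub_le C t r" using directedE[OF S(1) s t] by blast
      have "sub_le C (\<phi> \<cdot> g \<cdot> h) r"
        using sub_le_trans[OF h(3) r(3) SA[OF r(1)]] Comp_assoc[of h g \<phi>] h g \<phi> by simp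
      moreover have "sub_le C (f \<cdot> g \<cdot> h) r" if "f \<in> \<Phi>" for f
      proof -
        have "sub_le C (f \<cdot> g) r" using sub_le_trans[OF bspec[OF sg that] r(2) SA[OF r(1)]] .
        then have "sub_le C ((f \<cdot> g) \<cdot> h) r"
          using sub_le_comp_right[of "f \<cdot> g" r h] SA[OF r(1)] h g \<Phi>'[OF that] by simp
        then show ?thesis using Comp_assoc[of h g f] h g \<Phi>'[OF that] by simp
      qed
      ultimately have "sub_le C (g \<cdot> h) v" using insert.prems(2)[OF r(1), of "g \<cdot> h"] g h by simp
      then show "sub_le C h w" using w h by blast
    qed (use g \<phi> w in auto)
    then show "sub_le C g v" using w(2)[of "Id C (Dom C g)"] g by simp
  qed (use insert.prems in blast)
qed

end

section \<open>Functor categories\<close>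

lemma is_functorD:
  assumes "is_functor B C F"
  shows "X \<in> Ob B \<Longrightarrow> FOb F X \<in> Ob C"
    and "f \<in> Ar B \<Longrightarrow> FAr F f \<in> Ar C"
    and "f \<in> Ar B \<Longrightarrow> Dom C (FAr F f) = FOb F (Dom B f)"
    and "f \<in> Ar B \<Longrightarrow> Cod C (FAr F f) = FOb F (Cod B f)"
    and "X \<in> Ob B \<Longrightarrow> FAr F (Id B X) = Id C (FOb F X)"
    and "f \<in> Ar B \<Longrightarrow> g \<in> Ar B \<Longrightarrow> Cod B f = Dom B g \<Longrightarrow> FAr F (Comp B g f) = Comp C (FAr F g) (FAr F f)"
  using assms unfolding is_functor_def Hom_def by auto

lemma is_nattransD:
  assumes "is_nattrans B C (F, G, \<eta>)"
  shows "is_functor B C F" "is_functor B C G" "\<eta> \<in> extensional (Ob B)"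
    and "X \<in> Ob B \<Longrightarrow> \<eta> X \<in> Ar C"
    and "X \<in> Ob B \<Longrightarrow> Dom C (\<eta> X) = FOb F X"
    and "X \<in> Ob B \<Longrightarrow> Cod C (\<eta> X) = FOb G X"
    and "f \<in> Ar B \<Longrightarrow> Comp C (\<eta> (Cod B f)) (FAr F f) = Comp C (FAr G f) (\<eta> (Dom B f))"
  using assms unfolding is_nattrans_def Hom_def by auto

lemma is_nattransI:
  assumes "is_functor B C F" "is_functor B C G" "\<eta> \<in> extensional (Ob B)"
    and "\<And>X. X \<in> Ob B \<Longrightarrow> \<eta> X \<in> Ar C \<and> Dom C (\<eta> X) = FOb F X \<and> Cod C (\<eta> X) = FOb G X"
    and "\<And>f. f \<in> Ar B \<Longrightarrow> Comp C (\<eta> (Cod B f)) (FAr F f) = Comp C (FAr G f) (\<eta> (Dom B f))"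
  shows "is_nattrans B C (F, G, \<eta>)"
  using assms unfolding is_nattrans_def Hom_def by auto

lemma Ob_Fct [simp]: "F \<in> Ob (Fct B C) \<longleftrightarrow> is_functor B C F"
  and Ar_Fct [simp]: "x \<in> Ar (Fct B C) \<longleftrightarrow> is_nattrans B C x"
  and Dom_Fct [simp]: "Dom (Fct B C) (F, G, \<eta>) = F"
  and Cod_Fct [simp]: "Cod (Fct B C) (F, G, \<eta>) = G"
  and Id_Fct: "Id (Fct B C) F = (F, F, \<lambda>X\<in>Ob B. Id C (FOb F X))"
  and Comp_Fct: "Comp (Fct B C) (G', H, \<theta>) (F, G, \<eta>) = (F, H, \<lambda>X\<in>Ob B. Comp C (\<theta> X) (\<eta> X))"
  by (simp_all add: Fct_def)

lemma Hom_Fct: "x \<in> Hom (Fct B C) F G \<longleftrightarrow> (\<exists>\<eta>. x = (F, G, \<eta>) \<and> is_nattrans B C (F, G, \<eta>))"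
  by (cases x) (auto simp: Hom_def)

lemma component_simp [simp]: "component (F, G, \<eta>) = \<eta>"
  by (simp add: component_def)

lemma nattrans_eqI:
  assumes "is_nattrans B C (F, G, \<eta>)" "is_nattrans B C (F, G, \<theta>)" "\<And>X. X \<in> Ob B \<Longrightarrow> \<eta> X = \<theta> X"
  shows "\<eta> = \<theta>"
  using assms is_nattransD(3) extensionalityI by metis

section \<open>Monomorphisms, inclusions and cokernels of functors, computed pointwise\<close>

locale abelian_functors = abelian C add zer
  for C :: "('o, 'm) category" and add zer +
  fixes B :: "('p, 'a) category"
  assumes B: "is_category B"
begin

lemmas B_simps [simp] = cat.Dom_Ob[OF cat.intro, OF B] cat.Cod_Ob[OF cat.intro, OF B]
  cat.Id_Ar[OF cat.intro, OF B] cat.Dom_Id[OF cat.intro, OF B] cat.Cod_Id[OF cat.intro, OF B]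
  cat.Comp_Ar[OF cat.intro, OF B] cat.Dom_Comp[OF cat.intro, OF B] cat.Cod_Comp[OF cat.intro, OF B]

lemma functor_simps [simp]:
  assumes "is_functor B C F"
  shows "X \<in> Ob B \<Longrightarrow> FOb F X \<in> Ob C"
    and "f \<in> Ar B \<Longrightarrow> FAr F f \<in> Ar C"
    and "f \<in> Ar B \<Longrightarrow> Dom C (FAr F f) = FOb F (Dom B f)"
    and "f \<in> Ar B \<Longrightarrow> Cod C (FAr F f) = FOb F (Cod B f)"
  using is_functorD[OF assms] by blast+

lemma nattrans_Comp:
  assumes \<eta>: "is_nattrans B C (F, G, \<eta>)" and \<theta>: "is_nattrans B C (G, H, \<theta>)"
  shows "is_nattrans B C (F, H, \<lambda>X\<in>Ob B. \<theta> X \<cdot> \<eta> X)"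
proof (rule is_nattransI)
  fix f assume f: "f \<in> Ar B"
  note S = is_nattransD[OF \<eta>] is_nattransD[OF \<theta>]
  have "(\<theta> (Cod B f) \<cdot> \<eta> (Cod B f)) \<cdot> FAr F f = \<theta> (Cod B f) \<cdot> \<eta> (Cod B f) \<cdot> FAr F f"
    using f S by (intro Comp_assoc) auto
  also have "\<dots> = \<theta> (Cod B f) \<cdot> FAr G f \<cdot> \<eta> (Dom B f)" using S(7)[OF f] by simp
  also have "\<dots> = (\<theta> (Cod B f) \<cdot> FAr G f) \<cdot> \<eta> (Dom B f)"
    using f S by (intro Comp_assoc[symmetric]) auto
  also have "\<dots> = (FAr H f \<cdot> \<theta> (Dom B f)) \<cdot> \<eta> (Dom B f)" using S(14)[OF f] by simp
  also have "\<dots> = FAr H f \<cdot> \<theta> (Dom B f) \<cdot> \<eta> (Dom B f)"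
    using f S by (intro Comp_assoc) auto
  finally show "(\<lambda>X\<in>Ob B. \<theta> X \<cdot> \<eta> X) (Cod B f) \<cdot> FAr F f = FAr H f \<cdot> (\<lambda>X\<in>Ob B. \<theta> X \<cdot> \<eta> X) (Dom B f)"
    using f by simp
qed (use is_nattransD[OF \<eta>] is_nattransD[OF \<theta>] in auto)

lemma nattrans_Id:
  assumes F: "is_functor B C F"
  shows "is_nattrans B C (F, F, \<lambda>X\<in>Ob B. Id C (FOb F X))"
  by (rule is_nattransI) (use F in auto)

text \<open>Makes the results on arbitrary categories available for functors.\<close>

lemma Fct_cat: "cat (Fct B C)"
  unfolding cat_def is_category_def
proof (intro conjI allI ballI impI)
  show "Dom (Fct B C) x \<in> Ob (Fct B C)" "Cod (Fct B C) x \<in> Ob (Fct B C)" if "x \<in> Ar (Fct B C)" for x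
  proof -
    obtain F G \<eta> where x: "x = (F, G, \<eta>)" by (cases x)
    show "Dom (Fct B C) x \<in> Ob (Fct B C)" "Cod (Fct B C) x \<in> Ob (Fct B C)"
      using that is_nattransD(1,2)[of B C F G \<eta>] by (simp_all add: x)
  qed
  show "Id (Fct B C) F \<in> Hom (Fct B C) F F" if "F \<in> Ob (Fct B C)" for F
    using that nattrans_Id by (simp add: Hom_Fct Id_Fct)
  show "Comp (Fct B C) g f \<in> Hom (Fct B C) X Z"
    if "f \<in> Hom (Fct B C) X Y \<and> g \<in> Hom (Fct B C) Y Z" for X Y Z f g
    using that nattrans_Comp by (force simp: Hom_Fct Comp_Fct)
  fix X Y f assume f: "f \<in> Hom (Fct B C) X Y"
  then obtain \<eta> where \<eta>: "f = (X, Y, \<eta>)" "is_nattrans B C (X, Y, \<eta>)" by (auto simp: Hom_Fct)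
  note S = is_nattransD[OF \<eta>(2)]
  show "Comp (Fct B C) f (Id (Fct B C) X) = f" "Comp (Fct B C) (Id (Fct B C) Y) f = f"
    using S by (auto simp: \<eta>(1) Id_Fct Comp_Fct intro!: extensionalityI[of _ "Ob B"])
next
  fix W X Y Z f g h
  assume "f \<in> Hom (Fct B C) W X \<and> g \<in> Hom (Fct B C) X Y \<and> h \<in> Hom (Fct B C) Y Z"
  then obtain \<eta> \<theta> \<zeta> where *: "f = (W, X, \<eta>)" "is_nattrans B C (W, X, \<eta>)"
     "g = (X, Y, \<theta>)" "is_nattrans B C (X, Y, \<theta>)" "h = (Y, Z, \<zeta>)" "is_nattrans B C (Y, Z, \<zeta>)"
    by (auto simp: Hom_Fct)
  note S = is_nattransD[OF *(2)] is_nattransD[OF *(4)] is_nattransD[OF *(6)]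
  have "\<zeta> P \<cdot> \<theta> P \<cdot> \<eta> P = (\<zeta> P \<cdot> \<theta> P) \<cdot> \<eta> P" if "P \<in> Ob B" for P
    using S that by (intro Comp_assoc[symmetric]) auto
  then show "Comp (Fct B C) h (Comp (Fct B C) g f) = Comp (Fct B C) (Comp (Fct B C) h g) f"
    by (simp add: *(1,3,5) Comp_Fct cong: restrict_cong)
qed

lemma nattrans_zer:
  assumes "is_functor B C F" "is_functor B C G"
  shows "is_nattrans B C (F, G, \<lambda>X\<in>Ob B. zer (FOb F X) (FOb G X))"
  by (rule is_nattransI) (use assms in auto)

text \<open>A zero functor has a single endomorphism, so its identity coincides with the
  transformation with zero components.\<close>

lemma zero_object_Fct_iff:
  "is_zero_object (Fct B C) F \<longleftrightarrow> is_functor B C F \<and> (\<forall>X\<in>Ob B. Id C (FOb F X) = zer (FOb F X) (FOb F X))"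
proof
  assume Z: "is_zero_object (Fct B C) F"
  then have F: "is_functor B C F" and "\<exists>!f. f \<in> Hom (Fct B C) F F"
    unfolding is_zero_object_def Ob_Fct by auto
  then have e: "(\<lambda>X\<in>Ob B. Id C (FOb F X)) = (\<lambda>X\<in>Ob B. zer (FOb F X) (FOb F X))"
    using nattrans_zer[OF F F] nattrans_Id[OF F] by (auto simp: Hom_Fct)
  have "Id C (FOb F X) = zer (FOb F X) (FOb F X)" if "X \<in> Ob B" for X
    using fun_cong[OF e, of X] that by simp
  then show "is_functor B C F \<and> (\<forall>X\<in>Ob B. Id C (FOb F X) = zer (FOb F X) (FOb F X))" using F by blast
next
  assume Z: "is_functor B C F \<and> (\<forall>X\<in>Ob B. Id C (FOb F X) = zer (FOb F X) (FOb F X))"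
  then have ZO: "is_zero_object C (FOb F X)" if "X \<in> Ob B" for X
    using that by (simp add: zero_object_iff)
  show "is_zero_object (Fct B C) F"
    unfolding is_zero_object_def
  proof (intro conjI ballI)
    fix G assume "G \<in> Ob (Fct B C)"
    then have G: "is_functor B C G" by simp
    have eq: "f = g" if "X \<in> Ob B" "f \<in> Hom C (FOb F X) (FOb G X)" "g \<in> Hom C (FOb F X) (FOb G X)" for X f g
    proof -
      have "\<exists>!f. f \<in> Hom C (FOb F X) (FOb G X)"
        using ZO[OF that(1)] functor_simps(1)[OF G that(1)] unfolding is_zero_object_def by simp
      then show ?thesis using that by blast
    qed
    have eq': "f = g" if "X \<in> Ob B" "f \<in> Hom C (FOb G X) (FOb F X)" "g \<in> Hom C (FOb G X) (FOb F X)" for X f g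
    proof -
      have "\<exists>!f. f \<in> Hom C (FOb G X) (FOb F X)"
        using ZO[OF that(1)] functor_simps(1)[OF G that(1)] unfolding is_zero_object_def by simp
      then show ?thesis using that by blast
    qed
    show "\<exists>!f. f \<in> Hom (Fct B C) F G"
    proof (rule ex_ex1I)
      show "\<exists>f. f \<in> Hom (Fct B C) F G" using nattrans_zer[of F G] Z G by (auto simp: Hom_Fct)
      fix f g assume "f \<in> Hom (Fct B C) F G" "g \<in> Hom (Fct B C) F G"
      then obtain \<eta> \<theta> where *: "f = (F, G, \<eta>)" "is_nattrans B C (F, G, \<eta>)" "g = (F, G, \<theta>)" "is_nattrans B C (F, G, \<theta>)"
        by (auto simp: Hom_Fct)
      have "\<eta> = \<theta>"
        by (rule nattrans_eqI[OF *(2,4)], rule eq) (use is_nattransD[OF *(2)] is_nattransD[OF *(4)] in \<open>auto simp: Hom_iff\<close>)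
      then show "f = g" using * by simp
    qed
    show "\<exists>!f. f \<in> Hom (Fct B C) G F"
    proof (rule ex_ex1I)
      show "\<exists>f. f \<in> Hom (Fct B C) G F" using nattrans_zer[of G F] Z G by (auto simp: Hom_Fct)
      fix f g assume "f \<in> Hom (Fct B C) G F" "g \<in> Hom (Fct B C) G F"
      then obtain \<eta> \<theta> where *: "f = (G, F, \<eta>)" "is_nattrans B C (G, F, \<eta>)" "g = (G, F, \<theta>)" "is_nattrans B C (G, F, \<theta>)"
        by (auto simp: Hom_Fct)
      have "\<eta> = \<theta>"
        by (rule nattrans_eqI[OF *(2,4)], rule eq') (use is_nattransD[OF *(2)] is_nattransD[OF *(4)] in \<open>auto simp: Hom_iff\<close>)
      then show "f = g" using * by simp
    qed
  qed (use Z in simp)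
qed

lemma ex_zero_functor: "\<exists>F. is_zero_object (Fct B C) F"
proof -
  obtain Z where Z: "is_zero_object C Z" using zob by blast
  then have ZO: "Z \<in> Ob C" "Id C Z = zer Z Z" by (auto simp: zero_object_iff)
  have "is_functor B C \<lparr>FOb = \<lambda>X\<in>Ob B. Z, FAr = \<lambda>f\<in>Ar B. Id C Z\<rparr>"
    using ZO(1) cat.Comp_Hom[OF cat.intro[OF B]] unfolding is_functor_def by (auto simp: Hom_def)
  then show ?thesis using ZO by (intro exI) (auto simp: zero_object_Fct_iff)
qed

lemma zero_arrow_Fct_iff:
  assumes \<eta>: "is_nattrans B C (F, G, \<eta>)"
  shows "is_zero_arrow (Fct B C) (F, G, \<eta>) \<longleftrightarrow> (\<forall>X\<in>Ob B. \<eta> X = zer (FOb F X) (FOb G X))"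
proof
  note S = is_nattransD[OF \<eta>]
  assume "is_zero_arrow (Fct B C) (F, G, \<eta>)"
  then obtain Z g h where Z: "is_zero_object (Fct B C) Z" "g \<in> Hom (Fct B C) F Z" "h \<in> Hom (Fct B C) Z G"
    "(F, G, \<eta>) = Comp (Fct B C) h g"
    unfolding is_zero_arrow_def by auto
  then obtain \<theta> \<zeta> where *: "g = (F, Z, \<theta>)" "is_nattrans B C (F, Z, \<theta>)" "h = (Z, G, \<zeta>)" "is_nattrans B C (Z, G, \<zeta>)"
    by (auto simp: Hom_Fct)
  have \<eta>eq: "\<eta> = (\<lambda>X\<in>Ob B. \<zeta> X \<cdot> \<theta> X)" using Z(4) unfolding * by (simp add: Comp_Fct)
  show "\<forall>X\<in>Ob B. \<eta> X = zer (FOb F X) (FOb G X)"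
  proof
    fix X assume X: "X \<in> Ob B"
    note T = is_nattransD[OF *(2)] is_nattransD[OF *(4)]
    have i: "Id C (FOb Z X) = zer (FOb Z X) (FOb Z X)" using Z(1) X by (simp add: zero_object_Fct_iff)
    have "\<theta> X = Id C (FOb Z X) \<cdot> \<theta> X" using T X by simp
    also have "\<dots> = zer (FOb F X) (FOb Z X)" unfolding i using T X by simp
    finally show "\<eta> X = zer (FOb F X) (FOb G X)" using T S X by (simp add: \<eta>eq)
  qed
next
  note S = is_nattransD[OF \<eta>]
  assume z: "\<forall>X\<in>Ob B. \<eta> X = zer (FOb F X) (FOb G X)"
  obtain Z where Z: "is_zero_object (Fct B C) Z" using ex_zero_functor by blast
  then have ZF: "is_functor B C Z" by (simp add: zero_object_Fct_iff)
  let ?g = "(F, Z, \<lambda>X\<in>Ob B. zer (FOb F X) (FOb Z X))" and ?h = "(Z, G, \<lambda>X\<in>Ob B. zer (FOb Z X) (FOb G X))"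
  have "?g \<in> Hom (Fct B C) F Z" "?h \<in> Hom (Fct B C) Z G"
    using nattrans_zer S ZF by (auto simp: Hom_Fct)
  moreover have "(F, G, \<eta>) = Comp (Fct B C) ?h ?g"
    using z S ZF by (auto simp: Comp_Fct intro!: extensionalityI[of _ "Ob B"])
  ultimately show "is_zero_arrow (Fct B C) (F, G, \<eta>)"
    unfolding is_zero_arrow_def Dom_Fct Cod_Fct using Z \<eta> Ar_Fct by blast
qed

text \<open>The arrow that \<open>FAr F f\<close> induces between the sources of the
  \<open>s X\<close> is unique, since the target inclusion is monic. Hence the choices made in
  \<open>a\<close> respect identities and composition.\<close>

lemma subfunctor:
  assumes F: "is_functor B C F" and s: "\<And>X. X \<in> Ob B \<Longrightarrow> s X \<in> subobjects C (FOb F X)"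
    and le: "\<And>f. f \<in> Ar B \<Longrightarrow> sub_le C (FAr F f \<cdot> s (Dom B f)) (s (Cod B f))"
  obtains H where "is_nattrans B C (H, F, \<lambda>X\<in>Ob B. s X)"
proof -
  have sA: "s X \<in> Ar C" "Cod C (s X) = FOb F X" "is_mono C (s X)" if "X \<in> Ob B" for X
    using s[OF that] by (auto simp: subobjects_iff)
  define a where "a f = (SOME h. h \<in> Ar C \<and> Dom C h = Dom C (s (Dom B f)) \<and> Cod C h = Dom C (s (Cod B f)) \<and>
     s (Cod B f) \<cdot> h = FAr F f \<cdot> s (Dom B f))" for f
  have a: "a f \<in> Ar C \<and> Dom C (a f) = Dom C (s (Dom B f)) \<and> Cod C (a f) = Dom C (s (Cod B f)) \<and>
     s (Cod B f) \<cdot> a f = FAr F f \<cdot> s (Dom B f)" if "f \<in> Ar B" for f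
    unfolding a_def by (rule someI_ex) (use le[OF that] that F sA in \<open>auto simp: sub_le_iff\<close>)
  define H where "H = \<lparr>FOb = \<lambda>X\<in>Ob B. Dom C (s X), FAr = \<lambda>f\<in>Ar B. a f\<rparr>"
  have H: "is_functor B C H"
    unfolding is_functor_def
  proof (intro conjI ballI allI impI)
    fix X assume X: "X \<in> Ob B"
    have "a (Id B X) = Id C (Dom C (s X))"
      by (rule monoD[OF sA(3)[OF X]]) (use a[of "Id B X"] X sA F is_functorD(5)[OF F] in auto)
    then show "FAr H (Id B X) = Id C (FOb H X)" using X by (simp add: H_def)
  next
    fix X Y Z f g assume "f \<in> Hom B X Y \<and> g \<in> Hom B Y Z"
    then have fg: "f \<in> Ar B" "g \<in> Ar B" "Dom B f = X" "Cod B f = Y" "Dom B g = Y" "Cod B g = Z"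
      by (auto simp: Hom_def)
    then have O: "X \<in> Ob B" "Y \<in> Ob B" "Z \<in> Ob B" using B_simps by metis+
    note A = a[OF fg(1), unfolded fg] a[OF fg(2), unfolded fg]
    have gf: "Comp B g f \<in> Ar B" "Dom B (Comp B g f) = X" "Cod B (Comp B g f) = Z" using fg by auto
    note A3 = a[OF gf(1), unfolded gf]
    have "a (Comp B g f) = a g \<cdot> a f"
    proof (rule monoD[OF sA(3)[OF O(3)]])
      have "s Z \<cdot> a g \<cdot> a f = (s Z \<cdot> a g) \<cdot> a f"
        using A sA O by (intro Comp_assoc[symmetric]) auto
      also have "\<dots> = (FAr F g \<cdot> s Y) \<cdot> a f" using A by simp
      also have "\<dots> = FAr F g \<cdot> s Y \<cdot> a f" using A sA O F fg by (intro Comp_assoc) auto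
      also have "\<dots> = FAr F g \<cdot> FAr F f \<cdot> s X" using A by simp
      also have "\<dots> = (FAr F g \<cdot> FAr F f) \<cdot> s X" using sA O F fg by (intro Comp_assoc[symmetric]) auto
      also have "\<dots> = FAr F (Comp B g f) \<cdot> s X" using is_functorD(6)[OF F] fg by simp
      finally show "s Z \<cdot> a (Comp B g f) = s Z \<cdot> a g \<cdot> a f" using A3 by simp
    qed (use A A3 in auto)
    then show "FAr H (Comp B g f) = FAr H g \<cdot> FAr H f" using fg gf by (simp add: H_def)
  qed (use a sA F in \<open>auto simp: H_def\<close>)
  have "is_nattrans B C (H, F, \<lambda>X\<in>Ob B. s X)"
    by (rule is_nattransI) (use H F sA a in \<open>auto simp: H_def\<close>)
  then show thesis by (rule that)
qed

text \<open>Dual to \<open>subfunctor\<close>: the induced arrows are unique because the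
  \<open>q X\<close> are epic.\<close>

lemma quotient_functor:
  assumes F: "is_functor B C F" and q: "\<And>X. X \<in> Ob B \<Longrightarrow> is_epi C (q X) \<and> Dom C (q X) = FOb F X"
    and le: "\<And>f. f \<in> Ar B \<Longrightarrow> \<exists>h\<in>Hom C (Cod C (q (Dom B f))) (Cod C (q (Cod B f))).
       h \<cdot> q (Dom B f) = q (Cod B f) \<cdot> FAr F f"
  obtains D where "is_nattrans B C (F, D, \<lambda>X\<in>Ob B. q X)"
proof -
  have qA: "q X \<in> Ar C" "Dom C (q X) = FOb F X" "is_epi C (q X)" if "X \<in> Ob B" for X
    using q[OF that] by auto
  define a where "a f = (SOME h. h \<in> Hom C (Cod C (q (Dom B f))) (Cod C (q (Cod B f))) \<and>
     h \<cdot> q (Dom B f) = q (Cod B f) \<cdot> FAr F f)" for f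
  have a: "a f \<in> Ar C \<and> Dom C (a f) = Cod C (q (Dom B f)) \<and> Cod C (a f) = Cod C (q (Cod B f)) \<and>
     a f \<cdot> q (Dom B f) = q (Cod B f) \<cdot> FAr F f" if "f \<in> Ar B" for f
  proof -
    have "a f \<in> Hom C (Cod C (q (Dom B f))) (Cod C (q (Cod B f))) \<and>
     a f \<cdot> q (Dom B f) = q (Cod B f) \<cdot> FAr F f"
      unfolding a_def by (rule someI_ex) (use le[OF that] in blast)
    then show ?thesis by (auto simp: Hom_iff)
  qed
  define D where "D = \<lparr>FOb = \<lambda>X\<in>Ob B. Cod C (q X), FAr = \<lambda>f\<in>Ar B. a f\<rparr>"
  have D: "is_functor B C D"
    unfolding is_functor_def
  proof (intro conjI ballI allI impI)
    fix X assume X: "X \<in> Ob B"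
    have "a (Id B X) = Id C (Cod C (q X))"
      by (rule epiD[OF qA(3)[OF X]]) (use a[of "Id B X"] X qA F is_functorD(5)[OF F] in auto)
    then show "FAr D (Id B X) = Id C (FOb D X)" using X by (simp add: D_def)
  next
    fix X Y Z f g assume "f \<in> Hom B X Y \<and> g \<in> Hom B Y Z"
    then have fg: "f \<in> Ar B" "g \<in> Ar B" "Dom B f = X" "Cod B f = Y" "Dom B g = Y" "Cod B g = Z"
      by (auto simp: Hom_def)
    then have O: "X \<in> Ob B" "Y \<in> Ob B" "Z \<in> Ob B" using B_simps by metis+
    note A = a[OF fg(1), unfolded fg] a[OF fg(2), unfolded fg]
    have gf: "Comp B g f \<in> Ar B" "Dom B (Comp B g f) = X" "Cod B (Comp B g f) = Z" using fg by auto
    note A3 = a[OF gf(1), unfolded gf]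
    have "a (Comp B g f) = a g \<cdot> a f"
    proof (rule epiD[OF qA(3)[OF O(1)]])
      have "(a g \<cdot> a f) \<cdot> q X = a g \<cdot> a f \<cdot> q X"
        using A qA O by (intro Comp_assoc) auto
      also have "\<dots> = a g \<cdot> q Y \<cdot> FAr F f" using A by simp
      also have "\<dots> = (a g \<cdot> q Y) \<cdot> FAr F f" using A qA O F fg by (intro Comp_assoc[symmetric]) auto
      also have "\<dots> = (q Z \<cdot> FAr F g) \<cdot> FAr F f" using A by simp
      also have "\<dots> = q Z \<cdot> FAr F g \<cdot> FAr F f" using qA O F fg by (intro Comp_assoc) auto
      also have "\<dots> = q Z \<cdot> FAr F (Comp B g f)" using is_functorD(6)[OF F] fg by simp
      finally show "a (Comp B g f) \<cdot> q X = (a g \<cdot> a f) \<cdot> q X" using A3 by simp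
    qed (use A A3 in auto)
    then show "FAr D (Comp B g f) = FAr D g \<cdot> FAr D f" using fg gf by (simp add: D_def)
  qed (use a qA F in \<open>auto simp: D_def\<close>)
  have "is_nattrans B C (F, D, \<lambda>X\<in>Ob B. q X)"
    by (rule is_nattransI) (use D F qA a in \<open>auto simp: D_def\<close>)
  then show thesis by (rule that)
qed

text \<open>For the direct implication, the pointwise kernels of \<open>\<eta>\<close> form a
  subfunctor \<open>K\<close>. Its inclusion and the zero transformation have the same composite
  with \<open>\<eta>\<close>, so they agree and every kernel is zero.\<close>

lemma mono_Fct_iff:
  assumes \<eta>: "is_nattrans B C (F, G, \<eta>)"
  shows "is_mono (Fct B C) (F, G, \<eta>) \<longleftrightarrow> (\<forall>X\<in>Ob B. is_mono C (\<eta> X))"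
proof
  note S = is_nattransD[OF \<eta>]
  assume m: "is_mono (Fct B C) (F, G, \<eta>)"
  define k where "k X = (SOME k. k \<in> subobjects C (FOb F X) \<and>
     (\<forall>g. g \<in> Ar C \<longrightarrow> Cod C g = FOb F X \<longrightarrow> (sub_le C g k \<longleftrightarrow> kills (\<eta> X) g)))" for X
  have k: "k X \<in> subobjects C (FOb F X) \<and>
     (\<forall>g. g \<in> Ar C \<longrightarrow> Cod C g = FOb F X \<longrightarrow> (sub_le C g (k X) \<longleftrightarrow> kills (\<eta> X) g))" if "X \<in> Ob B" for X
    unfolding k_def by (rule someI_ex) (use ex_ker[OF S(4)[OF that]] S(5)[OF that] in metis)
  have kA: "k X \<in> Ar C" "Cod C (k X) = FOb F X" if "X \<in> Ob B" for X
    using k[OF that] by (auto simp: subobjects_iff)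
  have kk: "kills (\<eta> X) (k X)" if "X \<in> Ob B" for X using k[OF that] kA[OF that] by auto
  obtain K where K: "is_nattrans B C (K, F, \<lambda>X\<in>Ob B. k X)"
  proof (rule subfunctor[OF S(1)])
    fix f assume f: "f \<in> Ar B"
    have "\<eta> (Cod B f) \<cdot> FAr F f \<cdot> k (Dom B f) = (\<eta> (Cod B f) \<cdot> FAr F f) \<cdot> k (Dom B f)"
      using f S kA by (intro Comp_assoc[symmetric]) auto
    also have "\<dots> = (FAr G f \<cdot> \<eta> (Dom B f)) \<cdot> k (Dom B f)" using S(7)[OF f] by simp
    also have "\<dots> = FAr G f \<cdot> \<eta> (Dom B f) \<cdot> k (Dom B f)"
      using f S kA by (intro Comp_assoc) auto
    also have "\<eta> (Dom B f) \<cdot> k (Dom B f) = zer (Dom C (k (Dom B f))) (FOb G (Dom B f))"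
      using kk[of "Dom B f"] f S by (simp add: kills_def)
    finally have "kills (\<eta> (Cod B f)) (FAr F f \<cdot> k (Dom B f))"
      using f S kA by (simp add: kills_def)
    then show "sub_le C (FAr F f \<cdot> k (Dom B f)) (k (Cod B f))"
      using k[of "Cod B f"] f S kA by simp
  qed (use k in auto)
  note T = is_nattransD[OF K]
  have DK: "Dom C (k X) = FOb K X" if "X \<in> Ob B" for X using T(5)[OF that] that by simp
  let ?z = "(K, F, \<lambda>X\<in>Ob B. zer (FOb K X) (FOb F X))"
  have z: "?z \<in> Hom (Fct B C) K F" using nattrans_zer[OF T(1) S(1)] by (auto simp: Hom_Fct)
  have "\<eta> X \<cdot> k X = \<eta> X \<cdot> zer (FOb K X) (FOb F X)" if "X \<in> Ob B" for X
    using kk[OF that] DK[OF that] S T(1) that by (simp add: kills_def)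
  then have "Comp (Fct B C) (F, G, \<eta>) (K, F, \<lambda>X\<in>Ob B. k X) = Comp (Fct B C) (F, G, \<eta>) ?z"
    by (simp add: Comp_Fct cong: restrict_cong)
  moreover have "(K, F, \<lambda>X\<in>Ob B. k X) \<in> Hom (Fct B C) K F" using K by (auto simp: Hom_Fct)
  moreover have "\<And>W g h. g\<in>Hom (Fct B C) W F \<Longrightarrow> h\<in>Hom (Fct B C) W F \<Longrightarrow>
      Comp (Fct B C) (F, G, \<eta>) g = Comp (Fct B C) (F, G, \<eta>) h \<Longrightarrow> g = h"
    using m unfolding is_mono_def Dom_Fct by blast
  ultimately have "(K, F, \<lambda>X\<in>Ob B. k X) = ?z" using z by blast
  then have e: "(\<lambda>X\<in>Ob B. k X) = (\<lambda>X\<in>Ob B. zer (FOb K X) (FOb F X))" by simp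
  have kz: "k X = zer (FOb K X) (FOb F X)" if "X \<in> Ob B" for X using fun_cong[OF e, of X] that by simp
  show "\<forall>X\<in>Ob B. is_mono C (\<eta> X)"
  proof
    fix X assume X: "X \<in> Ob B"
    show "is_mono C (\<eta> X)"
      by (rule mono_if_ker_zero[of _ "k X"]) (use k[OF X] kz[OF X] DK[OF X] S X in auto)
  qed
next
  note S = is_nattransD[OF \<eta>]
  assume m: "\<forall>X\<in>Ob B. is_mono C (\<eta> X)"
  show "is_mono (Fct B C) (F, G, \<eta>)"
    unfolding is_mono_def Dom_Fct
  proof (intro conjI allI ballI impI)
    fix W g h assume gh: "g \<in> Hom (Fct B C) W F" "h \<in> Hom (Fct B C) W F"
      "Comp (Fct B C) (F, G, \<eta>) g = Comp (Fct B C) (F, G, \<eta>) h"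
    then obtain \<theta> \<zeta> where *: "g = (W, F, \<theta>)" "is_nattrans B C (W, F, \<theta>)" "h = (W, F, \<zeta>)" "is_nattrans B C (W, F, \<zeta>)"
      by (auto simp: Hom_Fct)
    have e: "(\<lambda>X\<in>Ob B. \<eta> X \<cdot> \<theta> X) = (\<lambda>X\<in>Ob B. \<eta> X \<cdot> \<zeta> X)"
      using gh(3) unfolding * by (simp add: Comp_Fct)
    have "\<theta> = \<zeta>"
    proof (rule nattrans_eqI[OF *(2,4)])
      fix X assume X: "X \<in> Ob B"
      have "\<eta> X \<cdot> \<theta> X = \<eta> X \<cdot> \<zeta> X" using fun_cong[OF e, of X] X by simp
      then show "\<theta> X = \<zeta> X"
        using m X monoD[of "\<eta> X" "\<theta> X" "\<zeta> X"] S is_nattransD[OF *(2)] is_nattransD[OF *(4)] by auto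
    qed
    then show "g = h" using * by simp
  qed (use \<eta> in simp)
qed

lemma subobjects_Fct_iff:
  "x \<in> subobjects (Fct B C) F \<longleftrightarrow>
    (\<exists>H \<eta>. x = (H, F, \<eta>) \<and> is_nattrans B C (H, F, \<eta>) \<and> (\<forall>X\<in>Ob B. \<eta> X \<in> subobjects C (FOb F X)))"
proof -
  obtain H F' \<eta> where x: "x = (H, F', \<eta>)" by (cases x) auto
  have "is_mono (Fct B C) x \<longleftrightarrow> is_nattrans B C x \<and> (\<forall>X\<in>Ob B. is_mono C (\<eta> X))"
    using mono_Fct_iff[of H F' \<eta>] unfolding x is_mono_def[of "Fct B C"] Ar_Fct by blast
  then show ?thesis unfolding x subobjects_def by (auto dest: is_nattransD(6))
qed

lemma subobjects_component:
  assumes "x \<in> subobjects (Fct B C) F" "X \<in> Ob B"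
  shows "component x X \<in> subobjects C (FOb F X)"
  using assms by (auto simp: subobjects_Fct_iff)

text \<open>Pointwise factorisations are automatically natural, because the components of
  \<open>\<theta>\<close> are monic.\<close>

lemma sub_le_Fct_iff:
  assumes \<eta>: "is_nattrans B C (H, F, \<eta>)" and \<theta>: "(K, F, \<theta>) \<in> subobjects (Fct B C) F"
  shows "sub_le (Fct B C) (H, F, \<eta>) (K, F, \<theta>) \<longleftrightarrow> (\<forall>X\<in>Ob B. sub_le C (\<eta> X) (\<theta> X))"
proof
  assume "sub_le (Fct B C) (H, F, \<eta>) (K, F, \<theta>)"
  then obtain \<zeta> where \<zeta>: "is_nattrans B C (H, K, \<zeta>)" "Comp (Fct B C) (K, F, \<theta>) (H, K, \<zeta>) = (H, F, \<eta>)"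
    unfolding sub_le_def by (auto simp: Hom_Fct)
  then have e: "\<eta> = (\<lambda>X\<in>Ob B. \<theta> X \<cdot> \<zeta> X)" by (simp add: Comp_Fct)
  have \<theta>': "is_nattrans B C (K, F, \<theta>)" using \<theta> by (auto simp: subobjects_Fct_iff)
  show "\<forall>X\<in>Ob B. sub_le C (\<eta> X) (\<theta> X)"
  proof
    fix X assume X: "X \<in> Ob B"
    show "sub_le C (\<eta> X) (\<theta> X)"
      using sub_le_Comp[of "\<zeta> X" "\<theta> X"] is_nattransD(4,6)[OF \<zeta>(1) X] is_nattransD(4,5)[OF \<theta>' X] X
      by (simp add: e)
  qed
next
  have \<theta>': "is_nattrans B C (K, F, \<theta>)" and m: "\<And>X. X \<in> Ob B \<Longrightarrow> is_mono C (\<theta> X)"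
    using \<theta> by (auto simp: subobjects_Fct_iff subobjects_iff)
  note S = is_nattransD[OF \<eta>] and T = is_nattransD[OF \<theta>']
  assume le: "\<forall>X\<in>Ob B. sub_le C (\<eta> X) (\<theta> X)"
  define a where "a X = (SOME h. h \<in> Ar C \<and> Dom C h = FOb H X \<and> Cod C h = FOb K X \<and> \<theta> X \<cdot> h = \<eta> X)" for X
  have a: "a X \<in> Ar C \<and> Dom C (a X) = FOb H X \<and> Cod C (a X) = FOb K X \<and> \<theta> X \<cdot> a X = \<eta> X" if "X \<in> Ob B" for X
    unfolding a_def by (rule someI_ex) (use le S T that in \<open>auto simp: sub_le_iff\<close>)
  have "is_nattrans B C (H, K, \<lambda>X\<in>Ob B. a X)"
  proof (rule is_nattransI)
    fix f assume f: "f \<in> Ar B"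
    then have O: "Dom B f \<in> Ob B" "Cod B f \<in> Ob B" by auto
    note A = a[OF O(1)] a[OF O(2)]
    have "a (Cod B f) \<cdot> FAr H f = FAr K f \<cdot> a (Dom B f)"
    proof (rule monoD[OF m[OF O(2)]])
      have "\<theta> (Cod B f) \<cdot> a (Cod B f) \<cdot> FAr H f = (\<theta> (Cod B f) \<cdot> a (Cod B f)) \<cdot> FAr H f"
        using f S T A O by (intro Comp_assoc[symmetric]) auto
      also have "\<dots> = \<eta> (Cod B f) \<cdot> FAr H f" using A by simp
      also have "\<dots> = FAr F f \<cdot> \<eta> (Dom B f)" by (rule S(7)[OF f])
      also have "\<dots> = FAr F f \<cdot> \<theta> (Dom B f) \<cdot> a (Dom B f)" using A by simp
      also have "\<dots> = (FAr F f \<cdot> \<theta> (Dom B f)) \<cdot> a (Dom B f)"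
        using f S T A O by (intro Comp_assoc[symmetric]) auto
      also have "\<dots> = (\<theta> (Cod B f) \<cdot> FAr K f) \<cdot> a (Dom B f)" using T(7)[OF f] by simp
      also have "\<dots> = \<theta> (Cod B f) \<cdot> FAr K f \<cdot> a (Dom B f)"
        using f S T A O by (intro Comp_assoc) auto
      finally show "\<theta> (Cod B f) \<cdot> a (Cod B f) \<cdot> FAr H f = \<theta> (Cod B f) \<cdot> FAr K f \<cdot> a (Dom B f)" .
    qed (use f S T A O in auto)
    then show "(\<lambda>X\<in>Ob B. a X) (Cod B f) \<cdot> FAr H f = FAr K f \<cdot> (\<lambda>X\<in>Ob B. a X) (Dom B f)" using O by simp
  qed (use S T a in auto)
  moreover have "\<eta> = (\<lambda>X\<in>Ob B. \<theta> X \<cdot> a X)"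
    by (rule extensionalityI[OF S(3)]) (use a in auto)
  ultimately show "sub_le (Fct B C) (H, F, \<eta>) (K, F, \<theta>)"
    unfolding sub_le_def Dom_Fct
    by (intro bexI[of _ "(H, K, \<lambda>X\<in>Ob B. a X)"]) (simp_all add: Hom_Fct Comp_Fct cong: restrict_cong)
qed

lemma sub_le_Fct_component_iff:
  assumes "x \<in> subobjects (Fct B C) F" "y \<in> subobjects (Fct B C) F"
  shows "sub_le (Fct B C) x y \<longleftrightarrow> (\<forall>X\<in>Ob B. sub_le C (component x X) (component y X))"
  using assms sub_le_Fct_iff by (auto simp: subobjects_Fct_iff)

lemma Id_sub_le_Fct_iff:
  assumes F: "is_functor B C F" and y: "y \<in> subobjects (Fct B C) F"
  shows "sub_le (Fct B C) (Id (Fct B C) F) y \<longleftrightarrow> (\<forall>X\<in>Ob B. sub_le C (Id C (FOb F X)) (component y X))"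
  using sub_le_Fct_component_iff[OF cat.Id_subobject[OF Fct_cat, of F] y] F
  by (simp add: Id_Fct)

text \<open>Pointwise cokernels form a functor because \<open>\<eta>\<close> is natural, and
  pointwise factorisations through them are natural because the \<open>q X\<close> are epic.\<close>

lemma ex_cokernel_Fct:
  assumes \<eta>: "is_nattrans B C (F, G, \<eta>)"
  obtains D q where "is_cokernel (Fct B C) (F, G, \<eta>) (G, D, q)" "is_nattrans B C (G, D, q)"
    "\<And>X. X \<in> Ob B \<Longrightarrow> is_cokernel C (\<eta> X) (q X)"
proof -
  note S = is_nattransD[OF \<eta>]
  define q where "q X = (SOME q. is_cokernel C (\<eta> X) q)" for X
  have q: "is_cokernel C (\<eta> X) (q X)" if "X \<in> Ob B" for X
    unfolding q_def by (rule someI_ex) (rule cokers[OF S(4)[OF that]])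
  have qA: "q X \<in> Ar C" "Dom C (q X) = FOb G X" "is_epi C (q X)" "kills (q X) (\<eta> X)"
    and uni: "\<And>g. g \<in> Ar C \<Longrightarrow> Dom C g = FOb G X \<Longrightarrow> kills g (\<eta> X) \<Longrightarrow> \<exists>h\<in>Hom C (Cod C (q X)) (Cod C g). h \<cdot> q X = g"
    if "X \<in> Ob B" for X
    using cokernel_iff[OF S(4)[OF that] q[OF that]] S(6)[OF that] by auto
  obtain D where D: "is_nattrans B C (G, D, \<lambda>X\<in>Ob B. q X)"
  proof (rule quotient_functor[OF S(2)])
    fix f assume f: "f \<in> Ar B"
    then have O: "Dom B f \<in> Ob B" "Cod B f \<in> Ob B" by auto
    have "(q (Cod B f) \<cdot> FAr G f) \<cdot> \<eta> (Dom B f) = q (Cod B f) \<cdot> FAr G f \<cdot> \<eta> (Dom B f)"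
      using f S qA O by (intro Comp_assoc) auto
    also have "\<dots> = q (Cod B f) \<cdot> \<eta> (Cod B f) \<cdot> FAr F f" using S(7)[OF f] by simp
    also have "\<dots> = (q (Cod B f) \<cdot> \<eta> (Cod B f)) \<cdot> FAr F f"
      using f S qA O by (intro Comp_assoc[symmetric]) auto
    also have "q (Cod B f) \<cdot> \<eta> (Cod B f) = zer (FOb F (Cod B f)) (Cod C (q (Cod B f)))"
      using qA(4)[OF O(2)] S(5)[OF O(2)] by (simp add: kills_def)
    finally have "kills (q (Cod B f) \<cdot> FAr G f) (\<eta> (Dom B f))"
      using f S qA O by (simp add: kills_def)
    then show "\<exists>h\<in>Hom C (Cod C (q (Dom B f))) (Cod C (q (Cod B f))). h \<cdot> q (Dom B f) = q (Cod B f) \<cdot> FAr G f"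
      using uni[OF O(1), of "q (Cod B f) \<cdot> FAr G f"] f S qA O by simp
  qed (use qA in auto)
  note T = is_nattransD[OF D]
  have "is_cokernel (Fct B C) (F, G, \<eta>) (G, D, \<lambda>X\<in>Ob B. q X)"
    unfolding is_cokernel_def
  proof (intro conjI allI ballI impI)
    show "is_zero_arrow (Fct B C) (Comp (Fct B C) (G, D, \<lambda>X\<in>Ob B. q X) (F, G, \<eta>))"
      using nattrans_Comp[OF \<eta> D] qA T S by (simp add: Comp_Fct zero_arrow_Fct_iff kills_def)
    fix Z x assume "x \<in> Hom (Fct B C) (Cod (Fct B C) (F, G, \<eta>)) Z"
      and z: "is_zero_arrow (Fct B C) (Comp (Fct B C) x (F, G, \<eta>))"
    then obtain \<theta> where x: "x = (G, Z, \<theta>)" and \<theta>: "is_nattrans B C (G, Z, \<theta>)" by (auto simp: Hom_Fct)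
    note Th = is_nattransD[OF \<theta>]
    have k\<theta>: "kills (\<theta> X) (\<eta> X)" if "X \<in> Ob B" for X
      using z nattrans_Comp[OF \<eta> \<theta>] that S Th unfolding x by (simp add: Comp_Fct zero_arrow_Fct_iff kills_def)
    define a where "a X = (SOME h. h \<in> Hom C (Cod C (q X)) (Cod C (\<theta> X)) \<and> h \<cdot> q X = \<theta> X)" for X
    have a0: "a X \<in> Hom C (Cod C (q X)) (Cod C (\<theta> X)) \<and> a X \<cdot> q X = \<theta> X" if "X \<in> Ob B" for X
      unfolding a_def by (rule someI_ex) (use uni[OF that, of "\<theta> X"] k\<theta>[OF that] Th that in blast)
    have a: "a X \<in> Ar C \<and> Dom C (a X) = FOb D X \<and> Cod C (a X) = FOb Z X \<and> a X \<cdot> q X = \<theta> X" if "X \<in> Ob B" for X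
      using a0[OF that] T(6)[OF that] Th(6)[OF that] that by (auto simp: Hom_iff)
    have aN: "is_nattrans B C (D, Z, \<lambda>X\<in>Ob B. a X)"
    proof (rule is_nattransI)
      fix f assume f: "f \<in> Ar B"
      then have O: "Dom B f \<in> Ob B" "Cod B f \<in> Ob B" by auto
      note A = a[OF O(1)] a[OF O(2)]
      have cq: "Cod C (q X) = FOb D X" if "X \<in> Ob B" for X using T(6)[OF that] that by simp
      have "a (Cod B f) \<cdot> FAr D f = FAr Z f \<cdot> a (Dom B f)"
      proof (rule epiD[OF qA(3)[OF O(1)]])
        have "(a (Cod B f) \<cdot> FAr D f) \<cdot> q (Dom B f) = a (Cod B f) \<cdot> FAr D f \<cdot> q (Dom B f)"
          using f S T A O qA cq by (intro Comp_assoc) auto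
        also have "FAr D f \<cdot> q (Dom B f) = q (Cod B f) \<cdot> FAr G f" using T(7)[OF f] O by simp
        also have "a (Cod B f) \<cdot> q (Cod B f) \<cdot> FAr G f = (a (Cod B f) \<cdot> q (Cod B f)) \<cdot> FAr G f"
          using f S T A O qA cq by (intro Comp_assoc[symmetric]) auto
        also have "\<dots> = \<theta> (Cod B f) \<cdot> FAr G f" using A by simp
        also have "\<dots> = FAr Z f \<cdot> \<theta> (Dom B f)" by (rule Th(7)[OF f])
        also have "\<dots> = FAr Z f \<cdot> a (Dom B f) \<cdot> q (Dom B f)" using A by simp
        also have "\<dots> = (FAr Z f \<cdot> a (Dom B f)) \<cdot> q (Dom B f)"
          using f S T A O qA cq Th by (intro Comp_assoc[symmetric]) auto
        finally show "(a (Cod B f) \<cdot> FAr D f) \<cdot> q (Dom B f) = (FAr Z f \<cdot> a (Dom B f)) \<cdot> q (Dom B f)" .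
      qed (use f S T A O cq Th in auto)
      then show "(\<lambda>X\<in>Ob B. a X) (Cod B f) \<cdot> FAr D f = FAr Z f \<cdot> (\<lambda>X\<in>Ob B. a X) (Dom B f)" using O by simp
    qed (use T Th a in auto)
    show "\<exists>!h. h \<in> Hom (Fct B C) (Cod (Fct B C) (G, D, \<lambda>X\<in>Ob B. q X)) Z \<and>
        Comp (Fct B C) h (G, D, \<lambda>X\<in>Ob B. q X) = x"
    proof (rule ex1I)
      have "(\<lambda>X\<in>Ob B. a X \<cdot> q X) = \<theta>"
        by (rule extensionalityI[OF _ Th(3)]) (use a in auto)
      then show "(D, Z, \<lambda>X\<in>Ob B. a X) \<in> Hom (Fct B C) (Cod (Fct B C) (G, D, \<lambda>X\<in>Ob B. q X)) Z \<and>
        Comp (Fct B C) (D, Z, \<lambda>X\<in>Ob B. a X) (G, D, \<lambda>X\<in>Ob B. q X) = x"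
        using aN by (simp add: Hom_Fct Comp_Fct x cong: restrict_cong)
      fix h assume "h \<in> Hom (Fct B C) (Cod (Fct B C) (G, D, \<lambda>X\<in>Ob B. q X)) Z \<and>
        Comp (Fct B C) h (G, D, \<lambda>X\<in>Ob B. q X) = x"
      then obtain \<zeta> where h: "h = (D, Z, \<zeta>)" and \<zeta>: "is_nattrans B C (D, Z, \<zeta>)"
        and e: "(\<lambda>X\<in>Ob B. \<zeta> X \<cdot> q X) = \<theta>"
        by (auto simp: Hom_Fct Comp_Fct x cong: restrict_cong)
      have "\<zeta> = (\<lambda>X\<in>Ob B. a X)"
      proof (rule nattrans_eqI[OF \<zeta> aN])
        fix X assume X: "X \<in> Ob B"
        have "\<zeta> X \<cdot> q X = a X \<cdot> q X" using fun_cong[OF e, of X] a[OF X] X by simp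
        then show "\<zeta> X = (\<lambda>X\<in>Ob B. a X) X"
          using epiD[OF qA(3)[OF X], of "\<zeta> X" "a X"] a[OF X] is_nattransD[OF \<zeta>] T(6)[OF X] X by simp
      qed
      then show "h = (D, Z, \<lambda>X\<in>Ob B. a X)" using h by simp
    qed
  qed (use D in auto)
  then show thesis using that D q by simp
qed

text \<open>\<open>is_delta\<close> admits any cokernel, so an arbitrary one is compared with the
  pointwise one through \<open>\<alpha>\<close> and \<open>\<beta>\<close>, and the properties of
  the components are carried over.\<close>

lemma cokernel_Fct_component:
  assumes \<eta>: "is_nattrans B C (F, G, \<eta>)" and x: "is_cokernel (Fct B C) (F, G, \<eta>) x"
  obtains D q where "x = (G, D, q)" "is_nattrans B C (G, D, q)"
    "\<And>X. X \<in> Ob B \<Longrightarrow> is_epi C (q X)" "\<And>X. X \<in> Ob B \<Longrightarrow> kills (q X) (\<eta> X)"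
    "\<And>X g. X \<in> Ob B \<Longrightarrow> g \<in> Ar C \<Longrightarrow> Dom C g = FOb G X \<Longrightarrow> kills g (\<eta> X) \<Longrightarrow>
       \<exists>h\<in>Hom C (FOb D X) (Cod C g). h \<cdot> q X = g"
proof -
  note S = is_nattransD[OF \<eta>]
  obtain D' q' where c': "is_cokernel (Fct B C) (F, G, \<eta>) (G, D', q')" and q': "is_nattrans B C (G, D', q')"
    and cp: "\<And>X. X \<in> Ob B \<Longrightarrow> is_cokernel C (\<eta> X) (q' X)"
    using ex_cokernel_Fct[OF \<eta>] by blast
  note T' = is_nattransD[OF q']
  have cq': "is_epi C (q' X)" "kills (q' X) (\<eta> X)"
    "\<And>g. g \<in> Ar C \<Longrightarrow> Dom C g = FOb G X \<Longrightarrow> kills g (\<eta> X) \<Longrightarrow> \<exists>h\<in>Hom C (FOb D' X) (Cod C g). h \<cdot> q' X = g"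
    if "X \<in> Ob B" for X
    using cokernel_iff[OF S(4)[OF that] cp[OF that]] S(6)[OF that] T'(6)[OF that] by auto
  have x1: "x \<in> Ar (Fct B C)" "Dom (Fct B C) x = G" "is_zero_arrow (Fct B C) (Comp (Fct B C) x (F, G, \<eta>))"
    and xu: "\<And>Z g. g\<in>Hom (Fct B C) G Z \<Longrightarrow> is_zero_arrow (Fct B C) (Comp (Fct B C) g (F, G, \<eta>)) \<Longrightarrow>
        (\<exists>!h. h \<in> Hom (Fct B C) (Cod (Fct B C) x) Z \<and> Comp (Fct B C) h x = g)"
    using x unfolding is_cokernel_def Cod_Fct by blast+
  have x1': "is_zero_arrow (Fct B C) (Comp (Fct B C) (G, D', q') (F, G, \<eta>))"
    and xu': "\<And>Z g. g\<in>Hom (Fct B C) G Z \<Longrightarrow> is_zero_arrow (Fct B C) (Comp (Fct B C) g (F, G, \<eta>)) \<Longrightarrow>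
        (\<exists>!h. h \<in> Hom (Fct B C) D' Z \<and> Comp (Fct B C) h (G, D', q') = g)"
    using c' unfolding is_cokernel_def Cod_Fct by blast+
  obtain D q where xe: "x = (G, D, q)" using x1(2) by (cases x) auto
  have q: "is_nattrans B C (G, D, q)" using x1(1) xe by simp
  note T = is_nattransD[OF q]
  have H: "(G, D, q) \<in> Hom (Fct B C) G D" "(G, D', q') \<in> Hom (Fct B C) G D'"
    using q q' by (auto simp: Hom_Fct)
  obtain \<alpha> where \<alpha>: "is_nattrans B C (D, D', \<alpha>)" "Comp (Fct B C) (D, D', \<alpha>) (G, D, q) = (G, D', q')"
    using xu[OF H(2) x1'] unfolding xe Cod_Fct by (auto simp: Hom_Fct)
  obtain \<beta> where \<beta>: "is_nattrans B C (D', D, \<beta>)" "Comp (Fct B C) (D', D, \<beta>) (G, D', q') = (G, D, q)"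
    using xu'[OF H(1) x1(3)[unfolded xe]] by (auto simp: Hom_Fct)
  note A = is_nattransD[OF \<alpha>(1)] and Bt = is_nattransD[OF \<beta>(1)]
  have \<alpha>q: "\<alpha> X \<cdot> q X = q' X" and \<beta>q: "\<beta> X \<cdot> q' X = q X" if "X \<in> Ob B" for X
  proof -
    have "(\<lambda>X\<in>Ob B. \<alpha> X \<cdot> q X) = q'" "(\<lambda>X\<in>Ob B. \<beta> X \<cdot> q' X) = q"
      using \<alpha>(2) \<beta>(2) unfolding Comp_Fct by simp_all
    from fun_cong[OF this(1), of X] fun_cong[OF this(2), of X] that
    show "\<alpha> X \<cdot> q X = q' X" "\<beta> X \<cdot> q' X = q X" by simp_all
  qed
  \<comment> \<open>The composite of \<open>\<alpha>\<close> and \<open>\<beta>\<close> and the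
    identity of \<open>D\<close> both factor \<open>x\<close> through itself, so the universal
    property identifies them.\<close>
  have "Comp (Fct B C) (Comp (Fct B C) (D', D, \<beta>) (D, D', \<alpha>)) (G, D, q) = (G, D, q)"
  proof -
    have "(\<beta> X \<cdot> \<alpha> X) \<cdot> q X = q X" if "X \<in> Ob B" for X
      using Comp_assoc[of "q X" "\<alpha> X" "\<beta> X"] A Bt T that \<alpha>q \<beta>q by simp
    then show ?thesis using T(3) by (auto simp: Comp_Fct intro!: extensionalityI[of _ "Ob B"])
  qed
  moreover have "Comp (Fct B C) (D', D, \<beta>) (D, D', \<alpha>) \<in> Hom (Fct B C) D D"
    using nattrans_Comp[OF \<alpha>(1) \<beta>(1)] by (simp add: Hom_Fct Comp_Fct)
  moreover have "Comp (Fct B C) (Id (Fct B C) D) (G, D, q) = (G, D, q)" "Id (Fct B C) D \<in> Hom (Fct B C) D D"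
    using cat.Comp_Id_left[OF Fct_cat, of "(G, D, q)" D] cat.Id_Hom[OF Fct_cat, of D] q T(2) by auto
  moreover have "\<exists>!h. h \<in> Hom (Fct B C) D D \<and> Comp (Fct B C) h (G, D, q) = (G, D, q)"
    using xu[OF H(1) x1(3)[unfolded xe]] unfolding xe by simp
  ultimately have "Comp (Fct B C) (D', D, \<beta>) (D, D', \<alpha>) = Id (Fct B C) D" by blast
  then have e: "(\<lambda>X\<in>Ob B. \<beta> X \<cdot> \<alpha> X) = (\<lambda>X\<in>Ob B. Id C (FOb D X))" by (simp add: Comp_Fct Id_Fct)
  have \<beta>\<alpha>: "\<beta> X \<cdot> \<alpha> X = Id C (FOb D X)" if "X \<in> Ob B" for X using fun_cong[OF e, of X] that by simp
  show thesis
  proof (rule that[OF xe q])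
    fix X assume X: "X \<in> Ob B"
    show "is_epi C (q X)"
      unfolding is_epi_def
    proof (intro conjI allI ballI impI)
      fix Z g h assume "g \<in> Hom C (Cod C (q X)) Z" "h \<in> Hom C (Cod C (q X)) Z" and e: "g \<cdot> q X = h \<cdot> q X"
      then have gh: "g \<in> Ar C" "h \<in> Ar C" "Dom C g = FOb D X" "Dom C h = FOb D X" "Cod C g = Cod C h"
        using T(6)[OF X] by (auto simp: Hom_iff)
      have "(g \<cdot> \<beta> X) \<cdot> q' X = (h \<cdot> \<beta> X) \<cdot> q' X"
        using Comp_assoc[of "q' X" "\<beta> X"] gh Bt T' X \<beta>q[OF X] e by simp
      then have "g \<cdot> \<beta> X = h \<cdot> \<beta> X"
        using epiD[OF cq'(1)[OF X], of "g \<cdot> \<beta> X" "h \<cdot> \<beta> X"] gh Bt T' X by simp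
      then have "(g \<cdot> \<beta> X) \<cdot> \<alpha> X = (h \<cdot> \<beta> X) \<cdot> \<alpha> X" by simp
      then show "g = h" using Comp_assoc[of "\<alpha> X" "\<beta> X"] gh Bt A X \<beta>\<alpha>[OF X] by simp
    qed (use T X in auto)
    have "kills (\<beta> X \<cdot> q' X) (\<eta> X)"
      using kills_Comp_left[OF cq'(2)[OF X], of "\<beta> X"] T' S Bt X by simp
    then show "kills (q X) (\<eta> X)" using \<beta>q[OF X] by simp
    fix g assume g: "g \<in> Ar C" "Dom C g = FOb G X" "kills g (\<eta> X)"
    then obtain h where h: "h \<in> Hom C (FOb D' X) (Cod C g)" "h \<cdot> q' X = g" using cq'(3)[OF X] by blast
    have "(h \<cdot> \<alpha> X) \<cdot> q X = g"
      using Comp_assoc[of "q X" "\<alpha> X" h] h A T X \<alpha>q[OF X] by (simp add: Hom_iff)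
    moreover have "h \<cdot> \<alpha> X \<in> Hom C (FOb D X) (Cod C g)" using h A X by (simp add: Hom_iff)
    ultimately show "\<exists>h\<in>Hom C (FOb D X) (Cod C g). h \<cdot> q X = g" by blast
  qed
qed

end

section \<open>Functors on \<open>\<Theta>\<close> and strong polynomiality\<close>

lemma Ob_Theta [simp]: "Ob Theta = UNIV"
  and Dom_Theta [simp]: "Dom Theta (m, n, f) = m"
  and Cod_Theta [simp]: "Cod Theta (m, n, f) = n"
  and Ar_Theta: "(m, n, f) \<in> Ar Theta \<longleftrightarrow> f \<in> {1..m} \<rightarrow>\<^sub>E {1..n} \<and> inj_on f {1..m}"
  and Id_Theta: "Id Theta n = (n, n, \<lambda>i\<in>{1..n}. i)"
  and Comp_Theta: "Comp Theta (n', p, g) (m, n, f) = (m, p, \<lambda>i\<in>{1..m}. g (f i))"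
  by (simp_all add: Theta_def)

lemma restrict_Ar_Theta:
  assumes "\<And>i. i \<in> {1..m} \<Longrightarrow> f i \<in> {1..n}"
    "\<And>i j. i \<in> {1..m} \<Longrightarrow> j \<in> {1..m} \<Longrightarrow> f i = f j \<Longrightarrow> i = j"
  shows "(m, n, \<lambda>i\<in>{1..m}. f i) \<in> Ar Theta"
  unfolding Ar_Theta inj_on_restrict_eq
proof
  show "inj_on f {1..m}" by (rule inj_onI) (rule assms(2))
  show "(\<lambda>i\<in>{1..m}. f i) \<in> {1..m} \<rightarrow>\<^sub>E {1..n}" 
    using assms(1) by (simp add: restrict_PiE_iff)
qed

lemma Theta_cat: "is_category Theta"
  unfolding is_category_def
proof (intro conjI allI ballI impI)
  show "Id Theta n \<in> Hom Theta n n" for n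
    by (auto simp: Hom_def Id_Theta Ar_Theta inj_on_def)
  show "Comp Theta g f \<in> Hom Theta X Z" if fg: "f \<in> Hom Theta X Y \<and> g \<in> Hom Theta Y Z" for X Y Z f g
  proof -
    obtain \<phi> \<psi> where *: "f = (X, Y, \<phi>)" "g = (Y, Z, \<psi>)" "f \<in> Ar Theta" "g \<in> Ar Theta"
      using fg by (cases f; cases g) (auto simp: Hom_def)
    then have \<phi>: "\<phi> \<in> {1..X} \<rightarrow> {1..Y}" "inj_on \<phi> {1..X}" and \<psi>: "\<psi> \<in> {1..Y} \<rightarrow> {1..Z}" "inj_on \<psi> {1..Y}"
      by (auto simp: Ar_Theta PiE_def)
    have "\<phi> ` {1..X} \<subseteq> {1..Y}" using \<phi>(1) by blast
    then have "inj_on (\<psi> \<circ> \<phi>) {1..X}" 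
      by (intro comp_inj_on \<phi>(2) inj_on_subset[OF \<psi>(2)])
    then have "inj_on (\<lambda>i\<in>{1..X}. \<psi> (\<phi> i)) {1..X}" by (simp add: o_def inj_on_restrict_eq)
    then show ?thesis using \<phi>(1) \<psi>(1) unfolding *(1,2) by (auto simp: Hom_def Comp_Theta Ar_Theta)
  qed
  fix X Y f assume "f \<in> Hom Theta X Y"
  then obtain \<phi> where f: "f = (X, Y, \<phi>)" "\<phi> \<in> {1..X} \<rightarrow>\<^sub>E {1..Y}" by (cases f) (auto simp: Hom_def Ar_Theta)
  show "Comp Theta f (Id Theta X) = f" "Comp Theta (Id Theta Y) f = f"
    using f(2) by (force simp: f(1) Id_Theta Comp_Theta PiE_def intro!: extensionalityI[of _ "{1..X}"])+
next
  fix W X Y Z f g h assume *: "f \<in> Hom Theta W X \<and> g \<in> Hom Theta X Y \<and> h \<in> Hom Theta Y Z"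
  then obtain \<phi> \<psi> \<chi> where f: "f = (W, X, \<phi>)" "g = (X, Y, \<psi>)" "h = (Y, Z, \<chi>)"
    by (cases f; cases g; cases h) (auto simp: Hom_def)
  have "\<phi> \<in> {1..W} \<rightarrow> {1..X}" using * by (auto simp: Hom_def Ar_Theta f)
  then have "\<phi> i \<in> {1..X}" if "i \<in> {1..W}" for i using that by blast
  then show "Comp Theta h (Comp Theta g f) = Comp Theta (Comp Theta h g) f"
    unfolding f by (simp add: Comp_Theta cong: restrict_cong)
qed simp_all

lemma finite_Hom_Theta: "finite (Hom Theta m n)"
proof (rule finite_subset)
  show "Hom Theta m n \<subseteq> (\<lambda>f. (m, n, f)) ` ({1..m} \<rightarrow>\<^sub>E {1..n})"
    by (auto simp: Hom_def Ar_Theta)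
qed (auto intro: finite_PiE)

abbreviation "theta_shift x \<equiv> theta_sum (Id Theta x)"
abbreviation "theta_inc x n \<equiv> theta_sum (theta_init x) (Id Theta n)"

lemma theta_shift_eq:
  "theta_shift x (m, n, f) = (x + m, x + n, \<lambda>i\<in>{1..x + m}. if i \<le> x then i else x + f (i - x))"
  by (auto simp: theta_sum_def Id_Theta intro!: restrict_ext)

lemma theta_inc_eq: "theta_inc x n = (n, x + n, \<lambda>i\<in>{1..n}. x + i)"
  by (auto simp: theta_sum_def Id_Theta theta_init_def intro!: restrict_ext)

lemma Dom_theta_shift [simp]: "Dom Theta (theta_shift x f) = x + Dom Theta f"
  and Cod_theta_shift [simp]: "Cod Theta (theta_shift x f) = x + Cod Theta f"
  by (cases f; simp add: theta_shift_eq)+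

lemma theta_shift_Ar [simp]:
  assumes "f \<in> Ar Theta"
  shows "theta_shift x f \<in> Ar Theta"
proof -
  obtain m n \<phi> where f: "f = (m, n, \<phi>)" by (cases f)
  have \<phi>: "\<phi> i \<in> {1..n}" if "i \<in> {1..m}" for i using assms that by (auto simp: f Ar_Theta)
  have inj: "i = j" if "i \<in> {1..m}" "j \<in> {1..m}" "\<phi> i = \<phi> j" for i j
  proof -
    have "inj_on \<phi> {1..m}" using assms by (simp add: f Ar_Theta)
    from inj_onD[OF this that(3,1,2)] show ?thesis .
  qed
  have "(if i \<le> x then i else x + \<phi> (i - x)) \<in> {1..x + n}" if "i \<in> {1..x + m}" for i
  proof (cases "i \<le> x")
    case False
    then have "i - x \<in> {1..m}" using that by auto
    from \<phi>[OF this] False show ?thesis by simp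
  qed (use that in auto)
  moreover have "i = j" if "i \<in> {1..x + m}" "j \<in> {1..x + m}"
    "(if i \<le> x then i else x + \<phi> (i - x)) = (if j \<le> x then j else x + \<phi> (j - x))" for i j
  proof -
    have p: "1 \<le> \<phi> (l - x)" if "x < l" "l \<in> {1..x + m}" for l
    proof -
      have "l - x \<in> {1..m}" using that by auto
      from \<phi>[OF this] show ?thesis by simp
    qed
    show ?thesis
    proof (cases "i \<le> x \<or> j \<le> x")
      case True
      then show ?thesis using that(3) p[of i] p[of j] that(1,2) by (auto split: if_splits)
    next
      case False
      then have e: "\<phi> (i - x) = \<phi> (j - x)" "i - x \<in> {1..m}" "j - x \<in> {1..m}" using that by auto
      have "i - x = j - x" by (rule inj[OF e(2,3,1)])
      then show ?thesis using False by linarith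
    qed
  qed
  ultimately show ?thesis unfolding f theta_shift_eq by (rule restrict_Ar_Theta)
qed

lemma theta_shift_Id: "theta_shift x (Id Theta n) = Id Theta (x + n)"
  by (auto simp: Id_Theta[of n] theta_shift_eq) (auto simp: Id_Theta intro!: restrict_ext)

lemma theta_shift_Comp:
  assumes "f \<in> Ar Theta" "g \<in> Ar Theta" "Cod Theta f = Dom Theta g"
  shows "theta_shift x (Comp Theta g f) = Comp Theta (theta_shift x g) (theta_shift x f)"
proof -
  obtain m n \<phi> p \<psi> where f: "f = (m, n, \<phi>)" "g = (n, p, \<psi>)" using assms(3) by (cases f; cases g) auto
  have \<phi>: "\<phi> i \<in> {1..n}" if "i \<in> {1..m}" for i using assms that by (auto simp: f Ar_Theta)
  have "(if i \<le> x then i else x + (\<lambda>i\<in>{1..m}. \<psi> (\<phi> i)) (i - x)) =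
      (\<lambda>i\<in>{1..x + n}. if i \<le> x then i else x + \<psi> (i - x)) (if i \<le> x then i else x + \<phi> (i - x))"
    if "i \<in> {1..x + m}" for i
    using \<phi>[of "i - x"] that by (cases "i \<le> x") auto
  then show ?thesis unfolding f theta_shift_eq Comp_Theta by (auto intro!: restrict_ext)
qed

lemma theta_inc_Ar [simp]: "theta_inc x n \<in> Ar Theta"
  by (auto simp: theta_inc_eq Ar_Theta inj_on_def)

lemma Dom_theta_inc [simp]: "Dom Theta (theta_inc x n) = n"
  and Cod_theta_inc [simp]: "Cod Theta (theta_inc x n) = x + n"
  by (simp_all add: theta_inc_eq)

lemma theta_inc_natural:
  assumes "f \<in> Ar Theta"
  shows "Comp Theta (theta_inc x (Cod Theta f)) f = Comp Theta (theta_shift x f) (theta_inc x (Dom Theta f))"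
proof -
  obtain m n \<phi> where f: "f = (m, n, \<phi>)" by (cases f)
  have \<phi>: "\<phi> i \<in> {1..n}" if "i \<in> {1..m}" for i using assms that by (auto simp: f Ar_Theta)
  then show ?thesis
    unfolding f by (simp add: theta_shift_eq theta_inc_eq Comp_Theta cong: restrict_cong)
qed

text \<open>The part of \<open>f\<close> that lands in the summand \<open>n\<close> of \<open>x \<oplus> n\<close> is an injection of a subset of the
  source; it is a proper subset unless \<open>f\<close> misses \<open>x\<close>.\<close>

lemma theta_factor:
  assumes f: "f \<in> Ar Theta" "Dom Theta f = m" "Cod Theta f = x + n"
  obtains (inc) g where "g \<in> Ar Theta" "Dom Theta g = m" "Cod Theta g = n" "f = Comp Theta (theta_inc x n) g"
  | (shift) k g h where "k < m" "g \<in> Ar Theta" "Dom Theta g = k" "Cod Theta g = n"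
      "h \<in> Ar Theta" "Dom Theta h = m" "Cod Theta h = x + k" "f = Comp Theta (theta_shift x g) h"
proof -
  obtain \<phi> where fe: "f = (m, x + n, \<phi>)" using f by (cases f) auto
  have \<phi>: "\<phi> i \<in> {1..x + n}" if "i \<in> {1..m}" for i using f(1) that by (auto simp: fe Ar_Theta)
  have inj: "i = j" if "i \<in> {1..m}" "j \<in> {1..m}" "\<phi> i = \<phi> j" for i j
  proof -
    have "inj_on \<phi> {1..m}" using f(1) by (simp add: fe Ar_Theta)
    from inj_onD[OF this that(3,1,2)] show ?thesis .
  qed
  have ext: "\<phi> = (\<lambda>i\<in>{1..m}. \<phi> i)" using f(1) by (auto simp: fe Ar_Theta)
  define M where "M = {i \<in> {1..m}. x < \<phi> i}"
  have M: "finite M" "M \<subseteq> {1..m}" by (auto simp: M_def)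
  show thesis
  proof (cases "M = {1..m}")
    case True
    have gt: "x < \<phi> i" if "i \<in> {1..m}" for i
    proof -
      have "i \<in> M" using that True by simp
      then show ?thesis by (simp add: M_def)
    qed
    let ?g = "(m, n, \<lambda>i\<in>{1..m}. \<phi> i - x)"
    have v: "\<phi> i - x \<in> {1..n}" if "i \<in> {1..m}" for i using \<phi>[OF that] gt[OF that] by auto
    have "i = j" if "i \<in> {1..m}" "j \<in> {1..m}" "\<phi> i - x = \<phi> j - x" for i j
      using inj[OF that(1,2)] gt[OF that(1)] gt[OF that(2)] that(3) by simp
    with v have "?g \<in> Ar Theta" by (rule restrict_Ar_Theta)
    moreover have "f = Comp Theta (theta_inc x n) ?g"
    proof -
      have "(\<lambda>i\<in>{1..m}. \<phi> i) = (\<lambda>i\<in>{1..m}. (\<lambda>i\<in>{1..n}. x + i) ((\<lambda>i\<in>{1..m}. \<phi> i - x) i))"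
        using v gt by (intro restrict_ext) (auto simp: less_imp_le)
      then show ?thesis using ext by (simp add: fe theta_inc_eq Comp_Theta)
    qed
    ultimately show thesis by (intro inc[of ?g]) auto
  next
    case False
    define k where "k = card M"
    have "k < card {1..m}" unfolding k_def using M False by (intro psubset_card_mono) auto
    then have km: "k < m" by simp
    obtain b where b: "bij_betw b {1..k} M" 
      using ex_bij_betw_nat_finite_1[OF M(1)] unfolding k_def by (rule exE)
    define c where "c = inv_into {1..k} b"
    have c: "bij_betw c M {1..k}" unfolding c_def by (rule bij_betw_inv_into[OF b])
    have bc: "b (c i) = i" if "i \<in> M" for i
      unfolding c_def by (rule bij_betw_inv_into_right[OF b that])
    have cM: "c i \<in> {1..k}" if "i \<in> M" for i using c that by (auto simp: bij_betw_def)
    have bM: "b l \<in> {1..m}" "x < \<phi> (b l)" if "l \<in> {1..k}" for l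
      using b that by (auto simp: bij_betw_def M_def)
    \<comment> \<open>\<open>?h\<close> keeps the values in \<open>x\<close> and sends the points of
      \<open>M\<close> to their numbers in \<open>{1..k}\<close>, placed after \<open>x\<close>;
      \<open>?g\<close> is \<open>\<phi>\<close> on \<open>M\<close>, read through this
      numbering.\<close>
    let ?g = "(k, n, \<lambda>l\<in>{1..k}. \<phi> (b l) - x)"
    let ?h = "(m, x + k, \<lambda>i\<in>{1..m}. if \<phi> i \<le> x then \<phi> i else x + c i)"
    have gv: "\<phi> (b l) - x \<in> {1..n}" if "l \<in> {1..k}" for l
      using \<phi>[OF bM(1)[OF that]] bM(2)[OF that] by auto
    have "l = l'" if l: "l \<in> {1..k}" "l' \<in> {1..k}" "\<phi> (b l) - x = \<phi> (b l') - x" for l l'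
    proof -
      have "\<phi> (b l) = \<phi> (b l')" using l(3) bM(2)[OF l(1)] bM(2)[OF l(2)] by simp
      then have e: "b l = b l'" by (rule inj[OF bM(1)[OF l(1)] bM(1)[OF l(2)]])
      have "inj_on b {1..k}" using b by (simp add: bij_betw_def)
      from inj_onD[OF this e l(1,2)] show ?thesis .
    qed
    with gv have g: "?g \<in> Ar Theta" by (rule restrict_Ar_Theta)
    have hv: "(if \<phi> i \<le> x then \<phi> i else x + c i) \<in> {1..x + k}" if "i \<in> {1..m}" for i
      using \<phi>[OF that] cM[of i] that by (auto simp: M_def)
    have "i = j" if i: "i \<in> {1..m}" "j \<in> {1..m}"
      "(if \<phi> i \<le> x then \<phi> i else x + c i) = (if \<phi> j \<le> x then \<phi> j else x + c j)" for i j
    proof (cases "i \<in> M \<and> j \<in> M")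
      case True
      then have "c i = c j" using i(3) by (auto simp: M_def)
      then show ?thesis using bc True by metis
    next
      case False
      then have "\<phi> i = \<phi> j" using i cM[of i] cM[of j] by (auto simp: M_def split: if_splits)
      then show ?thesis using inj i by blast
    qed
    with hv have h: "?h \<in> Ar Theta" by (rule restrict_Ar_Theta)
    have e: "(\<lambda>i\<in>{1..m}. \<phi> i) = (\<lambda>i\<in>{1..m}. (\<lambda>i\<in>{1..x + k}. if i \<le> x then i else x + (\<lambda>l\<in>{1..k}. \<phi> (b l) - x) (i - x))
         ((\<lambda>i\<in>{1..m}. if \<phi> i \<le> x then \<phi> i else x + c i) i))"
    proof (rule restrict_ext)
      fix i assume i: "i \<in> {1..m}"
      show "\<phi> i = (\<lambda>i\<in>{1..x + k}. if i \<le> x then i else x + (\<lambda>l\<in>{1..k}. \<phi> (b l) - x) (i - x))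
         ((\<lambda>i\<in>{1..m}. if \<phi> i \<le> x then \<phi> i else x + c i) i)"
      proof (cases "\<phi> i \<le> x")
        case True then show ?thesis using \<phi>[OF i] i by auto
      next
        case False
        then have "i \<in> M" using i by (auto simp: M_def)
        then have "1 \<le> c i" "c i \<le> k" "b (c i) = i" using cM bc by auto
        then show ?thesis using False i by simp
      qed
    qed
    have "f = Comp Theta (theta_shift x ?g) ?h"
      unfolding fe theta_shift_eq Comp_Theta by (rule arg_cong[OF trans[OF ext e]])
    then show thesis using km g h by (intro shift[of k ?g ?h]) auto
  qed
qed

section \<open>Strong polynomiality as joint epicity\<close>

locale abelian_theta = abelian_functors C add zer Theta
  for C :: "('o, 'm) category" and add zer
begin

lemma FOb_shift [simp]: "FOb (shift x F) n = FOb F (x + n)"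
  by (simp add: shift_def)

lemma shift_functor:
  assumes F: "is_functor Theta C F"
  shows "is_functor Theta C (shift x F)"
  unfolding is_functor_def
proof (intro conjI ballI allI impI)
  fix X Y Z f g assume "f \<in> Hom Theta X Y \<and> g \<in> Hom Theta Y Z"
  then have "f \<in> Ar Theta" "g \<in> Ar Theta" "Cod Theta f = Dom Theta g" by (auto simp: Hom_def)
  then show "FAr (shift x F) (Comp Theta g f) = FAr (shift x F) g \<cdot> FAr (shift x F) f"
    by (simp add: shift_def theta_shift_Comp is_functorD(6)[OF F])
qed (use F in \<open>auto simp: shift_def theta_shift_Id is_functorD(5)[OF F]\<close>)

lemma shift_map_nattrans:
  assumes F: "is_functor Theta C F"
  shows "is_nattrans Theta C (F, shift x F, \<lambda>n. FAr F (theta_inc x n))"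
proof (rule is_nattransI)
  fix f assume f: "f \<in> Ar Theta"
  have "FAr F (theta_inc x (Cod Theta f)) \<cdot> FAr F f = FAr F (Comp Theta (theta_inc x (Cod Theta f)) f)"
    using f by (intro is_functorD(6)[OF F, symmetric]) auto
  also have "\<dots> = FAr F (Comp Theta (theta_shift x f) (theta_inc x (Dom Theta f)))"
    using theta_inc_natural[OF f] by simp
  also have "\<dots> = FAr F (theta_shift x f) \<cdot> FAr F (theta_inc x (Dom Theta f))"
    using f by (intro is_functorD(6)[OF F]) auto
  finally show "FAr F (theta_inc x (Cod Theta f)) \<cdot> FAr F f = FAr (shift x F) f \<cdot> FAr F (theta_inc x (Dom Theta f))"
    using f by (simp add: shift_def)
qed (use F shift_functor[OF F] in \<open>auto simp: shift_def\<close>)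

text \<open>Tested on arrows \<open>r\<close> out of the value, so that no coproduct is formed. The
  bound is an integer to match \<open>Pol_fort\<close>: for \<open>n < 0\<close> no \<open>f\<close>
  qualifies and the condition says that \<open>F\<close> is zero.\<close>

definition jointly_epic_upto where
  "jointly_epic_upto F n \<longleftrightarrow>
    (\<forall>j. \<forall>r\<in>Ar C. Dom C r = FOb F j \<longrightarrow>
       (\<forall>f\<in>Ar Theta. Cod Theta f = j \<longrightarrow> int (Dom Theta f) \<le> n \<longrightarrow> kills r (FAr F f)) \<longrightarrow>
       r = zer (FOb F j) (Cod C r))"

lemma jointly_epic_uptoD:
  assumes "jointly_epic_upto F n" "r \<in> Ar C" "Dom C r = FOb F j"
    "\<And>f. f \<in> Ar Theta \<Longrightarrow> Cod Theta f = j \<Longrightarrow> int (Dom Theta f) \<le> n \<Longrightarrow> kills r (FAr F f)"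
  shows "r = zer (FOb F j) (Cod C r)"
  using assms unfolding jointly_epic_upto_def by blast

text \<open>Let \<open>r\<close> kill all admissible arrows into \<open>F (1 \<oplus> j)\<close>. By
  the inner induction, on \<open>j\<close>, it vanishes on \<open>F j\<close>, so it factors through
  the value of \<open>\<delta>\<^sub>1 F\<close> at \<open>j\<close>; there the outer induction, on
  \<open>n\<close>, applies.\<close>

lemma Pol_fort_imp_jointly_epic:
  "F \<in> Pol_fort C n \<Longrightarrow> jointly_epic_upto F n"
\<comment> \<open>\<open>nat (n + 1)\<close> sends every negative \<open>n\<close> to the base
  case.\<close>
proof (induction "nat (n + 1)" arbitrary: n F)
  case 0
  then have "is_zero_object (Fct Theta C) F" by (simp add: Pol_fort.simps[of C n])
  then have Z: "is_functor Theta C F" "\<And>j. Id C (FOb F j) = zer (FOb F j) (FOb F j)"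
    by (auto simp: zero_object_Fct_iff)
  have "r = zer (FOb F j) (Cod C r)" if r: "r \<in> Ar C" "Dom C r = FOb F j" for r j
  proof -
    have "r = r \<cdot> Id C (FOb F j)" using r by simp
    also have "\<dots> = zer (FOb F j) (Cod C r)" unfolding Z(2) using r Z(1) by simp
    finally show ?thesis .
  qed
  then show ?case unfolding jointly_epic_upto_def by blast
next
  case (Suc k)
  have n: "0 \<le> n" "k = nat (n - 1 + 1)" using Suc.hyps(2) by auto
  have F: "is_functor Theta C F" and "\<exists>D. is_delta C 1 F D \<and> D \<in> Pol_fort C (n - 1)"
    using Suc.prems n by (auto simp: Pol_fort.simps[of C n])
  then obtain D x where D: "D \<in> Pol_fort C (n - 1)"
    and x: "is_cokernel (Fct Theta C) (shift_map 1 F) x" "Cod (Fct Theta C) x = D"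
    unfolding is_delta_def by blast
  have epi: "jointly_epic_upto D (n - 1)" using Suc.hyps(1)[OF n(2) D] .
  have q: "\<exists>q. is_nattrans Theta C (shift 1 F, D, q) \<and> (\<forall>j. is_epi C (q j)) \<and>
    (\<forall>j g. g \<in> Ar C \<longrightarrow> Dom C g = FOb F (Suc j) \<longrightarrow> kills g (FAr F (theta_inc 1 j)) \<longrightarrow>
       (\<exists>h\<in>Hom C (FOb D j) (Cod C g). h \<cdot> q j = g))"
    by (rule cokernel_Fct_component[OF shift_map_nattrans[OF F, of 1] x(1)[unfolded shift_map_def]])
      (use x(2) in \<open>auto simp: shift_def\<close>)
  then obtain q where q: "is_nattrans Theta C (shift 1 F, D, q)" "\<And>j. is_epi C (q j)"
    and uni: "\<And>j g. g \<in> Ar C \<Longrightarrow> Dom C g = FOb F (Suc j) \<Longrightarrow> kills g (FAr F (theta_inc 1 j)) \<Longrightarrow>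
       \<exists>h\<in>Hom C (FOb D j) (Cod C g). h \<cdot> q j = g"
    by blast
  note Q = is_nattransD[OF q(1), simplified]
  have "r = zer (FOb F j) (Cod C r)"
    if "r \<in> Ar C" "Dom C r = FOb F j"
      "\<And>f. f \<in> Ar Theta \<Longrightarrow> Cod Theta f = j \<Longrightarrow> int (Dom Theta f) \<le> n \<Longrightarrow> kills r (FAr F f)" for r j
    using that
  proof (induction j arbitrary: r)
    case 0
    \<comment> \<open>Nothing lies below \<open>j = 0\<close>, but the identity of \<open>0\<close>
      is itself admissible because \<open>0 \<le> n\<close>.\<close>
    have "kills r (FAr F (Id Theta 0))" using 0(3)[of "Id Theta 0"] n by simp
    then show ?case using 0 F is_functorD(5)[OF F] by (simp add: kills_def)
  next
    case (Suc j)
    let ?i = "theta_inc 1 j"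
    have "r \<cdot> FAr F ?i = zer (FOb F j) (Cod C (r \<cdot> FAr F ?i))"
    proof (rule Suc.IH)
      fix f assume f: "f \<in> Ar Theta" "Cod Theta f = j" "int (Dom Theta f) \<le> n"
      have "kills r (FAr F (Comp Theta ?i f))" using f by (intro Suc.prems(3)) auto
      then show "kills (r \<cdot> FAr F ?i) (FAr F f)"
        using f F Suc.prems Comp_assoc[of "FAr F f" "FAr F ?i" r] is_functorD(6)[OF F f(1), of ?i]
        by (simp add: kills_def)
    qed (use F Suc.prems in auto)
    then have "kills r (FAr F ?i)" using F Suc.prems by (simp add: kills_def)
    then obtain h where h: "h \<in> Hom C (FOb D j) (Cod C r)" "h \<cdot> q j = r" using uni Suc.prems by blast
    then have hA: "h \<in> Ar C" "Dom C h = FOb D j" "Cod C h = Cod C r" by (auto simp: Hom_iff)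
    have "h = zer (FOb D j) (Cod C h)"
    proof (rule jointly_epic_uptoD[OF epi hA(1,2)])
      fix f assume f: "f \<in> Ar Theta" "Cod Theta f = j" "int (Dom Theta f) \<le> n - 1"
      have s: "FAr (shift 1 F) f = FAr F (theta_shift 1 f)" using f by (simp add: shift_def)
      \<comment> \<open>The shift raises the source of \<open>f\<close> by one, from at most
        \<open>n - 1\<close> to at most \<open>n\<close>.\<close>
      have "kills r (FAr F (theta_shift 1 f))" using f by (intro Suc.prems(3)) auto
      then have "r \<cdot> FAr F (theta_shift 1 f) = zer (FOb F (Suc (Dom Theta f))) (Cod C r)"
        using f F by (simp add: kills_def)
      \<comment> \<open>Naturality of \<open>q\<close> replaces \<open>f\<close> by its shift; the
        epic component of \<open>q\<close> is cancelled afterwards.\<close>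
      moreover have "(h \<cdot> FAr D f) \<cdot> q (Dom Theta f) = r \<cdot> FAr F (theta_shift 1 f)"
      proof -
        have "(h \<cdot> FAr D f) \<cdot> q (Dom Theta f) = h \<cdot> FAr D f \<cdot> q (Dom Theta f)"
          using hA f Q by (intro Comp_assoc) auto
        also have "\<dots> = h \<cdot> q j \<cdot> FAr F (theta_shift 1 f)" using Q(7)[OF f(1)] s f(2) by simp
        also have "\<dots> = (h \<cdot> q j) \<cdot> FAr F (theta_shift 1 f)"
          using hA f Q F by (intro Comp_assoc[symmetric]) auto
        finally show ?thesis using h(2) by simp
      qed
      ultimately have e: "(h \<cdot> FAr D f) \<cdot> q (Dom Theta f) =
          zer (FOb D (Dom Theta f)) (Cod C r) \<cdot> q (Dom Theta f)"
        using Q hA Suc.prems(1) by simp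
      have "h \<cdot> FAr D f = zer (FOb D (Dom Theta f)) (Cod C r)"
        by (rule epiD[OF q(2) _ _ _ _ _ e]) (use hA f Q Suc.prems in auto)
      then show "kills h (FAr D f)" using hA f Q by (simp add: kills_def)
    qed
    then have "h \<cdot> q j = zer (FOb D j) (Cod C r) \<cdot> q j" using hA by simp
    also have "\<dots> = zer (FOb F (Suc j)) (Cod C r)" using Q Suc.prems by (simp add: shift_def)
    finally show ?case using h(2) by simp
  qed
  then show ?case unfolding jointly_epic_upto_def by blast
qed

text \<open>An arrow \<open>r\<close> out of \<open>D j\<close> is tested through
  \<open>r \<cdot> q j\<close> on \<open>F (x \<oplus> j)\<close>, where \<open>theta_factor\<close>
  splits every injection: one part is killed by \<open>q j\<close>, the other passes to
  \<open>D\<close> by naturality of \<open>q\<close>.\<close>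

lemma jointly_epic_imp_Pol_fort:
  "is_functor Theta C F \<Longrightarrow> jointly_epic_upto F n \<Longrightarrow> F \<in> Pol_fort C n"
proof (induction "nat (n + 1)" arbitrary: n F)
  case 0
  have "Id C (FOb F j) = zer (FOb F j) (FOb F j)" for j
    using jointly_epic_uptoD[OF 0(3), of "Id C (FOb F j)" j] 0 by simp
  then have "is_zero_object (Fct Theta C) F" using 0 by (simp add: zero_object_Fct_iff)
  then show ?case using 0 by (simp add: Pol_fort.simps[of C n])
next
  case (Suc k)
  have n: "0 \<le> n" "k = nat (n - 1 + 1)" using Suc.hyps(2) by auto
  note F = Suc.prems(1)
  have "\<exists>D. is_delta C x F D \<and> D \<in> Pol_fort C (n - 1)" for x
  proof -
    obtain D q where c: "is_cokernel (Fct Theta C) (shift_map x F) (shift x F, D, q)"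
      and q: "is_nattrans Theta C (shift x F, D, q)"
      and cp: "\<And>j. is_cokernel C (FAr F (theta_inc x j)) (q j)"
      using ex_cokernel_Fct[OF shift_map_nattrans[OF F, of x]] unfolding shift_map_def by auto
    note Q = is_nattransD[OF q, simplified]
    have cq: "is_epi C (q j)" "kills (q j) (FAr F (theta_inc x j))" for j
      using cokernel_iff[OF _ cp[of j]] F by auto
    have "jointly_epic_upto D (n - 1)"
      unfolding jointly_epic_upto_def
    proof (intro allI ballI impI)
      fix j r assume r: "r \<in> Ar C" "Dom C r = FOb D j"
        and "\<forall>f\<in>Ar Theta. Cod Theta f = j \<longrightarrow> int (Dom Theta f) \<le> n - 1 \<longrightarrow> kills r (FAr D f)"
      then have kr: "kills r (FAr D f)"
        if "f \<in> Ar Theta" "Cod Theta f = j" "int (Dom Theta f) \<le> n - 1" for f using that by blast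
      have "r \<cdot> q j = zer (FOb F (x + j)) (Cod C (r \<cdot> q j))"
      proof (rule jointly_epic_uptoD[OF Suc.prems(2)])
        fix f assume f: "f \<in> Ar Theta" "Cod Theta f = x + j" "int (Dom Theta f) \<le> n"
        show "kills (r \<cdot> q j) (FAr F f)"
          using f(1) refl f(2)
        proof (cases rule: theta_factor)
          case (inc g)
          have "kills (r \<cdot> q j) (FAr F (theta_inc x j))"
            by (rule kills_Comp_left[OF cq(2)]) (use r Q F in auto)
          then have "kills (r \<cdot> q j) (FAr F (theta_inc x j) \<cdot> FAr F g)"
            by (rule kills_Comp_right) (use r Q F inc(1-3) in auto)
          then show ?thesis unfolding inc(4) using is_functorD(6)[OF F inc(1), of "theta_inc x j"] inc(1,3) by simp
        next
          case (shift k g h)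
          have s: "FAr (shift x F) g = FAr F (theta_shift x g)" using shift(2) by (simp add: shift_def)
          \<comment> \<open>The strict inequality \<open>k < m\<close>, together with
            \<open>m \<le> n\<close>, gives the bound \<open>n - 1\<close>.\<close>
          have "kills r (FAr D g)" using kr[of g] shift(1-4) f(3) by simp
          then have "kills r (FAr D g \<cdot> q k)"
            by (rule kills_Comp_right) (use r Q F shift(2-7) in auto)
          moreover have "FAr D g \<cdot> q k = q j \<cdot> FAr F (theta_shift x g)"
            using Q(7)[OF shift(2)] shift(3,4) s by simp
          ultimately have "kills (r \<cdot> q j) (FAr F (theta_shift x g))"
            using Comp_assoc[of "FAr F (theta_shift x g)" "q j" r] r Q F shift(2-4) by (simp add: kills_def)
          then have "kills (r \<cdot> q j) (FAr F (theta_shift x g) \<cdot> FAr F h)"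
            by (rule kills_Comp_right) (use r Q F shift(2-7) in auto)
          then show ?thesis unfolding shift(8) using is_functorD(6)[OF F shift(5), of "theta_shift x g"] shift(2,3,7) by simp
        qed
      qed (use r Q in auto)
      then have e: "r \<cdot> q j = zer (FOb D j) (Cod C r) \<cdot> q j" using r Q by simp
      show "r = zer (FOb D j) (Cod C r)"
        by (rule epiD[OF cq(1) _ _ _ _ _ e]) (use r Q in auto)
    qed
    then have "D \<in> Pol_fort C (n - 1)" using Suc.hyps(1)[OF n(2)] Q(2) by blast
    then show ?thesis using c unfolding is_delta_def by auto
  qed
  then show ?case using n F by (simp add: Pol_fort.simps[of C n])
qed

end

section \<open>Functors of finite type\<close>

context abelian_functors
begin

lemma subobject_component_le:
  assumes x: "x \<in> subobjects (Fct B C) F" and f: "f \<in> Ar B"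
  shows "sub_le C (FAr F f \<cdot> component x (Dom B f)) (component x (Cod B f))"
proof -
  obtain H \<eta> where x: "x = (H, F, \<eta>)" and \<eta>: "is_nattrans B C (H, F, \<eta>)"
    using x by (auto simp: subobjects_Fct_iff)
  note S = is_nattransD[OF \<eta>]
  have "sub_le C (\<eta> (Cod B f) \<cdot> FAr H f) (\<eta> (Cod B f))"
    using S f by (intro sub_le_Comp) auto
  then show ?thesis using S(7)[OF f] by (simp add: x)
qed

end

locale grothendieck_functors = grothendieck C add zer u G + abelian_functors C add zer B
  for C :: "('o, 'm) category" and add zer and u :: "'u itself" and G and B :: "('p, 'a) category"
begin

text \<open>One construction for three subfunctors used below: the union of a family, the subfunctor
  generated by the values up to \<open>n\<close>, and the largest one whose value at
  \<open>i\<close> lies in \<open>s\<close>. The sets \<open>T X\<close> may be large, and stability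
  is required only up to factorisation.\<close>

lemma span_subfunctor:
  assumes F: "is_functor B C F"
    and T: "\<And>X t. X \<in> Ob B \<Longrightarrow> t \<in> T X \<Longrightarrow> t \<in> Ar C \<and> Cod C t = FOb F X"
    and closed: "\<And>f t. f \<in> Ar B \<Longrightarrow> t \<in> T (Dom B f) \<Longrightarrow> \<exists>t'\<in>T (Cod B f). sub_le C (FAr F f \<cdot> t) t'"
  obtains x where "x \<in> subobjects (Fct B C) F" "\<And>X. X \<in> Ob B \<Longrightarrow> is_span (FOb F X) (T X) (component x X)"
proof -
  define s where "s X = (SOME s. is_span (FOb F X) (T X) s)" for X
  have s: "is_span (FOb F X) (T X) (s X)" if "X \<in> Ob B" for X
    unfolding s_def by (rule someI_ex) (rule ex_span, use T F that in auto)
  then have sub: "s X \<in> subobjects C (FOb F X)" if "X \<in> Ob B" for X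
    using that by (simp add: is_span_def)
  obtain H where H: "is_nattrans B C (H, F, \<lambda>X\<in>Ob B. s X)"
  proof (rule subfunctor[OF F sub])
    fix f assume f: "f \<in> Ar B"
    then have O: "Dom B f \<in> Ob B" "Cod B f \<in> Ob B" by auto
    show "sub_le C (FAr F f \<cdot> s (Dom B f)) (s (Cod B f))"
    proof (rule span_comp_left[OF s[OF O(1)] T[OF O(1)]])
      fix t assume t: "t \<in> T (Dom B f)"
      then obtain t' where t': "t' \<in> T (Cod B f)" "sub_le C (FAr F f \<cdot> t) t'" using closed f by blast
      moreover have "sub_le C t' (s (Cod B f))" "s (Cod B f) \<in> Ar C"
        using s[OF O(2)] sub[OF O(2)] t'(1) by (auto simp: is_span_def subobjects_iff)
      ultimately show "sub_le C (FAr F f \<cdot> t) (s (Cod B f))" using sub_le_trans by blast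
    qed (use f F sub O in auto)
  qed
  have "(H, F, \<lambda>X\<in>Ob B. s X) \<in> subobjects (Fct B C) F"
    using H sub by (auto simp: subobjects_Fct_iff)
  then show thesis by (rule that) (use s in simp)
qed

text \<open>Unions of subfunctors are pointwise: the pointwise sums form a subfunctor
  \<open>v\<close> above all members of \<open>S\<close>. Hence \<open>v\<close> is all of
  \<open>F\<close>, which is then read off at \<open>X\<close>.\<close>

lemma union_Fct_component:
  assumes F: "is_functor B C F" and S: "directed_subobjects (Fct B C) F S"
    "is_union (Fct B C) F S (Id (Fct B C) F)" and X: "X \<in> Ob B"
  shows "directed_subobjects C (FOb F X) ((\<lambda>x. component x X) ` S)"
    "is_union C (FOb F X) ((\<lambda>x. component x X) ` S) (Id C (FOb F X))"
proof -
  have sub: "x \<in> subobjects (Fct B C) F" if "x \<in> S" for x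
    using S(1) that by (auto simp: directed_subobjects_def)
  have csub: "(\<lambda>x. component x X) ` S \<subseteq> subobjects C (FOb F X)" if "X \<in> Ob B" for X
    using subobjects_component sub that by blast
  show "directed_subobjects C (FOb F X) ((\<lambda>x. component x X) ` S)"
    unfolding directed_subobjects_def
  proof (intro conjI ballI csub[OF X])
    show "(\<lambda>x. component x X) ` S \<noteq> {}" using S(1) by (simp add: directed_subobjects_def)
    fix s t assume "s \<in> (\<lambda>x. component x X) ` S" "t \<in> (\<lambda>x. component x X) ` S"
    then obtain x y where xy: "x \<in> S" "y \<in> S" "s = component x X" "t = component y X" by blast
    obtain z where z: "z \<in> S" "sub_le (Fct B C) x z" "sub_le (Fct B C) y z"
      using cat.directedE[OF Fct_cat S(1) xy(1,2)] by blast
    then have "sub_le C s (component z X)" "sub_le C t (component z X)"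
      using sub_le_Fct_component_iff sub xy X by blast+
    then show "\<exists>w\<in>(\<lambda>x. component x X) ` S. sub_le C s w \<and> sub_le C t w" using z(1) by blast
  qed
  obtain v where v: "v \<in> subobjects (Fct B C) F"
    "\<And>X. X \<in> Ob B \<Longrightarrow> is_span (FOb F X) ((\<lambda>x. component x X) ` S) (component v X)"
  proof (rule span_subfunctor[OF F])
    show "t \<in> Ar C \<and> Cod C t = FOb F X" if "X \<in> Ob B" "t \<in> (\<lambda>x. component x X) ` S" for X t
      using subsetD[OF csub[OF that(1)] that(2)] by (simp add: subobjects_iff)
    show "\<exists>t'\<in>(\<lambda>x. component x (Cod B f)) ` S. sub_le C (FAr F f \<cdot> t) t'"
      if "f \<in> Ar B" "t \<in> (\<lambda>x. component x (Dom B f)) ` S" for f t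
      using subobject_component_le sub that by blast
  qed blast
  have "sub_le (Fct B C) x v" if "x \<in> S" for x
    using v(2) that sub_le_Fct_component_iff[OF sub[OF that] v(1)] by (auto simp: is_span_def)
  then have "sub_le (Fct B C) (Id (Fct B C) F) v"
    using S(2) v(1) unfolding is_union_def by blast
  then have le: "sub_le C (Id C (FOb F X)) (component v X)"
    using Id_sub_le_Fct_iff[OF F v(1)] X by blast
  show "is_union C (FOb F X) ((\<lambda>x. component x X) ` S) (Id C (FOb F X))"
    unfolding cat.is_union_Id_iff[OF cat_axioms functor_simps(1)[OF F X] csub[OF X]]
  proof (intro ballI impI)
    fix w assume w: "w \<in> subobjects C (FOb F X)" "\<forall>s\<in>(\<lambda>x. component x X) ` S. sub_le C s w"
    then have "sub_le C (component v X) w" using v(2)[OF X] by (auto simp: is_span_def)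
    then show "sub_le C (Id C (FOb F X)) w" using sub_le_trans[OF le] w(1) by (auto simp: subobjects_iff)
  qed
qed

end

section \<open>Generation in bounded cardinality and finite type\<close>

locale grothendieck_theta = grothendieck_functors C add zer u G Theta + abelian_theta C add zer
  for C :: "('o, 'm) category" and add zer and u :: "'u itself" and G
begin

text \<open>The span of this set is the value at \<open>j\<close> of the subfunctor generated by the
  values of \<open>F\<close> up to \<open>n\<close>.\<close>

definition arrows_upto where
  "arrows_upto F n j = FAr F ` {f \<in> Ar Theta. Cod Theta f = j \<and> int (Dom Theta f) \<le> n}"

lemma arrows_upto_Cod:
  assumes "is_functor Theta C F" "t \<in> arrows_upto F n j"
  shows "t \<in> Ar C \<and> Cod C t = FOb F j"
  using assms by (auto simp: arrows_upto_def)

lemma ex_generated_subfunctor: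
  assumes F: "is_functor Theta C F"
  obtains x where "x \<in> subobjects (Fct Theta C) F"
    "\<And>j. is_span (FOb F j) (arrows_upto F n j) (component x j)"
proof (rule span_subfunctor[OF F, of "arrows_upto F n"])
  show "\<exists>t'\<in>arrows_upto F n (Cod Theta f). sub_le C (FAr F f \<cdot> t) t'"
    if f: "f \<in> Ar Theta" and t: "t \<in> arrows_upto F n (Dom Theta f)" for f t
  proof -
    obtain g where g: "g \<in> Ar Theta" "Cod Theta g = Dom Theta f" "int (Dom Theta g) \<le> n" "t = FAr F g"
      using t by (auto simp: arrows_upto_def)
    \<comment> \<open>Composing with \<open>f\<close> leaves the source of \<open>g\<close>
      unchanged, so the bound is kept.\<close>
    have "FAr F (Comp Theta f g) \<in> arrows_upto F n (Cod Theta f)"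
      unfolding arrows_upto_def using f g by (intro imageI CollectI) simp
    then have "FAr F f \<cdot> t \<in> arrows_upto F n (Cod Theta f)"
      using is_functorD(6)[OF F g(1) f g(2)] g(4) by simp
    then show ?thesis using arrows_upto_Cod[OF F] sub_le_refl by blast
  qed
qed (use arrows_upto_Cod[OF F] that in auto)

lemma Id_le_generated:
  assumes F: "is_functor Theta C F" and x: "is_span (FOb F i) (arrows_upto F n i) s" and i: "int i \<le> n"
  shows "sub_le C (Id C (FOb F i)) s"
proof -
  have "FAr F (Id Theta i) \<in> arrows_upto F n i" 
    unfolding arrows_upto_def using i by (intro imageI CollectI) simp
  then show ?thesis using x is_functorD(5)[OF F, of i] by (auto simp: is_span_def)
qed

lemma jointly_epic_if_Id_le_generated:
  assumes F: "is_functor Theta C F" and x: "\<And>j. is_span (FOb F j) (arrows_upto F n j) (s j)"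
    and le: "\<And>j. sub_le C (Id C (FOb F j)) (s j)"
  shows "jointly_epic_upto F n"
  unfolding jointly_epic_upto_def
proof (intro allI ballI impI)
  fix j r assume r: "r \<in> Ar C" "Dom C r = FOb F j"
    and k: "\<forall>f\<in>Ar Theta. Cod Theta f = j \<longrightarrow> int (Dom Theta f) \<le> n \<longrightarrow> kills r (FAr F f)"
  have "kills r (s j)"
    by (rule kills_span[OF x arrows_upto_Cod[OF F] r]) (use k in \<open>auto simp: arrows_upto_def\<close>)
  then show "r = zer (FOb F j) (Cod C r)"
    using kills_Id_sub_le[OF le] r x[of j] by (auto simp: is_span_def subobjects_iff)
qed

text \<open>One way, the subfunctor generated by the values up to \<open>n\<close> agrees with
  \<open>F\<close> there, hence is \<open>F\<close>. The other way, a subfunctor agreeing with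
  \<open>F\<close> up to \<open>n\<close> contains the image of each \<open>FAr F f\<close> with
  source at most \<open>n\<close>; an arrow that kills its value at \<open>j\<close> therefore kills
  all of these and is zero.\<close>

lemma generated_upto_iff:
  assumes F: "is_functor Theta C F"
  shows "generated_upto C F n \<longleftrightarrow> jointly_epic_upto F n"
proof
  assume gen: "generated_upto C F n"
  obtain x where x: "x \<in> subobjects (Fct Theta C) F"
    "\<And>j. is_span (FOb F j) (arrows_upto F n j) (component x j)"
    using ex_generated_subfunctor[OF F] by blast
  have xs: "component x j \<in> subobjects C (FOb F j)" for j using subobjects_component[OF x(1)] by simp
  have "is_iso C (component x i)" if "int i \<le> n" for i
    using Id_le_generated[OF F x(2) that] xs[of i] is_iso_iff_Id_sub_le by (auto simp: subobjects_iff)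
  then have "is_iso (Fct Theta C) x" using gen x(1) by (simp add: generated_upto_def)
  then have "sub_le (Fct Theta C) (Id (Fct Theta C) F) x"
    using cat.is_iso_iff_Id_sub_le[OF Fct_cat, of x] x(1) by (auto simp: subobjects_def)
  then have "sub_le C (Id C (FOb F j)) (component x j)" for j
    using Id_sub_le_Fct_iff[OF F x(1)] by simp
  then show "jointly_epic_upto F n" by (rule jointly_epic_if_Id_le_generated[OF F x(2)])
next
  assume epi: "jointly_epic_upto F n"
  show "generated_upto C F n"
    unfolding generated_upto_def
  proof (intro ballI impI)
    fix x assume x: "x \<in> subobjects (Fct Theta C) F" and iso: "\<forall>i. int i \<le> n \<longrightarrow> is_iso C (component x i)"
    have xs: "component x j \<in> subobjects C (FOb F j)" for j using subobjects_component[OF x] by simp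
    have xA: "component x j \<in> Ar C" "Cod C (component x j) = FOb F j" "is_mono C (component x j)" for j
      using xs[of j] by (auto simp: subobjects_iff)
    have "sub_le C (Id C (FOb F j)) (component x j)" for j
    proof (rule Id_sub_leI[OF xs])
      fix r assume r: "r \<in> Ar C" "Dom C r = FOb F j" "kills r (component x j)"
      show "r = zer (FOb F j) (Cod C r)"
      proof (rule jointly_epic_uptoD[OF epi r(1,2)])
        fix f assume f: "f \<in> Ar Theta" "Cod Theta f = j" "int (Dom Theta f) \<le> n"
        let ?i = "Dom Theta f"
        have "sub_le C (Id C (FOb F ?i)) (component x ?i)"
          using iso f(3) is_iso_iff_Id_sub_le[OF xA(3), of ?i] xA(2) by simp
        then have "sub_le C (FAr F f \<cdot> Id C (FOb F ?i)) (FAr F f \<cdot> component x ?i)"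
          using F f xA by (intro sub_le_comp_left) auto
        then have "sub_le C (FAr F f) (FAr F f \<cdot> component x ?i)" using F f by simp
        then have "sub_le C (FAr F f) (component x j)"
          using sub_le_trans[OF _ subobject_component_le[OF x f(1)]] xA f(2) by simp
        then show "kills r (FAr F f)" using kills_sub_le[OF r(3)] r(1,2) xA by simp
      qed
    qed
    then have "sub_le (Fct Theta C) (Id (Fct Theta C) F) x"
      using Id_sub_le_Fct_iff[OF F x] by simp
    then show "is_iso (Fct Theta C) x"
      using cat.is_iso_iff_Id_sub_le[OF Fct_cat, of x] x by (auto simp: subobjects_def)
  qed
qed

text \<open>The proof matches degree and bound: through joint epicity they are the same
  \<open>n\<close>.\<close>

lemma strongly_polynomial_iff:
  assumes F: "is_functor Theta C F"
  shows "strongly_polynomial C F \<longleftrightarrow> (\<exists>n. generated_upto C F n)"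
  using generated_upto_iff[OF F] Pol_fort_imp_jointly_epic jointly_epic_imp_Pol_fort[OF F]
  unfolding strongly_polynomial_def by blast

lemma finite_type_imp_generated:
  assumes F: "is_functor Theta C F" and ft: "finite_type (Fct Theta C) F"
  shows "\<exists>n. generated_upto C F n"
proof -
  define P where "P m x \<longleftrightarrow> x \<in> subobjects (Fct Theta C) F \<and>
    (\<forall>j. is_span (FOb F j) (arrows_upto F (int m) j) (component x j))" for m x
  have "\<exists>x. P m x" for m
    using ex_generated_subfunctor[OF F, of "int m"] unfolding P_def by metis
  then obtain x where P: "\<And>m. P m (x m)" by metis
  have x: "x m \<in> subobjects (Fct Theta C) F"
    and sp: "is_span (FOb F j) (arrows_upto F (int m) j) (component (x m) j)" for m j
    using P[of m] by (auto simp: P_def)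
  have xs: "component (x m) j \<in> subobjects C (FOb F j)" for m j using subobjects_component[OF x] by simp
  have mono: "sub_le (Fct Theta C) (x m) (x m')" if "m \<le> m'" for m m'
  proof -
    have "arrows_upto F (int m) j \<subseteq> arrows_upto F (int m') j" for j
      unfolding arrows_upto_def using that by (intro image_mono) auto
    then have "sub_le C (component (x m) j) (component (x m') j)" for j
      using sp[of j m] sp[of j m'] unfolding is_span_def by blast
    then show ?thesis using sub_le_Fct_component_iff[OF x x] by blast
  qed
  have "directed_subobjects (Fct Theta C) F (range x)"
    unfolding directed_subobjects_def
  proof (intro conjI ballI)
    fix s t assume "s \<in> range x" "t \<in> range x"
    then obtain m m' where "s = x m" "t = x m'" by blast
    then show "\<exists>w\<in>range x. sub_le (Fct Theta C) s w \<and> sub_le (Fct Theta C) t w"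
      using mono[of m "max m m'"] mono[of m' "max m m'"] by auto
  qed (use x in auto)
  moreover have "is_union (Fct Theta C) F (range x) (Id (Fct Theta C) F)"
  proof (subst cat.is_union_Id_iff[OF Fct_cat])
    show "\<forall>v\<in>subobjects (Fct Theta C) F. (\<forall>s\<in>range x. sub_le (Fct Theta C) s v) \<longrightarrow>
        sub_le (Fct Theta C) (Id (Fct Theta C) F) v"
    proof (intro ballI impI)
      fix v assume v: "v \<in> subobjects (Fct Theta C) F" "\<forall>s\<in>range x. sub_le (Fct Theta C) s v"
      \<comment> \<open>Stage \<open>j\<close> already has the full value at \<open>j\<close>,
        because \<open>Id Theta j\<close> is among its generating arrows.\<close>
      have "sub_le C (Id C (FOb F j)) (component v j)" for j
      proof -
        have "sub_le C (component (x j) j) (component v j)"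
          using v(2) sub_le_Fct_component_iff[OF x v(1)] by auto
        moreover have "component v j \<in> Ar C"
          using subobjects_component[OF v(1), of j] by (simp add: subobjects_iff)
        ultimately show ?thesis using sub_le_trans[OF Id_le_generated[OF F sp, of j j]] by simp
      qed
      then show "sub_le (Fct Theta C) (Id (Fct Theta C) F) v" using Id_sub_le_Fct_iff[OF F v(1)] by blast
    qed
  qed (use F x in auto)
  ultimately obtain m where "sub_le (Fct Theta C) (Id (Fct Theta C) F) (x m)"
    using ft unfolding cat.finite_type_iff[OF Fct_cat] by blast
  then have "sub_le C (Id C (FOb F j)) (component (x m) j)" for j
    using Id_sub_le_Fct_iff[OF F x] by simp
  then have "jointly_epic_upto F (int m)" by (rule jointly_epic_if_Id_le_generated[OF F sp])
  then show ?thesis using generated_upto_iff[OF F] by blast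
qed

text \<open>The subfunctor \<open>x s\<close> below is the largest one whose value at \<open>i\<close> lies in \<open>s\<close>. It is given at \<open>j\<close>
  by preimages of \<open>s\<close> along the maps from \<open>Hom Theta j i\<close>, and AB5 applies because this set is finite.\<close>

lemma finite_type_component:
  assumes F: "is_functor Theta C F" and ft: "finite_type (Fct Theta C) F"
  shows "finite_type C (FOb F i)"
  unfolding finite_type_iff
proof (intro conjI allI impI)
  show FO: "FOb F i \<in> Ob C" using F by simp
  fix S assume "directed_subobjects C (FOb F i) S \<and> is_union C (FOb F i) S (Id C (FOb F i))"
  then have S: "directed_subobjects C (FOb F i) S" "is_union C (FOb F i) S (Id C (FOb F i))" by auto
  have SA: "s \<in> Ar C" "s \<in> subobjects C (FOb F i)" if "s \<in> S" for s
    using S that unfolding directed_subobjects_def by (auto simp: subobjects_iff)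
  \<comment> \<open>Arbitrary arrows \<open>m\<close>, not just monomorphisms; their span is the
    value at \<open>j\<close> of the subfunctor \<open>x s\<close>.\<close>
  define T where "T s j = {m \<in> Ar C. Cod C m = FOb F j \<and> (\<forall>f\<in>Hom Theta j i. sub_le C (FAr F f \<cdot> m) s)}" for s j
  define P where "P s x \<longleftrightarrow> x \<in> subobjects (Fct Theta C) F \<and>
    (\<forall>j. is_span (FOb F j) (T s j) (component x j))" for s x
  have "\<exists>x. P s x" for s
  proof -
    obtain x where "x \<in> subobjects (Fct Theta C) F" "\<And>j. j \<in> Ob Theta \<Longrightarrow> is_span (FOb F j) (T s j) (component x j)"
    proof (rule span_subfunctor[OF F, of "T s"])
      fix f t assume f: "f \<in> Ar Theta" and t: "t \<in> T s (Dom Theta f)"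
      have tA: "t \<in> Ar C" "Cod C t = FOb F (Dom Theta f)" using t by (auto simp: T_def)
      have "FAr F f \<cdot> t \<in> T s (Cod Theta f)"
        unfolding T_def
      proof (intro CollectI conjI ballI)
        fix g assume "g \<in> Hom Theta (Cod Theta f) i"
        then have g: "g \<in> Ar Theta" "Dom Theta g = Cod Theta f" "Cod Theta g = i" by (auto simp: Hom_def)
        have "FAr F g \<cdot> FAr F f \<cdot> t = (FAr F g \<cdot> FAr F f) \<cdot> t"
          using f g F tA by (intro Comp_assoc[symmetric]) auto
        also have "\<dots> = FAr F (Comp Theta g f) \<cdot> t" using is_functorD(6)[OF F f g(1)] g by simp
        finally have e: "FAr F g \<cdot> FAr F f \<cdot> t = FAr F (Comp Theta g f) \<cdot> t" .
        \<comment> \<open>Testing the composite of \<open>FAr F f\<close> and \<open>t\<close> on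
          \<open>g\<close> is testing \<open>t\<close> on \<open>Comp Theta g f\<close>; this is the
          stability of \<open>T s\<close>.\<close>
        have "Comp Theta g f \<in> Hom Theta (Dom Theta f) i" using f g by (simp add: Hom_def)
        then show "sub_le C (FAr F g \<cdot> FAr F f \<cdot> t) s" using t unfolding e T_def by blast
      qed (use f F tA in auto)
      moreover have "FAr F f \<cdot> t \<in> Ar C" using f F tA by simp
      ultimately show "\<exists>t'\<in>T s (Cod Theta f). sub_le C (FAr F f \<cdot> t) t'" using sub_le_refl by blast
    qed (auto simp: T_def)
    then show ?thesis unfolding P_def Ob_Theta by blast
  qed
  then obtain x where P: "\<And>s. P s (x s)" by metis
  have x: "x s \<in> subobjects (Fct Theta C) F"
    and sp: "is_span (FOb F j) (T s j) (component (x s) j)" for s j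
    using P[of s] by (auto simp: P_def)
  have mono: "sub_le (Fct Theta C) (x s) (x t)" if st: "s \<in> S" "t \<in> S" "sub_le C s t" for s t
  proof -
    have "T s j \<subseteq> T t j" for j
      using sub_le_trans[OF _ st(3) SA(1)[OF st(2)]] unfolding T_def by blast
    then have "sub_le C (component (x s) j) (component (x t) j)" for j
      using sp[of j s] sp[of j t] unfolding is_span_def by blast
    then show ?thesis using sub_le_Fct_component_iff[OF x x] by blast
  qed
  have "directed_subobjects (Fct Theta C) F (x ` S)"
    unfolding directed_subobjects_def
  proof (intro conjI ballI)
    show "x ` S \<noteq> {}" using S(1) by (simp add: directed_subobjects_def)
    fix y z assume "y \<in> x ` S" "z \<in> x ` S"
    then obtain s t where st: "s \<in> S" "t \<in> S" "y = x s" "z = x t" by blast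
    obtain w where "w \<in> S" "sub_le C s w" "sub_le C t w" using directedE[OF S(1) st(1,2)] by blast
    then show "\<exists>w\<in>x ` S. sub_le (Fct Theta C) y w \<and> sub_le (Fct Theta C) z w" using mono st by blast
  qed (use x in auto)
  moreover have "is_union (Fct Theta C) F (x ` S) (Id (Fct Theta C) F)"
  proof (subst cat.is_union_Id_iff[OF Fct_cat])
    show "\<forall>v\<in>subobjects (Fct Theta C) F. (\<forall>s\<in>x ` S. sub_le (Fct Theta C) s v) \<longrightarrow>
        sub_le (Fct Theta C) (Id (Fct Theta C) F) v"
    proof (intro ballI impI)
      fix v assume v: "v \<in> subobjects (Fct Theta C) F" "\<forall>s\<in>x ` S. sub_le (Fct Theta C) s v"
      have "sub_le C (Id C (FOb F j)) (component v j)" for j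
      proof (rule preimages_directed_union[OF FO S, of "FAr F ` Hom Theta j i"])
        show "finite (FAr F ` Hom Theta j i)" using finite_Hom_Theta by simp
        show "f \<in> Hom C (FOb F j) (FOb F i)" if "f \<in> FAr F ` Hom Theta j i" for f
          using that F by (auto simp: Hom_def)
        show "FOb F j \<in> Ob C" using F by simp
        show vj: "component v j \<in> subobjects C (FOb F j)" using subobjects_component[OF v(1)] by simp
        fix s g assume s: "s \<in> S" and g: "g \<in> Ar C" "Cod C g = FOb F j"
          "\<forall>f\<in>FAr F ` Hom Theta j i. sub_le C (f \<cdot> g) s"
        then have "g \<in> T s j" by (simp add: T_def)
        then have "sub_le C g (component (x s) j)" using sp[of j s] by (simp add: is_span_def)
        moreover have "sub_le C (component (x s) j) (component v j)"
          using v s sub_le_Fct_component_iff[OF x v(1)] by auto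
        ultimately show "sub_le C g (component v j)" using sub_le_trans vj by (auto simp: subobjects_iff)
      qed
      then show "sub_le (Fct Theta C) (Id (Fct Theta C) F) v" using Id_sub_le_Fct_iff[OF F v(1)] by blast
    qed
  qed (use F x in auto)
  ultimately obtain s where s: "s \<in> S" "sub_le (Fct Theta C) (Id (Fct Theta C) F) (x s)"
    using ft unfolding cat.finite_type_iff[OF Fct_cat] by blast
  then have "sub_le C (Id C (FOb F i)) (component (x s) i)"
    using Id_sub_le_Fct_iff[OF F x] by simp
  \<comment> \<open>At \<open>i\<close> the identity is one of the tests, so the value of
    \<open>x s\<close> lies in \<open>s\<close>.\<close>
  moreover have "sub_le C (component (x s) i) s"
  proof -
    have "sub_le C t s" if "t \<in> T s i" for t
    proof -
      have "Id Theta i \<in> Hom Theta i i" by (simp add: Hom_def)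
      then have "sub_le C (FAr F (Id Theta i) \<cdot> t) s" using that unfolding T_def by blast
      then show ?thesis using that is_functorD(5)[OF F, of i] by (simp add: T_def)
    qed
    then show ?thesis using sp[of i s] SA(2)[OF s(1)] by (simp add: is_span_def)
  qed
  ultimately show "\<exists>s\<in>S. sub_le C (Id C (FOb F i)) s"
    using s(1) sub_le_trans SA by blast
qed

lemma generated_imp_finite_type:
  assumes F: "is_functor Theta C F" and gen: "generated_upto C F n"
    and ft: "\<And>i. int i \<le> n \<Longrightarrow> finite_type C (FOb F i)"
  shows "finite_type (Fct Theta C) F"
  unfolding cat.finite_type_iff[OF Fct_cat]
proof (intro conjI allI impI)
  show "F \<in> Ob (Fct Theta C)" using F by simp
  fix S assume "directed_subobjects (Fct Theta C) F S \<and> is_union (Fct Theta C) F S (Id (Fct Theta C) F)"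
  then have S: "directed_subobjects (Fct Theta C) F S" "is_union (Fct Theta C) F S (Id (Fct Theta C) F)" by auto
  have sub: "x \<in> subobjects (Fct Theta C) F" if "x \<in> S" for x
    using S(1) that by (auto simp: directed_subobjects_def)
  define K where "K = {i. int i \<le> n}"
  \<comment> \<open>The values at \<open>i\<close> of the members of \<open>S\<close> have union
    \<open>FOb F i\<close>, so finite type yields a member that reaches it.\<close>
  have "\<exists>x\<in>S. sub_le C (Id C (FOb F i)) (component x i)" if "i \<in> K" for i
    using union_Fct_component[OF F S, of i] ft[of i] that unfolding finite_type_iff K_def by auto
  then obtain x where x: "\<And>i. i \<in> K \<Longrightarrow> x i \<in> S \<and> sub_le C (Id C (FOb F i)) (component (x i) i)" by metis
  \<comment> \<open>For negative \<open>n\<close> the set \<open>K\<close> is empty, and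
    \<open>y\<close> is then any member of the nonempty \<open>S\<close>.\<close>
  have "K \<subseteq> {..nat n}" unfolding K_def by auto
  then have "finite K" by (rule finite_subset) simp
  then obtain y where y: "y \<in> S" "\<forall>i\<in>K. sub_le (Fct Theta C) (x i) y"
    using cat.directed_finite_bound[OF Fct_cat S(1), of K x] x by blast
  have yc: "component y i \<in> subobjects C (FOb F i)" for i using subobjects_component[OF sub[OF y(1)]] by simp
  have "is_iso C (component y i)" if "int i \<le> n" for i
  proof -
    have i: "i \<in> K" using that by (simp add: K_def)
    have "sub_le C (component (x i) i) (component y i)"
      using bspec[OF y(2) i] sub_le_Fct_component_iff[OF sub sub[OF y(1)]] x[OF i] by simp
    then have "sub_le C (Id C (FOb F i)) (component y i)"
      using sub_le_trans[OF conjunct2[OF x[OF i]]] yc[of i] by (auto simp: subobjects_iff)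
    then show ?thesis using is_iso_iff_Id_sub_le yc[of i] by (auto simp: subobjects_iff)
  qed
  then have "is_iso (Fct Theta C) y" using gen sub[OF y(1)] by (simp add: generated_upto_def)
  then have "sub_le (Fct Theta C) (Id (Fct Theta C) F) y"
    using cat.is_iso_iff_Id_sub_le[OF Fct_cat, of y] sub[OF y(1)] by (auto simp: subobjects_def)
  then show "\<exists>x\<in>S. sub_le (Fct Theta C) (Id (Fct Theta C) F) x" using y(1) by blast
qed

end

theorem proposition4p10:
  fixes A :: "('o, 'm) category"
  assumes "universe TYPE('u)" and "grothendieck_category TYPE('u) A"
  shows
    "(\<forall>F\<in>Ob (Fct Theta A).
        (finite_type (Fct Theta A) F \<longleftrightarrow>
           (\<exists>n :: int. generated_upto A F n \<and> (\<forall>i. finite_type A (FOb F i)))) \<and>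
        (finite_type (Fct Theta A) F \<longleftrightarrow>
           (\<exists>n :: int. generated_upto A F n \<and> (\<forall>i. int i \<le> n \<longrightarrow> finite_type A (FOb F i))))) \<and>
     (\<forall>F\<in>Ob (Fct Theta A). finite_type (Fct Theta A) F \<longrightarrow> strongly_polynomial A F) \<and>
     (\<forall>F\<in>Ob (Fct Theta A). strongly_polynomial A F \<and> (\<forall>i. finite_type A (FOb F i)) \<longrightarrow>
        finite_type (Fct Theta A) F)"
proof -
  have ab: "abelian_category A" and ab5: "AB5 TYPE('u) A" and gen: "\<exists>G. is_generator TYPE('u) A G"
    using assms(2) unfolding grothendieck_category_def by auto
  have cat: "is_category A" and add: "\<exists>add zer. preadditive A add zer \<and> (\<forall>X\<in>Ob A. \<forall>Y\<in>Ob A. has_biproduct A add X Y)"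
    and rest: "\<exists>Z. is_zero_object A Z" "\<forall>f\<in>Ar A. (\<exists>k. is_kernel A f k) \<and> (\<exists>q. is_cokernel A f q)"
    "\<forall>m. is_mono A m \<longrightarrow> (\<exists>f\<in>Ar A. is_kernel A f m)"
    using ab unfolding abelian_category_def by blast+
  obtain G where G: "is_generator TYPE('u) A G" using gen by blast
  obtain add zer where add: "preadditive A add zer" "\<forall>X\<in>Ob A. \<forall>Y\<in>Ob A. has_biproduct A add X Y"
    using add by blast
  interpret grothendieck_theta A add zer "TYPE('u)" G
    by unfold_locales (use cat add rest G ab5 assms(1) Theta_cat in blast)+
  have fg: "\<exists>n. generated_upto A F n" and fi: "finite_type A (FOb F i)"
    if "F \<in> Ob (Fct Theta A)" "finite_type (Fct Theta A) F" for F i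
    using that finite_type_imp_generated finite_type_component by auto
  \<comment> \<open>Stated with the values up to \<open>n\<close> only, so that it serves both
    criteria and the third claim.\<close>
  have gf: "finite_type (Fct Theta A) F"
    if "F \<in> Ob (Fct Theta A)" "generated_upto A F n" "\<forall>i. int i \<le> n \<longrightarrow> finite_type A (FOb F i)" for F n
    using that generated_imp_finite_type by simp
  have sp: "strongly_polynomial A F \<longleftrightarrow> (\<exists>n. generated_upto A F n)" if "F \<in> Ob (Fct Theta A)" for F
    using that strongly_polynomial_iff by simp
  show ?thesis
  proof (intro conjI ballI impI iffI)
    fix F assume F: "F \<in> Ob (Fct Theta A)"
    show "\<exists>n. generated_upto A F n \<and> (\<forall>i. finite_type A (FOb F i))"
      "\<exists>n. generated_upto A F n \<and> (\<forall>i. int i \<le> n \<longrightarrow> finite_type A (FOb F i))"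
      "strongly_polynomial A F"
      if "finite_type (Fct Theta A) F"
      using fg[OF F that] fi[OF F that] sp[OF F] by auto
    show "finite_type (Fct Theta A) F"
      if "\<exists>n. generated_upto A F n \<and> (\<forall>i. finite_type A (FOb F i))"
      using that gf[OF F] by blast
    show "finite_type (Fct Theta A) F"
      if "\<exists>n. generated_upto A F n \<and> (\<forall>i. int i \<le> n \<longrightarrow> finite_type A (FOb F i))"
      using that gf[OF F] by blast
    show "finite_type (Fct Theta A) F"
      if "strongly_polynomial A F \<and> (\<forall>i. finite_type A (FOb F i))"
      using that gf[OF F] sp[OF F] by blast
  qed
qed

end
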